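(* Let $u$ be a non-negative, locally bounded, local weak solution in $\Omega_T$ to $\partial_t u-\operatorname{div}A(x,t,u,Du)=B(x,t,u,Du)$ under the structure conditions with constants $C_o,C_1>0$, $C\ge 0$, and assume $u\in L^r_{loc}(\Omega_T)$ for some $r>1$. Put $\lambda_r=N(p-2)+pr$. Then there exists a positive constant $\gamma$, depending only on the data $\{N,p_i,C_o,C_1\}$, such that for all $t,\rho>0$ with $\mathcal K_{2\rho}(t)\times[0,t]\subset\Omega_T$, setting $\nu=\left(\frac t{\rho^p}\right)^{\frac1{2-p}}$, either $C^{p_i}\rho^p>\min\{1,\nu^{p-p_i},\nu^p\}$ for some $i\in\{1,\dots,N\}$, or $$\sup_{0\le\tau\le t}\int_{\mathcal K_\rho(t)}u^r(x,\tau)\,dx\le\gamma\int_{\mathcal K_{2\rho}(t)}u^r(x,0)\,dx+\gamma\left(\frac{t^r}{\rho^{\lambda_r}}\right)^{\frac1{2-p}}.$$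
   Context: Setting. $\Omega\subset\mathbb R^N$ is open and bounded, $T>0$, $\Omega_T=\Omega\times[0,T]$. Exponents $1<p_1\le\dots\le p_N<2$; $p=N/\big(\sum_{i=1}^N 1/p_i\big)$ is their harmonic mean, with $p<N$. Equation. $\partial_t u-\operatorname{div}A(x,t,u,Du)=B(x,t,u,Du)$ in $\Omega_T$, where $A=(A_1,\dots,A_N):\Omega_T\times\mathbb R^{N+1}\to\mathbb R^N$ and $B:\Omega_T\times\mathbb R^{N+1}\to\mathbb R$ are Carathéodory functions satisfying, for a.e. $(x,t)\in\Omega_T$, all $(s,\xi)\in\mathbb R\times\mathbb R^N$ and all $i$, the structure conditions $A_i(x,t,s,\xi)\xi_i\ge C_o|\xi_i|^{p_i}-C^{p_i}$, $|A_i(x,t,s,\xi)|\le C_1|\xi_i|^{p_i-1}+C^{p_i-1}$, $|B(x,t,s,\xi)|\le\sum_{i=1}^N C(|\xi_i|^{p_i-1}+C^{p_i-1})$, with constants $C_o,C_1>0$, $C\ge0$. Function spaces. $W^{1,\mathbf p}_{o}(\Omega)=\{u\in W^{1,1}_o(\Omega):\partial_iu\in L^{p_i}_{loc}(\Omega)\}$ and $W^{1,\mathbf p}_{loc}(\Omega)=\{u\in W^{1,1}_{loc}(\Omega):\partial_iu\in L^{p_i}_{loc}(\Omega)\}$; $L^{\mathbf p}_{loc}(0,T;W^{1,\mathbf p}_{loc}(\Omega))$ (resp. with $W^{1,\mathbf p}_o$) is the set of $u\in L^1_{loc}(0,T;W^{1,1}_{loc}(\Omega))$ (resp. $W^{1,1}_o$)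 with $\partial_iu\in L^{p_i}_{loc}(0,T;L^{p_i}_{loc}(\Omega))$ for all $i$. Weak solutions. A local weak sub(super)-solution is $u\in C(0,T;L^2_{loc}(\Omega))\cap L^{\mathbf p}_{loc}(0,T;W^{1,\mathbf p}_{loc}(\Omega))$ such that for all $0\le t_1\le t_2\le T$ and all compact $K\subset\subset\Omega$, $$\int_K u\varphi\,dx\Big|_{t_1}^{t_2}+\int_{t_1}^{t_2}\!\!\int_K\Big\{-u\,\partial_\tau\varphi+\sum_iA_i(x,\tau,u,Du)\,\partial_i\varphi\Big\}dx\,d\tau\le(\ge)\int_{t_1}^{t_2}\!\!\int_KB(x,\tau,u,Du)\varphi\,dx\,d\tau$$ for all non-negative $\varphi\in W^{1,2}_{loc}(0,T;L^2_{loc}(\Omega))\cap L^{\mathbf p}_{loc}(0,T;W^{1,\mathbf p}_o(\Omega))$. A local weak solution is both a sub- and a super-solution. Intrinsic cubes. For $a,\rho,t>0$, $\mathcal K_{a\rho}(t)=\prod_{i=1}^N\big\{|x_i|<a\,\rho^{\frac{p(2-p_i)}{p_i(2-p)}}\,t^{\frac{p_i-p}{(2-p)p_i}}\big\}$ (the factor $a$ multiplies each side; $|\mathcal K_\rho(t)|=(2\rho)^N$).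
   Formalization: The constant γ is allowed to depend also on the fixed exponent r, besides {N, p_i, C_o, C_1}; a γ independent of r is impossible, as explicit separable solutions with u(·,0)=0 show when r tends to infinity. *)

theory Defs
  imports "HOL-Analysis.Analysis"
begin

text \<open>Space-time points are pairs \<open>(x, t) :: (real^'n) \<times> real\<close>, and \<open>\<Omega>\<^sub>T\<close> is \<open>\<Omega> \<times> {0..T}\<close>. As the time
  interval of \<open>\<Omega>\<^sub>T\<close> is closed and the weak formulation is imposed from \<open>t\<^sub>1 = 0\<close> on, ``local in
  time'' means local in \<open>{0..T}\<close>; in space it means local in the open set \<open>\<Omega>\<close>.\<close>

definition Lloc :: "real \<Rightarrow> 'a::euclidean_space set \<Rightarrow> ('a \<Rightarrow> real) \<Rightarrow> bool" where
  "Lloc q S f \<longleftrightarrow> (\<forall>K. compact K \<and> K \<subseteq> S \<longrightarrow>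
     f \<in> borel_measurable (lebesgue_on K) \<and> integrable (lebesgue_on K) (\<lambda>x. \<bar>f x\<bar> powr q))"

definition locally_bounded :: "'a::euclidean_space set \<Rightarrow> ('a \<Rightarrow> real) \<Rightarrow> bool" where
  "locally_bounded S f \<longleftrightarrow> (\<forall>K. compact K \<and> K \<subseteq> S \<longrightarrow> (\<exists>M. AE x in lebesgue_on K. \<bar>f x\<bar> \<le> M))"


subsection \<open>Weak derivatives and Sobolev spaces\<close>

text \<open>\<open>C\<^sup>1\<close> functions with compact support in \<open>S\<close>. By mollification they give the same weak
  derivatives, and the same closure in \<open>W\<^sup>1\<^sup>,\<^sup>1\<close>, as smooth compactly supported functions.\<close>

definition C1c :: "'a::euclidean_space set \<Rightarrow> ('a \<Rightarrow> real) \<Rightarrow> bool" where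
  "C1c S \<psi> \<longleftrightarrow> (\<forall>x. \<psi> differentiable (at x)) \<and>
     (\<forall>v. continuous_on UNIV (\<lambda>x. frechet_derivative \<psi> (at x) v)) \<and>
     compact (closure {x. \<psi> x \<noteq> 0}) \<and> closure {x. \<psi> x \<noteq> 0} \<subseteq> S"

definition weak_deriv ::
  "'a::euclidean_space set \<Rightarrow> 'a \<Rightarrow> ('a \<Rightarrow> real) \<Rightarrow> ('a \<Rightarrow> real) \<Rightarrow> bool" where
  "weak_deriv S v f g \<longleftrightarrow> Lloc 1 S f \<and> Lloc 1 S g \<and>
     (\<forall>\<psi>. C1c S \<psi> \<longrightarrow>
        (\<integral>x. f x * frechet_derivative \<psi> (at x) v \<partial>lebesgue_on S) =
        - (\<integral>x. g x * \<psi> x \<partial>lebesgue_on S))"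

text \<open>\<open>W11loc \<Omega> f g\<close>: \<open>f \<in> W\<^sup>1\<^sup>,\<^sup>1\<close> locally in \<open>\<Omega>\<close>, with weak gradient \<open>g\<close>.\<close>

definition W11loc :: "(real^'n::finite) set \<Rightarrow> (real^'n \<Rightarrow> real) \<Rightarrow> (real^'n \<Rightarrow> real^'n) \<Rightarrow> bool" where
  "W11loc \<Omega> f g \<longleftrightarrow> (\<forall>i. weak_deriv \<Omega> (axis i 1) f (\<lambda>x. g x $ i))"

text \<open>\<open>W11o \<Omega> f g\<close>: \<open>f\<close> lies in the closure of \<open>C1c \<Omega>\<close> in \<open>W\<^sup>1\<^sup>,\<^sup>1(\<Omega>)\<close> and has weak gradient \<open>g\<close>.\<close>

definition W11o :: "(real^'n::finite) set \<Rightarrow> (real^'n \<Rightarrow> real) \<Rightarrow> (real^'n \<Rightarrow> real^'n) \<Rightarrow> bool" where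
  "W11o \<Omega> f g \<longleftrightarrow> W11loc \<Omega> f g \<and>
     integrable (lebesgue_on \<Omega>) f \<and> (\<forall>i. integrable (lebesgue_on \<Omega>) (\<lambda>x. g x $ i)) \<and>
     (\<exists>\<psi>. (\<forall>k::nat. C1c \<Omega> (\<psi> k)) \<and>
        (\<lambda>k. \<integral>x. \<bar>f x - \<psi> k x\<bar> \<partial>lebesgue_on \<Omega>) \<longlonglongrightarrow> 0 \<and>
        (\<forall>i. (\<lambda>k. \<integral>x. \<bar>g x $ i - frechet_derivative (\<psi> k) (at x) (axis i 1)\<bar> \<partial>lebesgue_on \<Omega>)
               \<longlonglongrightarrow> 0))"


subsection \<open>Parabolic function spaces\<close>

text \<open>\<open>C([0,T]; L\<^sup>2)\<close>, locally in \<open>\<Omega>\<close>. The function is the time-continuous representative, so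
  each individual time slice, in particular the one at \<open>0\<close>, is meaningful up to null sets.\<close>

definition C_L2loc :: "(real^'n::finite) set \<Rightarrow> real \<Rightarrow> ((real^'n) \<times> real \<Rightarrow> real) \<Rightarrow> bool" where
  "C_L2loc \<Omega> T u \<longleftrightarrow>
     (\<forall>t\<in>{0..T}. Lloc 2 \<Omega> (\<lambda>x. u (x, t))) \<and>
     (\<forall>K. compact K \<and> K \<subseteq> \<Omega> \<longrightarrow> (\<forall>t\<^sub>0\<in>{0..T}.
        ((\<lambda>t. \<integral>x. (u (x, t) - u (x, t\<^sub>0))\<^sup>2 \<partial>lebesgue_on K) \<longlongrightarrow> 0) (at t\<^sub>0 within {0..T})))"

text \<open>The next two predicates say that \<open>u\<close> belongs to the anisotropic space
  \<open>L\<^sup>p(0,T; W\<^sup>1\<^sup>,\<^sup>p)\<close> of local functions, respectively of functions vanishing on the boundary, and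
  that \<open>Du\<close> is its spatial weak gradient.\<close>

definition Lp_Wloc :: "(real^'n::finite) set \<Rightarrow> real \<Rightarrow> ('n \<Rightarrow> real) \<Rightarrow>
    ((real^'n) \<times> real \<Rightarrow> real) \<Rightarrow> ((real^'n) \<times> real \<Rightarrow> real^'n) \<Rightarrow> bool" where
  "Lp_Wloc \<Omega> T p u Du \<longleftrightarrow>
     (AE t in lebesgue_on {0..T}. W11loc \<Omega> (\<lambda>x. u (x, t)) (\<lambda>x. Du (x, t))) \<and>
     Lloc 1 (\<Omega> \<times> {0..T}) u \<and> (\<forall>i. Lloc 1 (\<Omega> \<times> {0..T}) (\<lambda>z. Du z $ i)) \<and>
     (\<forall>i. Lloc (p i) (\<Omega> \<times> {0..T}) (\<lambda>z. Du z $ i))"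

definition Lp_Wo :: "(real^'n::finite) set \<Rightarrow> real \<Rightarrow> ('n \<Rightarrow> real) \<Rightarrow>
    ((real^'n) \<times> real \<Rightarrow> real) \<Rightarrow> ((real^'n) \<times> real \<Rightarrow> real^'n) \<Rightarrow> bool" where
  "Lp_Wo \<Omega> T p u Du \<longleftrightarrow>
     (AE t in lebesgue_on {0..T}. W11o \<Omega> (\<lambda>x. u (x, t)) (\<lambda>x. Du (x, t))) \<and>
     integrable (lebesgue_on (\<Omega> \<times> {0..T})) u \<and>
     (\<forall>i. integrable (lebesgue_on (\<Omega> \<times> {0..T})) (\<lambda>z. Du z $ i)) \<and>
     (\<forall>i. Lloc (p i) (\<Omega> \<times> {0..T}) (\<lambda>z. Du z $ i))"

text \<open>\<open>W\<^sup>1\<^sup>,\<^sup>2(0,T; L\<^sup>2)\<close>, locally in \<open>\<Omega>\<close>, with weak time derivative \<open>\<phi>\<^sub>t\<close>. Such functions have a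
  representative that is continuous in time with values in \<open>L\<^sup>2\<close>; \<open>C_L2loc\<close> selects it, so that
  the slices at \<open>t\<^sub>1\<close> and \<open>t\<^sub>2\<close> in the weak formulation are the traces.\<close>

definition W12_L2loc :: "(real^'n::finite) set \<Rightarrow> real \<Rightarrow>
    ((real^'n) \<times> real \<Rightarrow> real) \<Rightarrow> ((real^'n) \<times> real \<Rightarrow> real) \<Rightarrow> bool" where
  "W12_L2loc \<Omega> T \<phi> \<phi>\<^sub>t \<longleftrightarrow> C_L2loc \<Omega> T \<phi> \<and>
     Lloc 2 (\<Omega> \<times> {0..T}) \<phi> \<and> Lloc 2 (\<Omega> \<times> {0..T}) \<phi>\<^sub>t \<and>
     weak_deriv (\<Omega> \<times> {0<..<T}) (0, 1) \<phi> \<phi>\<^sub>t"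


subsection \<open>The equation\<close>

definition caratheodory :: "(real^'n::finite) set \<Rightarrow> real \<Rightarrow>
    ((real^'n) \<times> real \<Rightarrow> real \<Rightarrow> real^'n \<Rightarrow> 'b::euclidean_space) \<Rightarrow> bool" where
  "caratheodory \<Omega> T F \<longleftrightarrow>
     (\<forall>s \<xi>. (\<lambda>z. F z s \<xi>) \<in> borel_measurable (lebesgue_on (\<Omega> \<times> {0..T}))) \<and>
     (AE z in lebesgue_on (\<Omega> \<times> {0..T}). continuous_on UNIV (\<lambda>(s, \<xi>). F z s \<xi>))"

definition structure_conditions :: "(real^'n::finite) set \<Rightarrow> real \<Rightarrow> ('n \<Rightarrow> real) \<Rightarrow>
    real \<Rightarrow> real \<Rightarrow> real \<Rightarrow>
    ((real^'n) \<times> real \<Rightarrow> real \<Rightarrow> real^'n \<Rightarrow> real^'n) \<Rightarrow>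
    ((real^'n) \<times> real \<Rightarrow> real \<Rightarrow> real^'n \<Rightarrow> real) \<Rightarrow> bool" where
  "structure_conditions \<Omega> T p C\<^sub>o C\<^sub>1 C A B \<longleftrightarrow>
     (AE z in lebesgue_on (\<Omega> \<times> {0..T}). \<forall>s \<xi>.
        (\<forall>i. A z s \<xi> $ i * \<xi> $ i \<ge> C\<^sub>o * \<bar>\<xi> $ i\<bar> powr p i - C powr p i) \<and>
        (\<forall>i. \<bar>A z s \<xi> $ i\<bar> \<le> C\<^sub>1 * \<bar>\<xi> $ i\<bar> powr (p i - 1) + C powr (p i - 1)) \<and>
        \<bar>B z s \<xi>\<bar> \<le> (\<Sum>i\<in>UNIV. C * (\<bar>\<xi> $ i\<bar> powr (p i - 1) + C powr (p i - 1))))"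

text \<open>The common part of the definitions of sub- and supersolution, with \<open>R\<close> for \<open>\<le>\<close> or \<open>\<ge>\<close>.
  The test function vanishes outside \<open>K\<close>: integrating by parts over \<open>K\<close> without this
  would discard the flux through the boundary of \<open>K\<close>.\<close>

definition weak_inequality :: "(real \<Rightarrow> real \<Rightarrow> bool) \<Rightarrow> (real^'n::finite) set \<Rightarrow> real \<Rightarrow> ('n \<Rightarrow> real) \<Rightarrow>
    ((real^'n) \<times> real \<Rightarrow> real \<Rightarrow> real^'n \<Rightarrow> real^'n) \<Rightarrow>
    ((real^'n) \<times> real \<Rightarrow> real \<Rightarrow> real^'n \<Rightarrow> real) \<Rightarrow>
    ((real^'n) \<times> real \<Rightarrow> real) \<Rightarrow> bool" where
  "weak_inequality R \<Omega> T p A B u \<longleftrightarrow> C_L2loc \<Omega> T u \<and>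
     (\<exists>Du. Lp_Wloc \<Omega> T p u Du \<and>
       (\<forall>t\<^sub>1 t\<^sub>2 K \<phi> \<phi>\<^sub>t D\<phi>.
          0 \<le> t\<^sub>1 \<and> t\<^sub>1 \<le> t\<^sub>2 \<and> t\<^sub>2 \<le> T \<and> compact K \<and> K \<subseteq> \<Omega> \<and>
          W12_L2loc \<Omega> T \<phi> \<phi>\<^sub>t \<and> Lp_Wo \<Omega> T p \<phi> D\<phi> \<and>
          (AE z in lebesgue_on (\<Omega> \<times> {0..T}). \<phi> z \<ge> 0) \<and>
          (AE z in lebesgue_on (\<Omega> \<times> {0..T}). fst z \<notin> K \<longrightarrow> \<phi> z = 0) \<longrightarrow>
          R ((\<integral>x. u (x, t\<^sub>2) * \<phi> (x, t\<^sub>2) \<partial>lebesgue_on K)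
             - (\<integral>x. u (x, t\<^sub>1) * \<phi> (x, t\<^sub>1) \<partial>lebesgue_on K)
             + (\<integral>z. - u z * \<phi>\<^sub>t z + (\<Sum>i\<in>UNIV. A z (u z) (Du z) $ i * D\<phi> z $ i)
                  \<partial>lebesgue_on (K \<times> {t\<^sub>1..t\<^sub>2})))
            (\<integral>z. B z (u z) (Du z) * \<phi> z \<partial>lebesgue_on (K \<times> {t\<^sub>1..t\<^sub>2}))))"

definition local_weak_subsolution where
  "local_weak_subsolution \<Omega> T p A B u \<longleftrightarrow> weak_inequality (\<le>) \<Omega> T p A B u"

definition local_weak_supersolution where
  "local_weak_supersolution \<Omega> T p A B u \<longleftrightarrow> weak_inequality (\<ge>) \<Omega> T p A B u"

definition local_weak_solution where
  "local_weak_solution \<Omega> T p A B u \<longleftrightarrow>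
     local_weak_subsolution \<Omega> T p A B u \<and> local_weak_supersolution \<Omega> T p A B u"


subsection \<open>Exponents and intrinsic cubes\<close>

definition harmonic_mean :: "('n::finite \<Rightarrow> real) \<Rightarrow> real" where
  "harmonic_mean p = real CARD('n) / (\<Sum>i\<in>UNIV. 1 / p i)"

text \<open>\<open>intrinsic_cube p a \<rho> t\<close> is \<open>\<K>\<^sub>a\<^sub>\<rho>(t)\<close>: the factor \<open>a\<close> scales every side and is not raised to
  the power that \<open>\<rho>\<close> carries.\<close>

definition intrinsic_cube :: "('n::finite \<Rightarrow> real) \<Rightarrow> real \<Rightarrow> real \<Rightarrow> real \<Rightarrow> (real^'n) set" where
  "intrinsic_cube p a \<rho> t = (let q = harmonic_mean p in
     {x. \<forall>i. \<bar>x $ i\<bar> < a * \<rho> powr (q * (2 - p i) / (p i * (2 - q)))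
                         * t powr ((p i - q) / ((2 - q) * p i))})"

end

theory Submission
  imports Defs
begin

text \<open>Put \<open>w = u + \<nu>\<close>. The weak inequality on \<open>[b - h, b]\<close> is tested with the time-independent function
  \<open>w(\<cdot>, b)\<^sup>r\<^sup>-\<^sup>1 \<zeta>\<^sup>m\<close>, whose spatial gradient is known for almost every \<open>b\<close>. Convexity of \<open>w \<mapsto> w\<^sup>r / r\<close>
  bounds the increment of \<open>Y = \<integral> (w\<^sup>r / r) \<zeta>\<^sup>m\<close> over \<open>[b - h, b]\<close> by the resulting integrals, and averaging
  over \<open>b\<close> and letting \<open>h \<rightarrow> 0\<close> gives the energy inequality without a time derivative of \<open>u\<close>. Since
  the sides \<open>s\<^sub>i\<close> of the intrinsic cube satisfy \<open>t / s\<^sub>i powr p\<^sub>i = \<nu> powr (2 - p\<^sub>i)\<close>, Young's inequality together with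
  \<open>w \<ge> \<nu>\<close> and the smallness of \<open>C\<close> bounds the integrand pointwise by
  \<open>(\<Gamma> / t) (w\<^sup>r \<zeta>\<^sup>m + \<nu>\<^sup>r)\<close>, and Gronwall's inequality on \<open>[0, t]\<close> concludes.\<close>

subsection \<open>Continuity of translations in \<open>L\<^sup>1\<close>\<close>

text \<open>The natural test function \<open>w powr (r - 1) * \<zeta> ^ m\<close> is not admissible:
  it would need a time derivative in L^2, and \<open>u\<close> has none. Freezing it at the final
  time b makes its time derivative zero, at the price of an integrand in which the coefficients run
  over [b - h, b] while the test function stays at b. Flux and frozen gradient lie only in dual
  Lebesgue spaces, so the error is controlled by continuity of translations for such products. It is
  o(h) only after integration over b, which is why b is averaged. The shift by \<nu> has two
  purposes: for r < 2 the power w^(r-2) would be singular where u vanishes, and w >= \<nu> allows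
  the lower-order terms to be measured against w. Local boundedness keeps u in an interval [0, M],
  on which the shifted powers are C^1 with bounded derivatives. The rate in Gronwall's inequality is
  a multiple of 1/t, so the exponential factor over [0, t] does not depend on t. In the final
  constant, 2^m comes from \<zeta> >= 1/2 on the smaller cube, 2^r + 1 from removing the shift, and
  4^N from the volume of the support of the cutoff.\<close>

lemma distr_lborel_translation: "distr lborel borel (\<lambda>x. x + h) = (lborel :: 'a::euclidean_space measure)"
  using lborel_distr_plus[of h] by (simp add: add.commute[of _ h] cong: distr_cong)

lemma integrable_translation:
  fixes f :: "'a::euclidean_space \<Rightarrow> real"
  assumes "integrable lborel f"
  shows "integrable lborel (\<lambda>x. f (x + h))"
proof -
  have "integrable (distr lborel borel (\<lambda>x. x + h)) f"
    using assms by (simp add: distr_lborel_translation)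
  then show ?thesis
    by (rule integrable_distr[rotated]) simp
qed

lemma integral_translation:
  fixes f :: "'a::euclidean_space \<Rightarrow> real"
  assumes "f \<in> borel_measurable borel"
  shows "(\<integral>x. f (x + h) \<partial>lborel) = (\<integral>x. f x \<partial>lborel)"
proof -
  have "(\<integral>x. f x \<partial>distr lborel borel (\<lambda>x. x + h)) = (\<integral>x. f (x + h) \<partial>lborel)"
    using assms by (intro integral_distr) auto
  then show ?thesis by (simp add: distr_lborel_translation)
qed

lemma nn_integral_translation:
  fixes f :: "'a::euclidean_space \<Rightarrow> ennreal"
  assumes "f \<in> borel_measurable borel"
  shows "(\<integral>\<^sup>+x. f (x + h) \<partial>lborel) = (\<integral>\<^sup>+x. f x \<partial>lborel)"
proof -
  have "(\<integral>\<^sup>+x. f x \<partial>distr lborel borel (\<lambda>x. x + h)) = (\<integral>\<^sup>+x. f (x + h) \<partial>lborel)"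
    using assms by (intro nn_integral_distr) auto
  then show ?thesis by (simp add: distr_lborel_translation)
qed

text \<open>Transfers smallness of translation differences from \<open>g\<close> to an L^1-close
  \<open>f\<close>: in the three-term triangle inequality the two terms comparing \<open>f\<close>
  with \<open>g\<close> have the same integral by translation invariance.\<close>

lemma translation_diff_bound:
  fixes f g :: "'a::euclidean_space \<Rightarrow> real"
  assumes f: "integrable lborel f" and g: "integrable lborel g"
  shows "(\<integral>x. \<bar>f (x + h) - f x\<bar> \<partial>lborel)
    \<le> (\<integral>x. \<bar>g (x + h) - g x\<bar> \<partial>lborel) + 2 * (\<integral>x. \<bar>f x - g x\<bar> \<partial>lborel)"
proof -
  note [simp] = integrable_translation f g
  have fg: "(\<lambda>x. \<bar>f x - g x\<bar>) \<in> borel_measurable borel"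
    using borel_measurable_integrable[OF f] borel_measurable_integrable[OF g] by simp
  have "(\<integral>x. \<bar>f (x + h) - f x\<bar> \<partial>lborel)
     \<le> (\<integral>x. \<bar>g (x + h) - g x\<bar> + \<bar>f x - g x\<bar> + \<bar>f (x+h) - g (x+h)\<bar> \<partial>lborel)"
    by (intro integral_mono integrable_abs Bochner_Integration.integrable_add Bochner_Integration.integrable_diff) auto
  also have "\<dots> = (\<integral>x. \<bar>g (x + h) - g x\<bar> \<partial>lborel) + (\<integral>x. \<bar>f x - g x\<bar> \<partial>lborel)
      + (\<integral>x. \<bar>f (x+h) - g (x+h)\<bar> \<partial>lborel)"
    by (simp add: integrable_translation)
  also have "(\<integral>x. \<bar>f (x+h) - g (x+h)\<bar> \<partial>lborel) = (\<integral>x. \<bar>f x - g x\<bar> \<partial>lborel)"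
    by (rule integral_translation[OF fg])
  finally show ?thesis by simp
qed

text \<open>For an open set, \<open>max 0 (1\<^sub>U(x) - 1\<^sub>U(x + h)) \<rightarrow> 0\<close> pointwise, and this positive part has half
  the integral of the modulus because both translates have the same integral.\<close>

lemma tendsto_translation_open:
  fixes U :: "'a::euclidean_space set"
  assumes U: "open U" "emeasure lborel U < \<infinity>" and X: "X \<longlonglongrightarrow> 0"
  shows "(\<lambda>n. \<integral>x. \<bar>indicator U (x + X n) - indicator U x :: real\<bar> \<partial>lborel) \<longlonglongrightarrow> 0"
proof -
  let ?u = "indicator U :: 'a \<Rightarrow> real"
  have [measurable]: "U \<in> sets borel" using U by simp
  have iu: "integrable lborel ?u" using U by simp
  have eq: "(\<integral>x. \<bar>?u (x + h) - ?u x\<bar> \<partial>lborel) = 2 * (\<integral>x. max 0 (?u x - ?u (x + h)) \<partial>lborel)" for h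
  proof -
    have im: "integrable lborel (\<lambda>x. max 0 (?u x - ?u (x + h)))"
      by (intro integrable_max Bochner_Integration.integrable_diff iu integrable_translation[OF iu]) simp
    have "(\<integral>x. \<bar>?u (x + h) - ?u x\<bar> \<partial>lborel)
      = (\<integral>x. 2 * max 0 (?u x - ?u (x + h)) + (?u (x + h) - ?u x) \<partial>lborel)"
      by (intro Bochner_Integration.integral_cong) (auto simp: indicator_def)
    also have "\<dots> = 2 * (\<integral>x. max 0 (?u x - ?u (x + h)) \<partial>lborel) + ((\<integral>x. ?u (x + h) \<partial>lborel) - (\<integral>x. ?u x \<partial>lborel))"
      using im iu integrable_translation[OF iu, of h] by simp
    also have "(\<integral>x. ?u (x + h) \<partial>lborel) = (\<integral>x. ?u x \<partial>lborel)"
      by (rule integral_translation) simp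
    finally show ?thesis by simp
  qed
  \<comment> \<open>The positive part is bounded by the fixed integrable function
    \<open>indicator U\<close>; the modulus also lives on the moving translates of U, and U may be
    unbounded.\<close>
  have "(\<lambda>n. \<integral>x. max 0 (?u x - ?u (x + X n)) \<partial>lborel) \<longlonglongrightarrow> (\<integral>x. 0 \<partial>(lborel::'a measure))"
  proof (rule integral_dominated_convergence[where w="?u"])
    show "AE x in lborel. (\<lambda>n. max 0 (?u x - ?u (x + X n))) \<longlonglongrightarrow> 0"
    proof (rule AE_I2)
      fix x :: 'a
      show "(\<lambda>n. max 0 (?u x - ?u (x + X n))) \<longlonglongrightarrow> 0"
      proof (cases "x \<in> U")
        case True
        have "(\<lambda>n. x + X n) \<longlonglongrightarrow> x + 0" by (intro tendsto_intros X)
        then have "\<forall>\<^sub>F n in sequentially. x + X n \<in> U"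
          using topological_tendstoD[OF _ U(1), of "\<lambda>n. x + X n" x] True by simp
        then have "\<forall>\<^sub>F n in sequentially. max 0 (?u x - ?u (x + X n)) = 0"
          by eventually_elim (simp add: True)
        then show ?thesis by (rule tendsto_eventually)
      qed (simp add: indicator_def)
    qed
  qed (use iu in \<open>auto simp: indicator_def\<close>)
  then show ?thesis unfolding eq using tendsto_mult_right_zero by force
qed

text \<open>The convergence is closed under L^1 limits (\<open>approx\<close>) and sums, so
  indicators suffice. Outer regularity replaces a Borel set by an open set with a small difference,
  to which \<open>tendsto_translation_open\<close> applies.\<close>

lemma tendsto_translation:
  fixes f :: "'a::euclidean_space \<Rightarrow> real"
  assumes f: "integrable lborel f" and X: "X \<longlonglongrightarrow> 0"
  shows "(\<lambda>n. \<integral>x. \<bar>f (x + X n) - f x\<bar> \<partial>lborel) \<longlonglongrightarrow> 0"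
proof -
  have approx: "(\<lambda>n. \<integral>x. \<bar>f (x + X n) - f x\<bar> \<partial>lborel) \<longlonglongrightarrow> 0"
    if f: "integrable lborel f"
      and *: "\<And>e. e > 0 \<Longrightarrow> \<exists>g. integrable lborel g \<and> (\<integral>x. \<bar>f x - g x\<bar> \<partial>lborel) < e \<and>
        (\<lambda>n. \<integral>x. \<bar>g (x + X n) - g x\<bar> \<partial>lborel) \<longlonglongrightarrow> 0" for f :: "'a \<Rightarrow> real"
  proof (rule LIMSEQ_I)
    fix e :: real assume e: "e > 0"
    obtain g where g: "integrable lborel g" "(\<integral>x. \<bar>f x - g x\<bar> \<partial>lborel) < e/4"
        "(\<lambda>n. \<integral>x. \<bar>g (x + X n) - g x\<bar> \<partial>lborel) \<longlonglongrightarrow> 0"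
      using *[of "e/4"] e by auto
    obtain N where N: "\<And>n. n \<ge> N \<Longrightarrow> norm ((\<integral>x. \<bar>g (x + X n) - g x\<bar> \<partial>lborel) - 0) < e/2"
      using LIMSEQ_D[OF g(3), of "e/2"] e by auto
    show "\<exists>N. \<forall>n\<ge>N. norm ((\<integral>x. \<bar>f (x + X n) - f x\<bar> \<partial>lborel) - 0) < e"
    proof (intro exI allI impI)
      fix n assume "n \<ge> N"
      then have "(\<integral>x. \<bar>f (x + X n) - f x\<bar> \<partial>lborel) < e"
        using translation_diff_bound[OF f g(1), of "X n"] N[of n] g(2) by simp
      then show "norm ((\<integral>x. \<bar>f (x + X n) - f x\<bar> \<partial>lborel) - 0) < e" by simp
    qed
  qed
  show ?thesis using f
  proof (induction rule: integrable_induct)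
    case (base A c)
    let ?f = "\<lambda>x. indicator A x *\<^sub>R c"
    have A: "A \<in> sets borel" using base by simp
    show ?case
    proof (rule approx)
      show "integrable lborel ?f" using base by simp
      fix e :: real assume e: "e > 0"
      define e' where "e' = min 1 (e / (\<bar>c\<bar> + 1))"
      have e': "e' > 0" using e by (simp add: e'_def)
      obtain U where U: "open U" "A \<subseteq> U" "emeasure lborel (U - A) < e'"
        using outer_regular_lborel[OF A e'] by auto
      have [measurable]: "U \<in> sets borel" "A \<in> sets borel" using U A by auto
      have "emeasure lborel U \<le> emeasure lborel A + emeasure lborel (U - A)"
        using emeasure_subadditive[of A lborel "U - A"] U(2) by (simp add: Un_absorb1)
      also have "\<dots> < \<infinity>" using base(2) U(3) by (auto simp: less_top[symmetric] intro: order_less_trans)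
      finally have fU: "emeasure lborel U < \<infinity>" .
      have m: "measure lborel (U - A) < e'"
        using U(3) e' by (simp add: Sigma_Algebra.measure_def enn2real_less_iff order_less_trans[OF U(3)])
      let ?g = "\<lambda>x. indicator U x * c"
      have "(\<integral>x. \<bar>?f x - ?g x\<bar> \<partial>lborel) = (\<integral>x. indicator (U - A) x * \<bar>c\<bar> \<partial>lborel)"
        using U(2) by (intro Bochner_Integration.integral_cong) (auto simp: indicator_def)
      also have "\<dots> = measure lborel (U - A) * \<bar>c\<bar>" by simp
      also have "\<dots> \<le> e' * \<bar>c\<bar>" using m by (intro mult_right_mono) auto
      also have "\<dots> < e' * (\<bar>c\<bar> + 1)" using e' by simp
      also have "e' * (\<bar>c\<bar> + 1) \<le> e"
        by (simp add: e'_def flip: pos_le_divide_eq)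
      finally have 1: "(\<integral>x. \<bar>?f x - ?g x\<bar> \<partial>lborel) < e" .
      have 2: "(\<lambda>n. \<integral>x. \<bar>?g (x + X n) - ?g x\<bar> \<partial>lborel) \<longlonglongrightarrow> 0"
      proof -
        have "(\<integral>x. \<bar>?g (x + X n) - ?g x\<bar> \<partial>lborel) = (\<integral>x. \<bar>indicator U (x + X n) - indicator U x :: real\<bar> \<partial>lborel) * \<bar>c\<bar>" for n
          by (simp flip: left_diff_distrib add: abs_mult)
        then show ?thesis
          using tendsto_mult_left_zero[OF tendsto_translation_open[OF U(1) fU X], of "\<bar>c\<bar>"] by simp
      qed
      show "\<exists>g. integrable lborel g \<and> (\<integral>x. \<bar>?f x - g x\<bar> \<partial>lborel) < e \<and>
        (\<lambda>n. \<integral>x. \<bar>g (x + X n) - g x\<bar> \<partial>lborel) \<longlonglongrightarrow> 0"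
        using 1 2 fU by (intro exI[of _ ?g]) auto
    qed
  next
    case (add f g)
    note [simp] = integrable_translation add.hyps
    have "(\<lambda>n. (\<integral>x. \<bar>f (x + X n) - f x\<bar> \<partial>lborel) + (\<integral>x. \<bar>g (x + X n) - g x\<bar> \<partial>lborel)) \<longlonglongrightarrow> 0"
      using tendsto_add[OF add.IH] by simp
    then show ?case
    proof (rule tendsto_sandwich[OF _ _ tendsto_const, rotated 2])
      show "\<forall>\<^sub>F n in sequentially. (\<integral>x. \<bar>f (x + X n) + g (x + X n) - (f x + g x)\<bar> \<partial>lborel)
          \<le> (\<integral>x. \<bar>f (x + X n) - f x\<bar> \<partial>lborel) + (\<integral>x. \<bar>g (x + X n) - g x\<bar> \<partial>lborel)"
      proof (intro always_eventually allI)
        fix n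
        have "(\<integral>x. \<bar>f (x + X n) + g (x + X n) - (f x + g x)\<bar> \<partial>lborel) \<le> (\<integral>x. \<bar>f (x + X n) - f x\<bar> + \<bar>g (x + X n) - g x\<bar> \<partial>lborel)"
          by (intro integral_mono) (auto intro!: Bochner_Integration.integrable_add Bochner_Integration.integrable_diff integrable_abs)
        also have "\<dots> = (\<integral>x. \<bar>f (x + X n) - f x\<bar> \<partial>lborel) + (\<integral>x. \<bar>g (x + X n) - g x\<bar> \<partial>lborel)"
          by (simp add: integrable_translation)
        finally show "(\<integral>x. \<bar>f (x + X n) + g (x + X n) - (f x + g x)\<bar> \<partial>lborel)
          \<le> (\<integral>x. \<bar>f (x + X n) - f x\<bar> \<partial>lborel) + (\<integral>x. \<bar>g (x + X n) - g x\<bar> \<partial>lborel)" .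
      qed
    qed auto
  next
    case (lim f s)
    show ?case
    proof (rule approx[OF \<open>integrable lborel f\<close>])
      fix e :: real assume "e > 0"
      have "(\<lambda>i. \<integral>x. \<bar>f x - s i x\<bar> \<partial>lborel) \<longlonglongrightarrow> (\<integral>x. 0 \<partial>(lborel::'a measure))"
      \<comment> \<open>The approximants of the induction rule satisfy |s i x| <= 2 |f x|, hence the
        factor 3.\<close>
      proof (rule integral_dominated_convergence[where w="\<lambda>x. 3 * \<bar>f x\<bar>"])
        show "AE x in lborel. (\<lambda>i. \<bar>f x - s i x\<bar>) \<longlonglongrightarrow> 0"
        proof (rule AE_I2)
          fix x :: 'a
          have "(\<lambda>i. \<bar>f x - s i x\<bar>) \<longlonglongrightarrow> \<bar>f x - f x\<bar>" by (intro tendsto_intros lim.hyps) simp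
          then show "(\<lambda>i. \<bar>f x - s i x\<bar>) \<longlonglongrightarrow> 0" by simp
        qed
        show "AE x in lborel. norm \<bar>f x - s i x\<bar> \<le> 3 * \<bar>f x\<bar>" for i
        proof (rule AE_I2)
          fix x :: 'a
          show "norm \<bar>f x - s i x\<bar> \<le> 3 * \<bar>f x\<bar>" using lim.hyps(3)[of x i] by simp
        qed
        show "(\<lambda>x. \<bar>f x - s i x\<bar>) \<in> borel_measurable lborel" for i
          using borel_measurable_integrable[OF lim.hyps(1)[of i]] borel_measurable_integrable[OF lim.hyps(4)] by simp
        show "integrable lborel (\<lambda>x. 3 * \<bar>f x\<bar>)" using lim.hyps by simp
      qed simp
      then have "(\<lambda>i. \<integral>x. \<bar>f x - s i x\<bar> \<partial>lborel) \<longlonglongrightarrow> 0" by simp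
      from LIMSEQ_D[OF this \<open>e > 0\<close>] obtain i where "(\<integral>x. \<bar>f x - s i x\<bar> \<partial>lborel) < e" by auto
      then show "\<exists>g. integrable lborel g \<and> (\<integral>x. \<bar>f x - g x\<bar> \<partial>lborel) < e \<and>
        (\<lambda>n. \<integral>x. \<bar>g (x + X n) - g x\<bar> \<partial>lborel) \<longlonglongrightarrow> 0"
        using lim.hyps(1) lim.IH by blast
    qed
  qed
qed

lemma L1_translation_continuous:
  fixes f :: "'a::euclidean_space \<Rightarrow> real"
  assumes f: "integrable lborel f" and e: "e > 0"
  shows "\<exists>d>0. \<forall>h. norm h < d \<longrightarrow> (\<integral>x. \<bar>f (x + h) - f x\<bar> \<partial>lborel) < e"
proof (rule ccontr)
  assume "\<not> ?thesis"
  then have "\<forall>n::nat. \<exists>h. norm h < inverse (Suc n) \<and> (\<integral>x. \<bar>f (x + h) - f x\<bar> \<partial>lborel) \<ge> e"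
    by (metis inverse_positive_iff_positive not_less of_nat_0_less_iff zero_less_Suc)
  then obtain X where X: "\<And>n::nat. norm (X n) < inverse (Suc n)"
      and ge: "\<And>n. (\<integral>x. \<bar>f (x + X n) - f x\<bar> \<partial>lborel) \<ge> e" by metis
  have "X \<longlonglongrightarrow> 0"
    using X by (intro Lim_null_comparison[OF _ LIMSEQ_inverse_real_of_nat]) (auto intro: always_eventually less_imp_le)
  from LIMSEQ_D[OF tendsto_translation[OF f this] e] obtain n
    where "norm ((\<integral>x. \<bar>f (x + X n) - f x\<bar> \<partial>lborel) - 0) < e" by blast
  with ge[of n] show False by simp
qed

subsection \<open>Borel representatives\<close>

text \<open>Completeness of Lebesgue measure: the preimages under \<open>f\<close> and
  \<open>F\<close> differ only inside a null set, all of whose subsets are measurable.\<close>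

lemma borel_measurable_lebesgue_AE:
  fixes f F :: "'a::euclidean_space \<Rightarrow> real"
  assumes F: "F \<in> borel_measurable borel" and eq: "AE x in lborel. F x = f x"
  shows "f \<in> borel_measurable lebesgue"
proof -
  obtain N where N: "N \<in> null_sets lborel" "{x. F x \<noteq> f x} \<subseteq> N"
    using eq by (auto elim!: AE_E simp: null_sets_def)
  show ?thesis
  proof (rule borel_measurableI)
    fix S :: "real set" assume S: "open S"
    have "f -` S \<inter> space lebesgue = (F -` S - N) \<union> (f -` S \<inter> N)"
      using N(2) by (auto simp: subset_eq) metis+
    moreover have "F -` S \<in> sets lebesgue"
      using measurable_sets[OF F, of S] S by simp
    moreover have "N \<in> sets lebesgue" "f -` S \<inter> N \<in> sets lebesgue"
      using N(1) null_sets_completion_subset[of "f -` S \<inter> N" N lborel]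
        null_sets_completionI[OF N(1)] by auto
    ultimately show "f -` S \<inter> space lebesgue \<in> sets lebesgue" by (metis sets.Diff sets.Un)
  qed
qed

text \<open>\<open>borel_rep S f F\<close>: \<open>F\<close> is a Borel representative of the extension of \<open>f\<close> by zero off \<open>S\<close>.\<close>

definition borel_rep :: "'a::euclidean_space set \<Rightarrow> ('a \<Rightarrow> real) \<Rightarrow> ('a \<Rightarrow> real) \<Rightarrow> bool" where
  "borel_rep S f F \<longleftrightarrow> F \<in> borel_measurable borel \<and> (AE x in lborel. F x = (if x \<in> S then f x else 0))"

lemma borel_rep_ex:
  assumes "S \<in> sets lebesgue" "f \<in> borel_measurable (lebesgue_on S)"
  shows "\<exists>F. borel_rep S f F"
proof -
  have "(\<lambda>x. if x \<in> S then f x else 0) \<in> borel_measurable lebesgue"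
    using assms by (simp add: borel_measurable_if)
  from completion_ex_borel_measurable_real[OF this] obtain F
    where F: "F \<in> borel_measurable lborel" "AE x in lborel. (if x \<in> S then f x else 0) = F x" by blast
  from F(2) have "AE x in lborel. F x = (if x \<in> S then f x else 0)" by eventually_elim simp
  with F(1) show ?thesis by (auto simp: borel_rep_def)
qed

text \<open>The definitions integrate over \<open>lebesgue_on S\<close>, whereas translations and
  iterated integrals are handled in \<open>lborel\<close>; this is the bridge between the
  two.\<close>

lemma borel_rep_integral:
  assumes S: "S \<in> sets lebesgue" and r: "borel_rep S f F"
  shows "integral\<^sup>L (lebesgue_on S) f = integral\<^sup>L lborel F"
    and "integrable (lebesgue_on S) f \<longleftrightarrow> integrable lborel F"
proof -
  let ?f = "\<lambda>x. if x \<in> S then f x else 0"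
  have F: "F \<in> borel_measurable borel" and eq: "AE x in lebesgue. F x = ?f x"
    using r by (auto simp: borel_rep_def AE_completion_iff)
  have m: "?f \<in> borel_measurable lebesgue" "F \<in> borel_measurable lebesgue"
    using borel_measurable_lebesgue_AE[OF F] F r by (auto simp: borel_rep_def measurable_completion)
  have "integral\<^sup>L (lebesgue_on S) f = integral\<^sup>L lebesgue ?f"
    by (rule Lebesgue_Measure.integral_restrict_UNIV[OF S, symmetric])
  also have "\<dots> = integral\<^sup>L lebesgue F"
    using eq by (intro integral_cong_AE m) (auto elim: eventually_mono)
  also have "\<dots> = integral\<^sup>L lborel F" using F by (simp add: integral_completion)
  finally show "integral\<^sup>L (lebesgue_on S) f = integral\<^sup>L lborel F" .
  have "integrable (lebesgue_on S) f \<longleftrightarrow> integrable lebesgue ?f"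
    by (rule Lebesgue_Measure.integrable_restrict_UNIV[OF S, symmetric])
  also have "\<dots> \<longleftrightarrow> integrable lebesgue F"
    using eq by (intro integrable_cong_AE m) (auto elim: eventually_mono)
  also have "\<dots> \<longleftrightarrow> integrable lborel F" using F by (simp add: integrable_completion)
  finally show "integrable (lebesgue_on S) f \<longleftrightarrow> integrable lborel F" .
qed

lemma AE_lebesgue_on_iff:
  assumes "S \<in> sets lebesgue"
  shows "(AE x in lebesgue_on S. P x) \<longleftrightarrow> (AE x in lborel. x \<in> S \<longrightarrow> P x)"
  using assms by (simp add: AE_restrict_space_iff AE_completion_iff)

section \<open>Continuously differentiable functions with a named derivative\<close>

text \<open>The regularity half of \<open>C1c\<close> with the derivative as an explicit argument,
  so that products and compositions come with formulas for their derivatives.\<close>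

definition has_C1_deriv :: "('a::euclidean_space \<Rightarrow> real) \<Rightarrow> ('a \<Rightarrow> 'a \<Rightarrow> real) \<Rightarrow> bool" where
  "has_C1_deriv f f' \<longleftrightarrow> (\<forall>x. (f has_derivative f' x) (at x)) \<and> (\<forall>v. continuous_on UNIV (\<lambda>x. f' x v))"

lemma has_C1_deriv_frechet: "has_C1_deriv f f' \<Longrightarrow> frechet_derivative f (at x) = f' x"
  unfolding has_C1_deriv_def by (metis frechet_derivative_at)

lemma has_C1_deriv_continuous: "has_C1_deriv f f' \<Longrightarrow> continuous_on A f"
  unfolding has_C1_deriv_def by (meson has_derivative_continuous_on has_derivative_at_withinI)

lemma C1c_iff:
  "C1c S f \<longleftrightarrow> (\<exists>f'. has_C1_deriv f f') \<and> compact (closure {x. f x \<noteq> 0}) \<and> closure {x. f x \<noteq> 0} \<subseteq> S"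
proof
  assume "C1c S f"
  then have "has_C1_deriv f (\<lambda>x. frechet_derivative f (at x))"
    using frechet_derivative_works[of f] unfolding C1c_def has_C1_deriv_def by blast
  with \<open>C1c S f\<close> show "(\<exists>f'. has_C1_deriv f f') \<and> compact (closure {x. f x \<noteq> 0}) \<and> closure {x. f x \<noteq> 0} \<subseteq> S"
    by (auto simp: C1c_def)
next
  assume *: "(\<exists>f'. has_C1_deriv f f') \<and> compact (closure {x. f x \<noteq> 0}) \<and> closure {x. f x \<noteq> 0} \<subseteq> S"
  then obtain f' where f': "has_C1_deriv f f'" by blast
  with * show "C1c S f"
    unfolding C1c_def has_C1_deriv_frechet[OF f'] by (auto simp: has_C1_deriv_def differentiable_def)
qed

lemma C1cI:
  assumes "has_C1_deriv f f'" "compact K" "K \<subseteq> S" "\<And>x. x \<notin> K \<Longrightarrow> f x = 0"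
  shows "C1c S f"
proof -
  have "closure {x. f x \<noteq> 0} \<subseteq> K"
    using assms by (intro closure_minimal) (auto simp: compact_imp_closed)
  then show ?thesis
    using assms compact_Int_closed[OF assms(2) closed_closure[of "{x. f x \<noteq> 0}"]]
    unfolding C1c_iff by (auto simp: Int_absorb1)
qed

lemma has_C1_deriv_zero:
  assumes f: "has_C1_deriv f f'" and K: "closed K" "\<And>x. x \<notin> K \<Longrightarrow> f x = 0" and x: "x \<notin> K"
  shows "f' x v = 0"
proof -
  have "(f has_derivative f' x) (at x)" using f by (simp add: has_C1_deriv_def)
  moreover have "(f has_derivative (\<lambda>_. 0)) (at x)"
    by (rule has_derivative_transform_within_open[OF has_derivative_const[of 0], of "- K"])
      (use K x in auto)
  ultimately show ?thesis by (metis has_derivative_unique)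
qed

lemma has_C1_deriv_mult:
  assumes "has_C1_deriv f f'" "has_C1_deriv g g'"
  shows "has_C1_deriv (\<lambda>x. f x * g x) (\<lambda>x v. f x * g' x v + f' x v * g x)"
  unfolding has_C1_deriv_def
proof (intro conjI allI)
  fix x
  show "((\<lambda>x. f x * g x) has_derivative (\<lambda>v. f x * g' x v + f' x v * g x)) (at x)"
    using assms unfolding has_C1_deriv_def by (intro has_derivative_mult) auto
next
  fix v
  have "continuous_on UNIV (\<lambda>x. f' x v)" "continuous_on UNIV (\<lambda>x. g' x v)"
    using assms unfolding has_C1_deriv_def by auto
  then show "continuous_on UNIV (\<lambda>x. f x * g' x v + f' x v * g x)"
    by (intro continuous_on_add continuous_on_mult has_C1_deriv_continuous[OF assms(1)]
        has_C1_deriv_continuous[OF assms(2)])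
qed

lemma has_C1_deriv_comp:
  assumes f: "has_C1_deriv f f'"
    and g: "\<And>x. (g has_real_derivative g' (f x)) (at (f x))" and c: "continuous_on (range f) g'"
  shows "has_C1_deriv (\<lambda>x. g (f x)) (\<lambda>x v. g' (f x) * f' x v)"
  unfolding has_C1_deriv_def
proof (intro conjI allI)
  fix x
  have "(f has_derivative f' x) (at x)" using f by (simp add: has_C1_deriv_def)
  from has_derivative_compose[OF this g[unfolded has_field_derivative_def]]
  show "((\<lambda>x. g (f x)) has_derivative (\<lambda>v. g' (f x) * f' x v)) (at x)" .
next
  fix v
  show "continuous_on UNIV (\<lambda>x. g' (f x) * f' x v)"
    using f unfolding has_C1_deriv_def
    by (intro continuous_on_mult continuous_on_compose2[OF c has_C1_deriv_continuous[OF f]]) auto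
qed

text \<open>The source of integration by parts here: difference quotients have integral zero by
  translation invariance, and dominated convergence passes this on to the derivative.\<close>

lemma integral_deriv_eq_0:
  fixes f :: "'a::euclidean_space \<Rightarrow> real"
  assumes f: "has_C1_deriv f f'" and K: "compact K" "\<And>x. x \<notin> K \<Longrightarrow> f x = 0"
  shows "(\<integral>x. f' x v \<partial>lborel) = 0"
proof -
  let ?s = "\<lambda>n. inverse (real (Suc n))"
  define q where "q n x = (f (x + ?s n *\<^sub>R v) - f x) / ?s n" for n x
  have contf: "continuous_on UNIV f" by (rule has_C1_deriv_continuous[OF f])
  have fm[measurable]: "f \<in> borel_measurable borel" using contf by (simp add: borel_measurable_continuous_onI)
  have contf': "continuous_on UNIV (\<lambda>x. f' x v)" using f by (simp add: has_C1_deriv_def)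
  have [measurable]: "(\<lambda>x. f' x v) \<in> borel_measurable borel" using contf' by (simp add: borel_measurable_continuous_onI)
  obtain M where M: "\<And>x. x \<in> K \<Longrightarrow> norm (f' x v) \<le> M" "M > 0"
    using compact_imp_bounded[OF compact_continuous_image[OF continuous_on_subset[OF contf' subset_UNIV] K(1)]]
    by (auto simp: bounded_pos)
  have Mall: "norm (f' x v) \<le> M" for x
    using M has_C1_deriv_zero[OF f compact_imp_closed[OF K(1)] K(2), of x v] by (cases "x \<in> K") auto
  obtain R where R: "\<And>x. x \<in> K \<Longrightarrow> norm x \<le> R"
    using compact_imp_bounded[OF K(1)] by (auto simp: bounded_iff)
  have line: "((\<lambda>s. f (x + s *\<^sub>R v)) has_real_derivative f' (x + s *\<^sub>R v) v) (at s)" for x s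
  proof -
    have "(f has_derivative f' (x + s *\<^sub>R v)) (at (x + s *\<^sub>R v))" using f by (simp add: has_C1_deriv_def)
    moreover have "((\<lambda>s. x + s *\<^sub>R v) has_derivative (\<lambda>h. h *\<^sub>R v)) (at s)"
      by (auto intro!: derivative_eq_intros)
    ultimately have "((\<lambda>s. f (x + s *\<^sub>R v)) has_derivative (\<lambda>h. f' (x + s *\<^sub>R v) (h *\<^sub>R v))) (at s)"
      by (rule has_derivative_compose[rotated])
    moreover have "linear (f' (x + s *\<^sub>R v))"
      using f unfolding has_C1_deriv_def by (blast intro: has_derivative_linear)
    then have "f' (x + s *\<^sub>R v) (h *\<^sub>R v) = f' (x + s *\<^sub>R v) v * h" for h
      by (simp add: linear_scale)
    ultimately show ?thesis by (simp add: has_field_derivative_def)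
  qed
  have q0: "(\<integral>x. q n x \<partial>lborel) = 0" for n
  proof -
    have fi: "integrable lborel f"
    proof -
      have "(\<lambda>x. indicator K x *\<^sub>R f x) = f" using K(2) by (auto simp: fun_eq_iff indicator_def)
      then show ?thesis
        using borel_integrable_compact[OF K(1) continuous_on_subset[OF contf subset_UNIV]] by simp
    qed
    show ?thesis
      using fi integrable_translation[OF fi, of "?s n *\<^sub>R v"] integral_translation[OF fm, of "?s n *\<^sub>R v"]
      by (simp add: q_def)
  qed
  have "(\<lambda>n. \<integral>x. q n x \<partial>lborel) \<longlonglongrightarrow> (\<integral>x. f' x v \<partial>lborel)"
  \<comment> \<open>The steps \<open>?s n\<close> are at most 1, so all quotients are supported
    within distance \<open>norm v\<close> of K; the mean value theorem bounds them by M.\<close>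
  proof (rule integral_dominated_convergence[where w="\<lambda>x. M * indicator (cball 0 (R + norm v)) x"])
    show "integrable lborel (\<lambda>x. M * indicator (cball 0 (R + norm v)) x :: real)"
      using emeasure_lborel_cball_finite[of 0 "R + norm v"] by (auto intro!: integrable_mult_right integrable_real_indicator)
    show "AE x in lborel. (\<lambda>n. q n x) \<longlonglongrightarrow> f' x v"
    proof (rule AE_I2)
      fix x
      have "((\<lambda>h. (f (x + (0 + h) *\<^sub>R v) - f (x + 0 *\<^sub>R v)) / h) \<longlongrightarrow> f' x v) (at 0)"
        using line[of x 0] by (simp add: DERIV_def)
      then show "(\<lambda>n. q n x) \<longlonglongrightarrow> f' x v"
        unfolding q_def tendsto_at_iff_sequentially comp_def
        using LIMSEQ_inverse_real_of_nat by simp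
    qed
    show "AE x in lborel. norm (q n x) \<le> M * indicator (cball 0 (R + norm v)) x" for n
    proof (rule AE_I2)
      fix x
      have s: "0 < ?s n" "?s n \<le> 1" by (auto simp: field_simps)
      obtain z where z: "f (x + ?s n *\<^sub>R v) - f (x + 0 *\<^sub>R v) = (?s n - 0) * f' (x + z *\<^sub>R v) v"
        using MVT2[OF s(1), of "\<lambda>s. f (x + s *\<^sub>R v)" "\<lambda>s. f' (x + s *\<^sub>R v) v", OF line] by metis
      have "q n x = f' (x + z *\<^sub>R v) v" using z s by (simp add: q_def)
      then have b: "norm (q n x) \<le> M" using Mall by simp
      show "norm (q n x) \<le> M * indicator (cball 0 (R + norm v)) x"
      proof (cases "norm x \<le> R + norm v")
        case False
        have "x \<notin> K" using R[of x] False norm_ge_zero[of v] by auto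
        moreover have "x + ?s n *\<^sub>R v \<notin> K"
        proof
          assume "x + ?s n *\<^sub>R v \<in> K"
          then have "norm (x + ?s n *\<^sub>R v) \<le> R" by (rule R)
          moreover have "norm x \<le> norm (x + ?s n *\<^sub>R v) + norm (?s n *\<^sub>R v)"
            by (metis add_diff_cancel_right' norm_triangle_ineq4)
          moreover have "norm (?s n *\<^sub>R v) \<le> norm v" using s by (simp add: mult_left_le_one_le)
          ultimately show False using False by simp
        qed
        ultimately show ?thesis using K(2) False by (simp add: q_def)
      qed (use b in simp)
    qed
  qed (auto simp: q_def)
  then show ?thesis using q0 by (simp add: LIMSEQ_const_iff)
qed

subsection \<open>Mollification\<close>

text \<open>An unnormalised mollifier. Squaring the positive part of e^2 - |y|^2 makes it C^1, the
  regularity that \<open>C1c\<close> asks for, and keeps gradient and remainder elementary.\<close>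

definition bump :: "real \<Rightarrow> 'a::euclidean_space \<Rightarrow> real" where
  "bump e y = (max 0 (e\<^sup>2 - y \<bullet> y))\<^sup>2"

definition bump_grad :: "real \<Rightarrow> 'a::euclidean_space \<Rightarrow> 'a" where
  "bump_grad e y = - (4 * max 0 (e\<^sup>2 - y \<bullet> y)) *\<^sub>R y"

text \<open>The square of the positive part has a Lipschitz derivative, so its Taylor remainder is
  quadratic uniformly in s, also across the kink at 0.\<close>

lemma max_square_error:
  fixes s k :: real
  shows "\<bar>(max 0 (s + k))\<^sup>2 - (max 0 s)\<^sup>2 - 2 * max 0 s * k\<bar> \<le> k\<^sup>2"
proof (cases "s \<ge> 0"; cases "s + k \<ge> 0")
  assume "s \<ge> 0" "s + k \<ge> 0"
  then have "(max 0 (s + k))\<^sup>2 - (max 0 s)\<^sup>2 - 2 * max 0 s * k = k\<^sup>2"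
    by (simp add: power2_eq_square algebra_simps)
  then show ?thesis by simp
next
  assume a: "s \<ge> 0" "\<not> s + k \<ge> 0"
  then have eq: "(max 0 (s + k))\<^sup>2 - (max 0 s)\<^sup>2 - 2 * max 0 s * k = s * (- s - 2 * k)"
    by (simp add: power2_eq_square algebra_simps)
  have "s * (- s - 2 * k) \<ge> 0" using a by (intro mult_nonneg_nonneg) auto
  moreover have "s * (- s - 2 * k) = k\<^sup>2 - (s + k)\<^sup>2" by (simp add: power2_eq_square algebra_simps)
  ultimately show ?thesis unfolding eq by auto
next
  assume a: "\<not> s \<ge> 0" "s + k \<ge> 0"
  then have "(s + k)\<^sup>2 \<le> k\<^sup>2" by (intro power_mono) auto
  then show ?thesis using a by simp
next
  assume "\<not> s \<ge> 0" "\<not> s + k \<ge> 0"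
  then show ?thesis by simp
qed

lemma bump_eq_0: "e > 0 \<Longrightarrow> e \<le> norm y \<Longrightarrow> bump e y = 0"
  and bump_grad_eq_0: "e > 0 \<Longrightarrow> e \<le> norm y \<Longrightarrow> bump_grad e y = 0"
  using power_mono[of e "norm y" 2]
  by (auto simp: bump_def bump_grad_def simp flip: power2_norm_eq_inner)

lemma bump_nonneg: "bump e y \<ge> 0" by (simp add: bump_def)

lemma bump_le: "bump e y \<le> e ^ 4"
proof -
  have "(max 0 (e\<^sup>2 - y \<bullet> y))\<^sup>2 \<le> (e\<^sup>2)\<^sup>2" by (intro power_mono) auto
  then show ?thesis by (simp add: bump_def flip: power_mult)
qed

lemma bump_minus: "bump e (x - y) = bump e (y - x)"
  by (simp add: bump_def flip: power2_norm_eq_inner) (simp add: norm_minus_commute)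

lemma bump_uminus [simp]: "bump e (- y) = bump e y"
  by (simp add: bump_def)

lemma continuous_bump: "continuous_on A (bump e)" "continuous_on A (bump_grad e)"
  unfolding bump_def[abs_def] bump_grad_def[abs_def] by (auto intro!: continuous_intros)

lemma norm_bump_grad_le: "e > 0 \<Longrightarrow> norm (bump_grad e y) \<le> 4 * e ^ 3"
proof (cases "norm y \<le> e")
  case True
  assume "e > 0"
  have "norm (bump_grad e y) = 4 * max 0 (e\<^sup>2 - y \<bullet> y) * norm y" by (simp add: bump_grad_def)
  also have "\<dots> \<le> (4 * e\<^sup>2) * e" using True by (intro mult_mono) auto
  finally show ?thesis by (simp add: power2_eq_square power3_eq_cube)
next
  case False
  then show "e > 0 \<Longrightarrow> ?thesis" by (simp add: bump_grad_eq_0)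
qed

lemma bump_measurable [measurable]: "bump e \<in> borel_measurable borel" "bump_grad e \<in> borel_measurable borel"
  by (simp_all add: borel_measurable_continuous_onI continuous_bump)

text \<open>The remainder is uniform in \<open>y\<close>, which later permits differentiation under
  the integral in \<open>mollify\<close>. If |y| > e + 1 all terms vanish. Otherwise the increment k
  of e^2 - |y|^2 is at most (2(e + 1) + 1)|h|, and 2 e^2 accounts for the quadratic part -|h|^2 of
  k, which the gradient term does not contain.\<close>

lemma bump_error:
  fixes y h :: "'a::euclidean_space"
  assumes e: "e > 0" and h: "norm h \<le> 1"
  shows "\<bar>bump e (y + h) - bump e y - bump_grad e y \<bullet> h\<bar> \<le> ((2 * (e + 1) + 1)\<^sup>2 + 2 * e\<^sup>2) * (norm h)\<^sup>2"
proof (cases "norm y \<le> e + 1")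
  case False
  then have "norm y \<ge> e" by simp
  moreover have "norm (y + h) \<ge> e"
    using norm_triangle_ineq4[of "y + h" h] h False by simp
  ultimately show ?thesis using e by (simp add: bump_eq_0 bump_grad_eq_0)
next
  case True
  define s k where "s = e\<^sup>2 - y \<bullet> y" and "k = - (2 * (y \<bullet> h) + h \<bullet> h)"
  have sk: "e\<^sup>2 - (y + h) \<bullet> (y + h) = s + k"
    by (simp add: s_def k_def inner_add_left inner_add_right inner_commute)
  have hh: "h \<bullet> h = (norm h)\<^sup>2" by (simp add: power2_norm_eq_inner)
  have "bump e (y + h) - bump e y - bump_grad e y \<bullet> h
      = ((max 0 (s + k))\<^sup>2 - (max 0 s)\<^sup>2 - 2 * max 0 s * k) - 2 * max 0 s * (norm h)\<^sup>2"
    unfolding bump_def bump_grad_def sk hh[symmetric] s_def[symmetric]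
    by (simp add: k_def algebra_simps)
  also have "\<bar>\<dots>\<bar> \<le> k\<^sup>2 + 2 * max 0 s * (norm h)\<^sup>2"
    using max_square_error[of s k]
    by (smt (verit) mult_nonneg_nonneg zero_le_power2)
  also have "k\<^sup>2 \<le> ((2 * (e + 1) + 1) * norm h)\<^sup>2"
  proof (rule power2_le_iff_abs_le[THEN iffD2])
    have "\<bar>k\<bar> \<le> 2 * (norm y * norm h) + norm h * norm h"
      using Cauchy_Schwarz_ineq2[of y h] zero_le_square[of "norm h"]
      unfolding k_def hh power2_eq_square by linarith
    also have "\<dots> \<le> 2 * ((e + 1) * norm h) + 1 * norm h"
      using True h e by (intro add_mono mult_mono) auto
    also have "\<dots> = (2 * (e + 1) + 1) * norm h" by (simp add: algebra_simps)
    finally show "\<bar>k\<bar> \<le> (2 * (e + 1) + 1) * norm h" .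
  qed (use e in simp)
  also have "2 * max 0 s * (norm h)\<^sup>2 \<le> 2 * e\<^sup>2 * (norm h)\<^sup>2"
    by (intro mult_mono) (auto simp: s_def)
  finally show ?thesis by (simp only: power_mult_distrib distrib_right[of _ _ "(norm h)\<^sup>2"])
qed

lemma has_C1_deriv_bump:
  fixes x :: "'a::euclidean_space"
  assumes e: "e > 0"
  shows "has_C1_deriv (\<lambda>y. bump e (x - y)) (\<lambda>y v. - (bump_grad e (x - y) \<bullet> v))"
  unfolding has_C1_deriv_def
proof (intro conjI allI)
  fix y :: 'a
  let ?C = "(2 * (e + 1) + 1)\<^sup>2 + 2 * e\<^sup>2"
  show "((\<lambda>y. bump e (x - y)) has_derivative (\<lambda>v. - (bump_grad e (x - y) \<bullet> v))) (at y)"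
  proof (rule has_derivativeI_sandwich[where e=1 and H="\<lambda>z. ?C * norm (z - y)"])
    show "bounded_linear (\<lambda>v. - (bump_grad e (x - y) \<bullet> v))"
      by (intro bounded_linear_minus bounded_linear_inner_right)
    fix z assume "z \<noteq> y" "dist z y < 1"
    then have "norm (y - z) \<le> 1" by (simp add: dist_norm norm_minus_commute)
    from bump_error[OF e this, of "x - y"] \<open>z \<noteq> y\<close>
    show "norm ((bump e (x - z) - bump e (x - y)) - - (bump_grad e (x - y) \<bullet> (z - y))) / norm (z - y) \<le> ?C * norm (z - y)"
      by (simp add: divide_le_eq power2_eq_square inner_diff_right norm_minus_commute mult.assoc)
  next
    show "((\<lambda>z. ?C * norm (z - y)) \<longlongrightarrow> 0) (at y)"
      by (auto intro!: tendsto_eq_intros)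
  qed simp
next
  fix v :: 'a
  show "continuous_on UNIV (\<lambda>y. - (bump_grad e (x - y) \<bullet> v))"
    by (intro continuous_intros continuous_on_compose2[OF continuous_bump(2)[of UNIV]]) auto
qed

definition bump_mass :: "'a::euclidean_space itself \<Rightarrow> real \<Rightarrow> real" where
  "bump_mass _ e = (\<integral>y. bump e (y::'a) \<partial>lborel)"

lemma integrable_bump: "e > 0 \<Longrightarrow> integrable lborel (bump e :: 'a::euclidean_space \<Rightarrow> real)"
proof -
  assume e: "e > 0"
  have "(\<lambda>x. indicator (cball 0 e) x *\<^sub>R bump e x) = (bump e :: 'a \<Rightarrow> real)"
    using e by (auto simp: fun_eq_iff indicator_def intro!: bump_eq_0)
  then show ?thesis
    using borel_integrable_compact[OF compact_cball[of 0 e] continuous_bump(1)[of _ e]] by metis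
qed

lemma bump_mass_pos: "e > 0 \<Longrightarrow> bump_mass TYPE('a::euclidean_space) e > 0"
proof -
  assume e: "e > 0"
  have "bump_mass TYPE('a) e \<ge> 0" unfolding bump_mass_def by (simp add: bump_nonneg)
  moreover have "bump_mass TYPE('a) e \<noteq> 0"
  proof
    assume "bump_mass TYPE('a) e = 0"
    then have "AE y in (lborel::'a measure). bump e y = 0"
      using integral_nonneg_eq_0_iff_AE[OF integrable_bump[OF e, where 'a='a]] by (simp add: bump_mass_def bump_nonneg)
    moreover have "bump e y \<noteq> 0" if "y \<in> ball 0 e" for y :: 'a
      using that power_strict_mono[of "norm y" e 2] by (simp add: bump_def flip: power2_norm_eq_inner)
    ultimately have "AE y in (lborel::'a measure). y \<notin> ball 0 e" by (auto elim: eventually_mono)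
    then have "ball (0::'a) e \<in> null_sets lborel"
      using AE_iff_null_sets[of "ball (0::'a) e" lborel] by simp
    then have "negligible (ball (0::'a) e)"
      by (simp add: negligible_iff_null_sets null_sets_completionI)
    then show False
      using e open_not_negligible[of "ball (0::'a) e"] by simp
  qed
  ultimately show ?thesis by simp
qed

definition mollify :: "real \<Rightarrow> ('a::euclidean_space \<Rightarrow> real) \<Rightarrow> 'a \<Rightarrow> real" where
  "mollify e f x = (\<integral>y. f y * bump e (x - y) \<partial>lborel) / bump_mass TYPE('a) e"

lemma integrable_mult_bounded:
  fixes f g :: "'a \<Rightarrow> real"
  assumes "integrable M f" "g \<in> borel_measurable M" "\<And>x. \<bar>g x\<bar> \<le> C"
  shows "integrable M (\<lambda>x. f x * g x)"
proof (rule Bochner_Integration.integrable_bound[of M "\<lambda>x. C * f x"])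
  show "AE x in M. norm (f x * g x) \<le> norm (C * f x)"
  proof (rule AE_I2)
    fix x
    have "0 \<le> C" using assms(3)[of x] abs_ge_zero[of "g x"] by linarith
    then show "norm (f x * g x) \<le> norm (C * f x)"
      using assms(3)[of x] mult_left_mono[of "\<bar>g x\<bar>" C "\<bar>f x\<bar>"] by (simp add: abs_mult mult.commute)
  qed
qed (use assms in auto)

lemma integrable_mult_bump:
  assumes "e > 0" "integrable lborel f"
  shows "integrable lborel (\<lambda>y. f y * bump e (x - y))"
  using assms by (intro integrable_mult_bounded[where C="e ^ 4"]) (auto simp: bump_le abs_of_nonneg[OF bump_nonneg])

lemma integrable_scale_bump_grad:
  fixes f :: "'a::euclidean_space \<Rightarrow> real"
  assumes e: "e > 0" and f: "integrable lborel f"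
  shows "integrable lborel (\<lambda>y. f y *\<^sub>R bump_grad e (x - y))"
proof (rule Bochner_Integration.integrable_bound[of lborel "\<lambda>y. (4 * e ^ 3) * f y"])
  show "AE y in lborel. norm (f y *\<^sub>R bump_grad e (x - y)) \<le> norm ((4 * e ^ 3) * f y)"
  proof (rule AE_I2)
    fix y
    show "norm (f y *\<^sub>R bump_grad e (x - y)) \<le> norm ((4 * e ^ 3) * f y)"
      using mult_left_mono[OF norm_bump_grad_le[OF e, of "x - y"], of "\<bar>f y\<bar>"] e
      by (simp add: abs_mult mult.commute)
  qed
qed (use f in auto)

text \<open>Differentiation under the integral: the uniform remainder of \<open>bump_error\<close>
  is integrated against |f|. The gradient is continuous by dominated convergence, with majorant a
  multiple of |f|.\<close>

lemma has_C1_deriv_mollify: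
  fixes f :: "'a::euclidean_space \<Rightarrow> real"
  assumes e: "e > 0" and f: "integrable lborel f"
  shows "has_C1_deriv (mollify e f)
    (\<lambda>x v. (\<integral>y. f y * (bump_grad e (x - y) \<bullet> v) \<partial>lborel) / bump_mass TYPE('a) e)"
proof -
  let ?c = "bump_mass TYPE('a) e"
  have c: "?c > 0" by (rule bump_mass_pos[OF e])
  define G where "G x = (\<integral>y. f y *\<^sub>R bump_grad e (x - y) \<partial>lborel)" for x
  have GI: "(\<integral>y. f y * (bump_grad e (x - y) \<bullet> v) \<partial>lborel) = G x \<bullet> v" for x v
    unfolding G_def by (subst integral_inner_left[symmetric]) (simp_all add: integrable_scale_bump_grad[OF e f])
  have intg: "integrable lborel (\<lambda>y. f y * (bump_grad e (x - y) \<bullet> v))" for x v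
    using integrable_inner_left[of v lborel "\<lambda>y. f y *\<^sub>R bump_grad e (x - y)"]
      integrable_scale_bump_grad[OF e f, of x] by simp
  let ?C = "(2 * (e + 1) + 1)\<^sup>2 + 2 * e\<^sup>2"
  have err: "\<bar>(mollify e f z - mollify e f x) - G x \<bullet> (z - x) / ?c\<bar> \<le> ?C * (norm (z - x))\<^sup>2 * (\<integral>y. \<bar>f y\<bar> \<partial>lborel) / ?c"
    if "dist z x < 1" for x z
  proof -
    have "(mollify e f z - mollify e f x) - G x \<bullet> (z - x) / ?c
      = (\<integral>y. f y * bump e (z - y) - f y * bump e (x - y) - f y * (bump_grad e (x - y) \<bullet> (z - x)) \<partial>lborel) / ?c"
      unfolding mollify_def GI[symmetric]
      by (simp add: integrable_mult_bump[OF e f] intg diff_divide_distrib)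
    also have "\<bar>\<dots>\<bar> \<le> (\<integral>y. ?C * (norm (z - x))\<^sup>2 * \<bar>f y\<bar> \<partial>lborel) / ?c"
      unfolding abs_divide abs_of_pos[OF c]
    proof (rule divide_right_mono[OF _ less_imp_le[OF c]], rule integral_abs_bound[THEN order_trans], rule integral_mono)
      fix y :: 'a
      have "\<bar>bump e (x - y + (z - x)) - bump e (x - y) - bump_grad e (x - y) \<bullet> (z - x)\<bar> \<le> ?C * (norm (z - x))\<^sup>2"
        using that by (intro bump_error[OF e]) (simp add: dist_norm)
      from mult_left_mono[OF this, of "\<bar>f y\<bar>"]
      show "\<bar>f y * bump e (z - y) - f y * bump e (x - y) - f y * (bump_grad e (x - y) \<bullet> (z - x))\<bar>
          \<le> ?C * (norm (z - x))\<^sup>2 * \<bar>f y\<bar>"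
        by (simp add: abs_mult[symmetric] right_diff_distrib mult.commute mult.left_commute)
    qed (auto intro!: integrable_abs Bochner_Integration.integrable_diff integrable_mult_bump[OF e f] intg integrable_mult_right f)
    finally show ?thesis by simp
  qed
  have der: "(mollify e f has_derivative (\<lambda>v. G x \<bullet> v / ?c)) (at x)" for x
  proof (rule has_derivativeI_sandwich[where e=1 and H="\<lambda>z. (?C * (\<integral>y. \<bar>f y\<bar> \<partial>lborel) / ?c) * norm (z - x)"])
    show "bounded_linear (\<lambda>v. G x \<bullet> v / ?c)"
      by (intro bounded_linear_divide bounded_linear_inner_right bounded_linear_compose[OF bounded_linear_divide])
    fix z assume "z \<noteq> x" "dist z x < 1"
    with err[OF this(2)] show "norm ((mollify e f z - mollify e f x) - G x \<bullet> (z - x) / ?c) / norm (z - x)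
        \<le> (?C * (\<integral>y. \<bar>f y\<bar> \<partial>lborel) / ?c) * norm (z - x)"
      by (simp add: divide_le_eq power2_eq_square mult_ac)
  next
    show "((\<lambda>z. (?C * (\<integral>y. \<bar>f y\<bar> \<partial>lborel) / ?c) * norm (z - x)) \<longlongrightarrow> 0) (at x)"
      by (rule tendsto_eq_rhs[OF tendsto_mult[OF tendsto_const tendsto_norm[OF tendsto_diff[OF tendsto_ident_at tendsto_const]]]]) simp
  qed simp
  have "continuous_on UNIV G"
    unfolding continuous_on_sequentially
  proof (intro allI ballI impI, elim conjE)
    fix X :: "nat \<Rightarrow> 'a" and a assume X: "X \<longlonglongrightarrow> a"
    show "(G \<circ> X) \<longlonglongrightarrow> G a"
      unfolding comp_def G_def
    proof (rule integral_dominated_convergence[where w="\<lambda>y. (4 * e ^ 3) * \<bar>f y\<bar>"])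
      show "AE y in lborel. (\<lambda>i. f y *\<^sub>R bump_grad e (X i - y)) \<longlonglongrightarrow> f y *\<^sub>R bump_grad e (a - y)"
      proof (rule AE_I2)
        fix y
        have "isCont (bump_grad e) (a - y)"
          using continuous_bump(2)[of "UNIV :: 'a set" e] by (simp add: continuous_on_eq_continuous_at)
        then show "(\<lambda>i. f y *\<^sub>R bump_grad e (X i - y)) \<longlonglongrightarrow> f y *\<^sub>R bump_grad e (a - y)"
          by (intro tendsto_scaleR tendsto_const isCont_tendsto_compose[of _ "bump_grad e"] tendsto_diff X)
      qed
      show "AE y in lborel. norm (f y *\<^sub>R bump_grad e (X i - y)) \<le> (4 * e ^ 3) * \<bar>f y\<bar>" for i
      proof (rule AE_I2)
        fix y
        show "norm (f y *\<^sub>R bump_grad e (X i - y)) \<le> (4 * e ^ 3) * \<bar>f y\<bar>"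
          using mult_left_mono[OF norm_bump_grad_le[OF e, of "X i - y"], of "\<bar>f y\<bar>"] by (simp add: mult.commute)
      qed
    qed (use f in auto)
  qed
  then show ?thesis
    unfolding has_C1_deriv_def GI using der c by (auto intro!: continuous_intros)
qed

text \<open>Averages stay in the range of f. The approximants therefore remain in [0, M], the only
  interval on which the outer function of the chain rule is controlled.\<close>

lemma mollify_bounds:
  fixes f :: "'a::euclidean_space \<Rightarrow> real"
  assumes e: "e > 0" and f: "integrable lborel f" and b: "\<And>x. 0 \<le> f x" "\<And>x. f x \<le> M"
  shows "0 \<le> mollify e f x" "mollify e f x \<le> M"
proof -
  have c: "bump_mass TYPE('a) e > 0" by (rule bump_mass_pos[OF e])
  show "0 \<le> mollify e f x"
    unfolding mollify_def using c b by (intro divide_nonneg_pos integral_nonneg) (auto simp: bump_nonneg)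
  have ib: "integrable lborel (\<lambda>y. bump e (x - y))"
    using integrable_translation[OF integrable_bump[OF e], of "- x"] by (simp add: bump_minus[of e x])
  have "(\<integral>y. f y * bump e (x - y) \<partial>lborel) \<le> (\<integral>y. M * bump e (x - y) \<partial>lborel)"
    by (intro integral_mono integrable_mult_bump[OF e f] integrable_mult_right ib mult_right_mono b bump_nonneg)
  also have "\<dots> = M * bump_mass TYPE('a) e"
    using integral_translation[of "bump e :: 'a \<Rightarrow> real" "- x"] by (simp add: bump_mass_def bump_minus[of e x])
  finally show "mollify e f x \<le> M" using c by (simp add: mollify_def divide_le_eq)
qed

text \<open>The difference is an average of f(x + z) - f(x) over |z| <= e with weight
  \<open>bump e z\<close> divided by its mass; Tonelli's theorem bounds its L^1 norm by the
  translation modulus. \<open>eps\<close> may be small, for convergence, or the crude 2 |f|_1, for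
  mere integrability.\<close>

lemma mollify_L1:
  fixes f :: "'a::euclidean_space \<Rightarrow> real"
  assumes e: "e > 0" and f: "integrable lborel f" and eps: "eps \<ge> 0"
    and w: "\<And>h. norm h \<le> e \<Longrightarrow> (\<integral>x. \<bar>f (x + h) - f x\<bar> \<partial>lborel) \<le> eps"
  shows "integrable lborel (\<lambda>x. mollify e f x - f x)" "(\<integral>x. \<bar>mollify e f x - f x\<bar> \<partial>lborel) \<le> eps"
proof -
  let ?c = "bump_mass TYPE('a) e"
  have c: "?c > 0" by (rule bump_mass_pos[OF e])
  have [measurable]: "f \<in> borel_measurable borel" using f by simp
  have [measurable]: "mollify e f \<in> borel_measurable borel"
    using has_C1_deriv_continuous[OF has_C1_deriv_mollify[OF e f], of UNIV] by (rule borel_measurable_continuous_onI)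
  have pt: "ennreal \<bar>mollify e f x - f x\<bar> \<le> (\<integral>\<^sup>+z. ennreal (\<bar>f (x + z) - f x\<bar> * (bump e z / ?c)) \<partial>lborel)" for x
  proof -
    have i1: "integrable lborel (\<lambda>z. f (z + x) * bump e z)"
      using integrable_translation[OF integrable_mult_bump[OF e f, of x], of x]
        bump_minus[of e x] by simp
    have i2: "integrable lborel (\<lambda>z::'a. f x * bump e z)"
      using integrable_bump[OF e, where 'a='a] by (rule integrable_mult_right)
    have "mollify e f x = (\<integral>z. f (z + x) * bump e z \<partial>lborel) / ?c"
      using integral_translation[of "\<lambda>y. f y * bump e (x - y)" x]
      by (simp add: mollify_def bump_minus[of e x])
    moreover have "f x = (\<integral>z. f x * bump e (z::'a) \<partial>lborel) / ?c"
      using c by (simp add: bump_mass_def)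
    ultimately have "mollify e f x - f x = (\<integral>z. f (z + x) * bump e z - f x * bump e z \<partial>lborel) / ?c"
      using i1 i2 by (simp add: diff_divide_distrib)
    also have "\<dots> = (\<integral>z. (f (x + z) - f x) * (bump e z / ?c) \<partial>lborel)"
      by (simp add: left_diff_distrib add.commute flip: times_divide_eq_right)
         (simp add: diff_divide_distrib flip: integral_divide_zero)
    also have "ennreal \<bar>\<dots>\<bar> \<le> (\<integral>\<^sup>+z. ennreal (norm ((f (x + z) - f x) * (bump e z / ?c))) \<partial>lborel)"
      unfolding real_norm_def[symmetric] by (rule integral_norm_bound_ennreal)
         (use i1 i2 c in \<open>simp add: left_diff_distrib diff_divide_distrib add.commute\<close>)
    finally show ?thesis using c by (simp add: abs_mult bump_nonneg)
  qed
  have meas: "(\<lambda>(x, z). ennreal (\<bar>f (x + z) - f x\<bar> * (bump e z / ?c))) \<in> borel_measurable (lborel \<Otimes>\<^sub>M lborel)"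
    by measurable
  have "(\<integral>\<^sup>+x. ennreal \<bar>mollify e f x - f x\<bar> \<partial>lborel)
    \<le> (\<integral>\<^sup>+x. \<integral>\<^sup>+z. ennreal (\<bar>f (x + z) - f x\<bar> * (bump e z / ?c)) \<partial>lborel \<partial>lborel)"
    by (intro nn_integral_mono pt)
  also have "\<dots> = (\<integral>\<^sup>+z. \<integral>\<^sup>+x. ennreal (\<bar>f (x + z) - f x\<bar> * (bump e z / ?c)) \<partial>lborel \<partial>lborel)"
    using lborel_pair.Fubini'[OF meas] by simp
  also have "\<dots> \<le> (\<integral>\<^sup>+z. ennreal eps * ennreal (bump e (z::'a) / ?c) \<partial>lborel)"
  proof (rule nn_integral_mono)
    fix z :: 'a
    show "(\<integral>\<^sup>+x. ennreal (\<bar>f (x + z) - f x\<bar> * (bump e z / ?c)) \<partial>lborel) \<le> ennreal eps * ennreal (bump e z / ?c)"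
    proof (cases "norm z \<le> e")
      case True
      have "(\<integral>\<^sup>+x. ennreal (\<bar>f (x + z) - f x\<bar> * (bump e z / ?c)) \<partial>lborel)
        = (\<integral>\<^sup>+x. ennreal \<bar>f (x + z) - f x\<bar> \<partial>lborel) * ennreal (bump e z / ?c)"
        using c by (subst nn_integral_multc[symmetric]) (simp_all add: ennreal_mult bump_nonneg del: times_divide_eq_right)
      also have "(\<integral>\<^sup>+x. ennreal \<bar>f (x + z) - f x\<bar> \<partial>lborel) = ennreal (\<integral>x. \<bar>f (x + z) - f x\<bar> \<partial>lborel)"
        by (rule nn_integral_eq_integral) (auto intro!: integrable_abs Bochner_Integration.integrable_diff integrable_translation f)
      also have "\<dots> \<le> ennreal eps" using w[OF True] by (rule ennreal_leI)
      finally show ?thesis by (simp add: mult_right_mono)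
    next
      case False
      then show ?thesis using e by (simp add: bump_eq_0)
    qed
  qed
  also have "\<dots> = ennreal eps * (\<integral>\<^sup>+z. ennreal (bump e (z::'a) / ?c) \<partial>lborel)"
    by (rule nn_integral_cmult) simp
  also have "(\<integral>\<^sup>+z. ennreal (bump e (z::'a) / ?c) \<partial>lborel) = ennreal (\<integral>z. bump e (z::'a) / ?c \<partial>lborel)"
    using integrable_bump[OF e] c by (intro nn_integral_eq_integral) (auto simp: bump_nonneg)
  also have "(\<integral>z. bump e (z::'a) / ?c \<partial>lborel) = 1" using c by (simp add: bump_mass_def)
  finally have *: "(\<integral>\<^sup>+x. ennreal \<bar>mollify e f x - f x\<bar> \<partial>lborel) \<le> ennreal eps" by simp
  show i: "integrable lborel (\<lambda>x. mollify e f x - f x)"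
    using * by (intro integrableI_bounded) (auto intro: order_le_less_trans)
  have "ennreal (\<integral>x. \<bar>mollify e f x - f x\<bar> \<partial>lborel) \<le> ennreal eps"
    using * nn_integral_eq_integral[OF integrable_abs[OF i]] by simp
  then show "(\<integral>x. \<bar>mollify e f x - f x\<bar> \<partial>lborel) \<le> eps" using eps by simp
qed

subsection \<open>Chain rule in \<open>W\<^sup>1\<^sup>,\<^sup>1\<^sub>o\<close>\<close>

lemma Lloc_integrable:
  assumes "Lloc 1 S f" "compact K" "K \<subseteq> S"
  shows "integrable (lebesgue_on K) f"
proof -
  have m: "f \<in> borel_measurable (lebesgue_on K)" and i: "integrable (lebesgue_on K) (\<lambda>x. \<bar>f x\<bar> powr 1)"
    using assms by (auto simp: Lloc_def)
  have "(\<lambda>x. \<bar>f x\<bar> powr 1) = (\<lambda>x. norm (f x))" by (auto simp: fun_eq_iff)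
  with i m show ?thesis by (auto intro: integrable_norm_cancel)
qed

lemma compact_lebesgue: "compact K \<Longrightarrow> K \<in> sets lebesgue"
  by (simp add: borel_compact lborelD)

lemma borel_rep_mult:
  assumes f: "borel_rep K f F" and K: "K \<subseteq> S" and k: "k \<in> borel_measurable borel" "\<And>x. x \<notin> K \<Longrightarrow> k x = 0"
  shows "borel_rep S (\<lambda>x. f x * k x) (\<lambda>x. F x * k x)"
  using f k unfolding borel_rep_def
proof (intro conjI)
  assume a: "F \<in> borel_measurable borel \<and> (AE x in lborel. F x = (if x \<in> K then f x else 0))"
  then show "(\<lambda>x. F x * k x) \<in> borel_measurable borel" using k by auto
  from a have "AE x in lborel. F x = (if x \<in> K then f x else 0)" by blast
  then show "AE x in lborel. F x * k x = (if x \<in> S then f x * k x else 0)"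
    by eventually_elim (use K k in auto)
qed

lemma borel_rep_self: "f \<in> borel_measurable borel \<Longrightarrow> (\<And>x. x \<notin> S \<Longrightarrow> f x = 0) \<Longrightarrow> borel_rep S f f"
  by (auto simp: borel_rep_def)

text \<open>Local approximation by mollification with range in [0, M]. For x in K a kernel of small
  radius centred at x is supported in K1, hence is a test function in \<Omega>, and the weak
  derivative makes the gradient of the mollified function equal to the mollified weak gradient on
  K.\<close>

lemma W11loc_approx:
  fixes \<Omega> :: "(real^'n::finite) set"
  assumes \<Omega>: "open \<Omega>" and W: "W11loc \<Omega> f g" and K1: "compact K1" "K1 \<subseteq> \<Omega>"
    and K: "compact K" "K \<subseteq> interior K1"
    and f0: "borel_rep K1 f f0" and g0: "\<And>i. borel_rep K1 (\<lambda>x. g x $ i) (g0 i)"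
    and b: "\<And>x. 0 \<le> f0 x" "\<And>x. f0 x \<le> M"
  shows "integrable lborel f0" and "integrable lborel (g0 i)" and
    "\<exists>F F'. (\<forall>k::nat. has_C1_deriv (F k) (F' k) \<and> (\<forall>x. 0 \<le> F k x \<and> F k x \<le> M)) \<and>
      (\<lambda>k. \<integral>x. indicator K x * \<bar>F k x - f0 x\<bar> \<partial>lborel) \<longlonglongrightarrow> 0 \<and>
      (\<forall>i. (\<lambda>k. \<integral>x. indicator K x * \<bar>F' k x (axis i 1) - g0 i x\<bar> \<partial>lborel) \<longlonglongrightarrow> 0)"
proof -
  have wd: "weak_deriv \<Omega> (axis i 1) f (\<lambda>x. g x $ i)" for i
    using W by (simp add: W11loc_def)
  have i0: "integrable lborel f0"
    using Lloc_integrable[OF _ K1] wd borel_rep_integral(2)[OF compact_lebesgue[OF K1(1)] f0]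
    by (auto simp: weak_deriv_def)
  have ig: "integrable lborel (g0 i)" for i
    using Lloc_integrable[OF _ K1] wd[of i] borel_rep_integral(2)[OF compact_lebesgue[OF K1(1)] g0[of i]]
    by (auto simp: weak_deriv_def)
  show "integrable lborel f0" "integrable lborel (g0 i)" by (rule i0, rule ig)
  obtain d where d: "d > 0" "\<And>x. x \<in> K \<Longrightarrow> cball x d \<subseteq> K1"
  proof -
    obtain d where "d > 0" and d: "(\<Union>x\<in>K. cball x d) \<subseteq> interior K1"
      using compact_subset_open_imp_cball_epsilon_subset[OF K(1) open_interior K(2)] .
    have "cball x d \<subseteq> K1" if "x \<in> K" for x
      using d that interior_subset[of K1] by (meson UN_subset_iff subset_trans)
    with \<open>d > 0\<close> show ?thesis by (rule that)
  qed
  \<comment> \<open>Radii at most d keep every kernel centred in K inside K1, where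
    \<open>f0\<close> and \<open>g0\<close> represent f and its gradient.\<close>
  define e where "e k = d / real (Suc k)" for k
  have e: "e k > 0" "e k \<le> d" for k
  proof -
    show "e k > 0" using d(1) unfolding e_def by (intro divide_pos_pos) auto
    show "e k \<le> d" unfolding e_def using d(1) frac_le[of d d 1 "real (Suc k)"] by simp
  qed
  have elim: "e \<longlonglongrightarrow> 0"
    unfolding e_def using tendsto_mult_right_zero[OF LIMSEQ_inverse_real_of_nat, of d] by (simp add: divide_inverse)
  define F' where "F' k x v = (\<integral>y. f0 y * (bump_grad (e k) (x - y) \<bullet> v) \<partial>lborel) / bump_mass TYPE(real^'n) (e k)" for k x v
  have C1: "has_C1_deriv (mollify (e k) f0) (F' k)" for k
    using has_C1_deriv_mollify[OF e(1) i0, of k] unfolding F'_def .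
  have F'eq: "F' k x (axis i 1) = mollify (e k) (g0 i) x" if x: "x \<in> K" for k x i
  proof -
    let ?\<psi> = "\<lambda>y. bump (e k) (x - y)"
    have z: "?\<psi> y = 0" "bump_grad (e k) (x - y) = 0" if "y \<notin> K1" for y
    proof -
      have "norm (x - y) > d" using d(2)[OF x] that by (auto simp: subset_eq dist_norm not_le)
      then have "e k \<le> norm (x - y)" using e(2)[of k] by linarith
      then show "?\<psi> y = 0" "bump_grad (e k) (x - y) = 0" using e(1)[of k] by (auto intro: bump_eq_0 bump_grad_eq_0)
    qed
    have "C1c \<Omega> ?\<psi>"
      by (rule C1cI[OF has_C1_deriv_bump[OF e(1)] K1]) (use z in auto)
    moreover have "C1c \<Omega> \<psi> \<Longrightarrow> (\<integral>y. f y * frechet_derivative \<psi> (at y) (axis i 1) \<partial>lebesgue_on \<Omega>)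
        = - (\<integral>y. g y $ i * \<psi> y \<partial>lebesgue_on \<Omega>)" for \<psi>
      using wd[of i] by (simp add: weak_deriv_def)
    ultimately have "(\<integral>y. f y * frechet_derivative ?\<psi> (at y) (axis i 1) \<partial>lebesgue_on \<Omega>)
        = - (\<integral>y. g y $ i * ?\<psi> y \<partial>lebesgue_on \<Omega>)" by blast
    then have "(\<integral>y. f y * - (bump_grad (e k) (x - y) \<bullet> axis i 1) \<partial>lebesgue_on \<Omega>)
        = - (\<integral>y. g y $ i * ?\<psi> y \<partial>lebesgue_on \<Omega>)"
      by (simp only: has_C1_deriv_frechet[OF has_C1_deriv_bump[OF e(1)[of k]]])
    moreover have \<Omega>s: "\<Omega> \<in> sets lebesgue" using \<Omega> by (simp add: lborelD)
    have "(\<integral>y. f y * - (bump_grad (e k) (x - y) \<bullet> axis i 1) \<partial>lebesgue_on \<Omega>)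
        = (\<integral>y. f0 y * - (bump_grad (e k) (x - y) \<bullet> axis i 1) \<partial>lborel)"
      by (rule borel_rep_integral(1)[OF \<Omega>s borel_rep_mult[OF f0 K1(2)]]) (simp_all add: z)
    moreover have "(\<integral>y. g y $ i * ?\<psi> y \<partial>lebesgue_on \<Omega>) = (\<integral>y. g0 i y * ?\<psi> y \<partial>lborel)"
      by (rule borel_rep_integral(1)[OF \<Omega>s borel_rep_mult[OF g0 K1(2)]]) (simp_all add: z)
    ultimately show ?thesis by (simp add: F'_def mollify_def)
  qed
  have conv: "(\<lambda>k. \<integral>x. \<bar>mollify (e k) h x - h x\<bar> \<partial>lborel) \<longlonglongrightarrow> 0"
    and convi: "integrable lborel (\<lambda>x. \<bar>mollify (e k) h x - h x\<bar>)"
    if h: "integrable lborel h" for h :: "real^'n \<Rightarrow> real" and k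
  proof -
    show "(\<lambda>k. \<integral>x. \<bar>mollify (e k) h x - h x\<bar> \<partial>lborel) \<longlonglongrightarrow> 0"
    proof (rule LIMSEQ_I)
      fix r :: real assume r: "r > 0"
      obtain dl where dl: "dl > 0" "\<And>v. norm v < dl \<Longrightarrow> (\<integral>x. \<bar>h (x + v) - h x\<bar> \<partial>lborel) < r / 2"
        using L1_translation_continuous[OF h, of "r / 2"] r by auto
      obtain N where N: "\<And>k. k \<ge> N \<Longrightarrow> norm (e k - 0) < dl"
        using LIMSEQ_D[OF elim dl(1)] by blast
      have "norm ((\<integral>x. \<bar>mollify (e k) h x - h x\<bar> \<partial>lborel) - 0) < r" if "k \<ge> N" for k
      proof -
        have "(\<integral>x. \<bar>mollify (e k) h x - h x\<bar> \<partial>lborel) \<le> r / 2"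
        proof (rule mollify_L1(2)[OF e(1) h])
          fix v :: "real^'n" assume "norm v \<le> e k"
          then show "(\<integral>x. \<bar>h (x + v) - h x\<bar> \<partial>lborel) \<le> r / 2"
            using N[OF that] e(1)[of k] dl(2)[of v] by force
        qed (use r in simp)
        then show ?thesis using r by simp
      qed
      then show "\<exists>N. \<forall>k\<ge>N. norm ((\<integral>x. \<bar>mollify (e k) h x - h x\<bar> \<partial>lborel) - 0) < r" by blast
    qed
    \<comment> \<open>Only integrability is wanted here, so the trivial modulus 2 |h|_1 is
      enough.\<close>
    have "(\<integral>x. \<bar>h (x + v) - h x\<bar> \<partial>lborel) \<le> 2 * (\<integral>x. \<bar>h x\<bar> \<partial>lborel)" for v
      using translation_diff_bound[OF h integrable_zero, of v] by simp
    then show "integrable lborel (\<lambda>x. \<bar>mollify (e k) h x - h x\<bar>)"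
      by (intro integrable_abs mollify_L1(1)[OF e(1) h, where eps="2 * (\<integral>x. \<bar>h x\<bar> \<partial>lborel)"]) auto
  qed
  have convK: "(\<lambda>k. \<integral>x. indicator K x * \<bar>mollify (e k) h x - h x\<bar> \<partial>lborel) \<longlonglongrightarrow> 0"
    if h: "integrable lborel h" for h :: "real^'n \<Rightarrow> real"
  proof (rule tendsto_sandwich[OF _ _ tendsto_const conv[OF h]])
    have Ks: "K \<in> sets lborel" using K(1) by (simp add: borel_compact)
    show "\<forall>\<^sub>F k in sequentially. (\<integral>x. indicator K x * \<bar>mollify (e k) h x - h x\<bar> \<partial>lborel) \<le> (\<integral>x. \<bar>mollify (e k) h x - h x\<bar> \<partial>lborel)"
    proof (intro always_eventually allI integral_mono convi[OF h])
      fix k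
      show "integrable lborel (\<lambda>x. indicator K x * \<bar>mollify (e k) h x - h x\<bar>)"
        using integrable_real_mult_indicator[OF Ks convi[OF h, of k]] by (simp add: mult.commute)
    qed (simp add: indicator_def)
  qed auto
  show "\<exists>F F'. (\<forall>k::nat. has_C1_deriv (F k) (F' k) \<and> (\<forall>x. 0 \<le> F k x \<and> F k x \<le> M)) \<and>
      (\<lambda>k. \<integral>x. indicator K x * \<bar>F k x - f0 x\<bar> \<partial>lborel) \<longlonglongrightarrow> 0 \<and>
      (\<forall>i. (\<lambda>k. \<integral>x. indicator K x * \<bar>F' k x (axis i 1) - g0 i x\<bar> \<partial>lborel) \<longlonglongrightarrow> 0)"
  proof (intro exI conjI allI)
    show "has_C1_deriv (mollify (e k) f0) (F' k)" for k by (rule C1)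
    show "0 \<le> mollify (e k) f0 x" "mollify (e k) f0 x \<le> M" for k x
      using mollify_bounds[OF e(1) i0] b by auto
    show "(\<lambda>k. \<integral>x. indicator K x * \<bar>mollify (e k) f0 x - f0 x\<bar> \<partial>lborel) \<longlonglongrightarrow> 0"
      by (rule convK[OF i0])
    fix i
    have eq: "indicator K x * \<bar>F' k x (axis i 1) - g0 i x\<bar> = indicator K x * \<bar>mollify (e k) (g0 i) x - g0 i x\<bar>" for k x
      using F'eq[of x k i] by (cases "x \<in> K") auto
    show "(\<lambda>k. \<integral>x. indicator K x * \<bar>F' k x (axis i 1) - g0 i x\<bar> \<partial>lborel) \<longlonglongrightarrow> 0"
      unfolding eq by (rule convK[OF ig])
  qed
qed

lemma has_C1_deriv_measurable:
  assumes "has_C1_deriv f f'"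
  shows "f \<in> borel_measurable borel" "(\<lambda>x. f' x v) \<in> borel_measurable borel"
  using has_C1_deriv_continuous[OF assms, of UNIV] assms
  by (auto simp: has_C1_deriv_def intro!: borel_measurable_continuous_onI)

lemma has_C1_deriv_bounded:
  assumes f: "has_C1_deriv f f'" and K: "compact K" "\<And>x. x \<notin> K \<Longrightarrow> f x = 0"
  shows "\<exists>B. \<forall>x. \<bar>f x\<bar> \<le> B" "\<exists>B. \<forall>x. \<bar>f' x v\<bar> \<le> B"
proof -
  have *: "\<exists>B. \<forall>x. \<bar>h x\<bar> \<le> B" if h: "continuous_on UNIV h" "\<And>x. x \<notin> K \<Longrightarrow> h x = 0" for h :: "'a \<Rightarrow> real"
  proof -
    obtain B where "B > 0" and B: "\<And>x. x \<in> K \<Longrightarrow> \<bar>h x\<bar> \<le> B"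
      using compact_imp_bounded[OF compact_continuous_image[OF continuous_on_subset[OF h(1) subset_UNIV] K(1)]]
      by (auto simp: bounded_pos)
    have "\<bar>h x\<bar> \<le> B" for x using B[of x] h(2)[of x] \<open>B > 0\<close> by (cases "x \<in> K") auto
    then show ?thesis by blast
  qed
  show "\<exists>B. \<forall>x. \<bar>f x\<bar> \<le> B" using has_C1_deriv_continuous[OF f] K(2) by (rule *)
  show "\<exists>B. \<forall>x. \<bar>f' x v\<bar> \<le> B"
    using f has_C1_deriv_zero[OF f compact_imp_closed[OF K(1)] K(2)] by (intro *) (auto simp: has_C1_deriv_def)
qed

lemma tendsto_integral_mult_bounded:
  fixes h :: "'a \<Rightarrow> real"
  assumes h: "integrable M h" and hk: "\<And>k. integrable M (hk k)"
    and lim: "(\<lambda>k::nat. \<integral>x. \<bar>h x - hk k x\<bar> \<partial>M) \<longlonglongrightarrow> 0"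
    and b: "b \<in> borel_measurable M" "\<And>x. \<bar>b x\<bar> \<le> B"
  shows "(\<lambda>k. \<integral>x. hk k x * b x \<partial>M) \<longlonglongrightarrow> (\<integral>x. h x * b x \<partial>M)"
proof (rule Lim_transform_bound[of _ "\<lambda>k. B * (\<integral>x. \<bar>h x - hk k x\<bar> \<partial>M)", THEN Lim_null[THEN iffD2]])
  show "(\<lambda>k. B * (\<integral>x. \<bar>h x - hk k x\<bar> \<partial>M)) \<longlonglongrightarrow> 0"
    by (rule tendsto_mult_right_zero[OF lim])
  show "\<forall>\<^sub>F k in sequentially. norm ((\<integral>x. hk k x * b x \<partial>M) - (\<integral>x. h x * b x \<partial>M)) \<le> norm (B * (\<integral>x. \<bar>h x - hk k x\<bar> \<partial>M))"
  proof (intro always_eventually allI)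
    fix k
    have "(\<integral>x. hk k x * b x \<partial>M) - (\<integral>x. h x * b x \<partial>M) = (\<integral>x. hk k x * b x - h x * b x \<partial>M)"
      using integrable_mult_bounded[OF hk b] integrable_mult_bounded[OF h b] by simp
    also have "norm \<dots> \<le> (\<integral>x. B * \<bar>h x - hk k x\<bar> \<partial>M)"
      unfolding real_norm_def
    proof (rule integral_abs_bound[THEN order_trans], rule integral_mono)
      fix x
      show "\<bar>hk k x * b x - h x * b x\<bar> \<le> B * \<bar>h x - hk k x\<bar>"
      proof -
        have "hk k x * b x - h x * b x = b x * (hk k x - h x)" by (simp add: algebra_simps)
        then have "\<bar>hk k x * b x - h x * b x\<bar> = \<bar>b x\<bar> * \<bar>h x - hk k x\<bar>"
          by (simp add: abs_mult abs_minus_commute)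
        then show ?thesis using mult_right_mono[OF b(2)[of x], of "\<bar>h x - hk k x\<bar>"] by simp
      qed
    qed (use integrable_mult_bounded[OF hk b] integrable_mult_bounded[OF h b] h hk in auto)
    also have "\<dots> = B * (\<integral>x. \<bar>h x - hk k x\<bar> \<partial>M)" by simp
    finally show "norm ((\<integral>x. hk k x * b x \<partial>M) - (\<integral>x. h x * b x \<partial>M)) \<le> norm (B * (\<integral>x. \<bar>h x - hk k x\<bar> \<partial>M))"
      by simp
  qed
qed

lemma Lloc_1_integrable:
  assumes "integrable lborel f" "\<And>x. x \<notin> S \<Longrightarrow> f x = 0"
  shows "Lloc 1 S f"
  unfolding Lloc_def
proof (intro allI impI conjI; elim conjE)
  fix K assume K: "compact K" "K \<subseteq> S"
  have fm: "f \<in> borel_measurable borel" using assms(1) by simp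
  show "f \<in> borel_measurable (lebesgue_on K)"
    using fm by (intro measurable_restrict_space1) (simp add: measurable_completion)
  have "integrable lebesgue f" using assms(1) fm by (simp add: integrable_completion)
  then have "integrable (lebesgue_on K) f"
    using integrable_mult_indicator[OF compact_lebesgue[OF K(1)], of f]
    by (simp add: integrable_restrict_space compact_lebesgue K)
  then show "integrable (lebesgue_on K) (\<lambda>x. \<bar>f x\<bar> powr 1)" by simp
qed

text \<open>\<open>W11o\<close> asks for a weak gradient and for an approximating sequence. The
  sequence yields both: L^1 convergence of functions and gradients passes to the limit in
  integration by parts, since test functions and their derivatives are bounded.\<close>

lemma W11o_limit:
  fixes \<Omega> :: "(real^'n::finite) set" and f :: "real^'n \<Rightarrow> real"
  assumes \<Omega>: "open \<Omega>" and K: "compact K" "K \<subseteq> \<Omega>"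
    and f: "integrable lborel f" "\<And>x. x \<notin> K \<Longrightarrow> f x = 0"
    and g: "\<And>i. integrable lborel (g i)" "\<And>x i. x \<notin> K \<Longrightarrow> g i x = 0"
    and \<psi>: "\<And>k::nat. has_C1_deriv (\<psi> k) (D k)" "\<And>k x. x \<notin> K \<Longrightarrow> \<psi> k x = 0"
    and lim: "(\<lambda>k. \<integral>x. \<bar>f x - \<psi> k x\<bar> \<partial>lborel) \<longlonglongrightarrow> 0"
    and limD: "\<And>i. (\<lambda>k. \<integral>x. \<bar>g i x - D k x (axis i 1)\<bar> \<partial>lborel) \<longlonglongrightarrow> 0"
  shows "W11o \<Omega> f (\<lambda>x. \<chi> i. g i x)"
proof -
  have \<Omega>s: "\<Omega> \<in> sets lebesgue" using \<Omega> by (simp add: lborelD)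
  have int\<Omega>: "(\<integral>x. h x \<partial>lebesgue_on \<Omega>) = (\<integral>x. h x \<partial>lborel)"
    "integrable (lebesgue_on \<Omega>) h \<longleftrightarrow> integrable lborel h"
    if "h \<in> borel_measurable borel" "\<And>x. x \<notin> K \<Longrightarrow> h x = 0" for h :: "real^'n \<Rightarrow> real"
  proof -
    have "borel_rep \<Omega> h h" using that K by (intro borel_rep_self) auto
    from borel_rep_integral[OF \<Omega>s this]
    show "(\<integral>x. h x \<partial>lebesgue_on \<Omega>) = (\<integral>x. h x \<partial>lborel)"
      "integrable (lebesgue_on \<Omega>) h \<longleftrightarrow> integrable lborel h" by auto
  qed
  have D0: "D k x v = 0" if "x \<notin> K" for k x v
    by (rule has_C1_deriv_zero[OF \<psi>(1) compact_imp_closed[OF K(1)] \<psi>(2) that])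
  have fm [measurable]: "f \<in> borel_measurable borel" using f by simp
  have gm [measurable]: "g i \<in> borel_measurable borel" for i using g(1)[of i] by simp
  note [measurable] = has_C1_deriv_measurable[OF \<psi>(1)]
  have comp: "integrable lborel h" if "continuous_on UNIV h" "\<And>x. x \<notin> K \<Longrightarrow> h x = 0" for h :: "real^'n \<Rightarrow> real"
  proof -
    have "(\<lambda>x. indicator K x *\<^sub>R h x) = h" using that(2) by (auto simp: fun_eq_iff indicator_def)
    then show ?thesis
      using borel_integrable_compact[OF K(1) continuous_on_subset[OF that(1) subset_UNIV]] by metis
  qed
  have \<psi>i: "integrable lborel (\<psi> k)" for k
    using has_C1_deriv_continuous[OF \<psi>(1)] \<psi>(2) by (rule comp)
  have Di: "integrable lborel (\<lambda>x. D k x v)" for k v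
    using \<psi>(1)[of k] D0 by (intro comp) (auto simp: has_C1_deriv_def)
  have wd: "weak_deriv \<Omega> (axis i 1) f (g i)" for i
    unfolding weak_deriv_def
  proof (intro conjI allI impI)
    show "Lloc 1 \<Omega> f" by (rule Lloc_1_integrable[OF f(1)], rule f(2)) (use K in auto)
    show "Lloc 1 \<Omega> (g i)" by (rule Lloc_1_integrable[OF g(1)], rule g(2)) (use K in auto)
    fix \<phi> assume "C1c \<Omega> \<phi>"
    then obtain \<phi>' where \<phi>': "has_C1_deriv \<phi> \<phi>'" "compact (closure {x. \<phi> x \<noteq> 0})"
      by (auto simp: C1c_iff)
    let ?v = "axis i 1 :: real^'n"
    have z: "\<phi> x = 0" if "x \<notin> closure {x. \<phi> x \<noteq> 0}" for x
      using that closure_subset[of "{x. \<phi> x \<noteq> 0}"] by auto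
    obtain B1 where B1: "\<And>x. \<bar>\<phi> x\<bar> \<le> B1" using has_C1_deriv_bounded(1)[OF \<phi>' z] by blast
    obtain B2 where B2: "\<And>x. \<bar>\<phi>' x ?v\<bar> \<le> B2" using has_C1_deriv_bounded(2)[OF \<phi>' z] by blast
    note [measurable] = has_C1_deriv_measurable[OF \<phi>'(1)]
    have parts: "(\<integral>x. \<psi> k x * \<phi>' x ?v \<partial>lborel) = - (\<integral>x. D k x ?v * \<phi> x \<partial>lborel)" for k
    proof -
      have "(\<integral>x. \<psi> k x * \<phi>' x ?v + D k x ?v * \<phi> x \<partial>lborel) = 0"
        using integral_deriv_eq_0[OF has_C1_deriv_mult[OF \<psi>(1)[of k] \<phi>'(1)] K(1), of ?v] \<psi>(2) by simp
      moreover have "integrable lborel (\<lambda>x. \<psi> k x * \<phi>' x ?v)" "integrable lborel (\<lambda>x. D k x ?v * \<phi> x)"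
        using integrable_mult_bounded[OF \<psi>i _ B2] integrable_mult_bounded[OF Di _ B1] by auto
      ultimately show ?thesis by simp
    qed
    have "(\<lambda>k. \<integral>x. \<psi> k x * \<phi>' x ?v \<partial>lborel) \<longlonglongrightarrow> (\<integral>x. f x * \<phi>' x ?v \<partial>lborel)"
      by (rule tendsto_integral_mult_bounded[OF f(1) \<psi>i lim _ B2]) simp
    moreover have "(\<lambda>k. - (\<integral>x. D k x ?v * \<phi> x \<partial>lborel)) \<longlonglongrightarrow> - (\<integral>x. g i x * \<phi> x \<partial>lborel)"
      by (intro tendsto_minus tendsto_integral_mult_bounded[OF g(1) Di limD _ B1]) simp
    ultimately have "(\<integral>x. f x * \<phi>' x ?v \<partial>lborel) = - (\<integral>x. g i x * \<phi> x \<partial>lborel)"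
      unfolding parts by (rule LIMSEQ_unique)
    then show "(\<integral>x. f x * frechet_derivative \<phi> (at x) ?v \<partial>lebesgue_on \<Omega>) = - (\<integral>x. g i x * \<phi> x \<partial>lebesgue_on \<Omega>)"
      unfolding has_C1_deriv_frechet[OF \<phi>'(1)] by (subst (1 2) int\<Omega>(1)) (auto simp: f g)
  qed
  have C: "C1c \<Omega> (\<psi> k)" for k by (rule C1cI[OF \<psi>(1) K \<psi>(2)])
  have l1: "(\<integral>x. \<bar>f x - \<psi> k x\<bar> \<partial>lebesgue_on \<Omega>) = (\<integral>x. \<bar>f x - \<psi> k x\<bar> \<partial>lborel)" for k
    by (rule int\<Omega>(1)) (auto simp: f \<psi>)
  have l2: "(\<integral>x. \<bar>g i x - frechet_derivative (\<psi> k) (at x) (axis i 1)\<bar> \<partial>lebesgue_on \<Omega>)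
    = (\<integral>x. \<bar>g i x - D k x (axis i 1)\<bar> \<partial>lborel)" for i k
    unfolding has_C1_deriv_frechet[OF \<psi>(1)] by (rule int\<Omega>(1)) (auto simp: g D0)
  show ?thesis
    unfolding W11o_def W11loc_def
  proof (intro conjI exI[of _ \<psi>] allI)
    show "weak_deriv \<Omega> (axis i 1) f (\<lambda>x. (\<chi> i. g i x) $ i)" for i using wd by simp
    show "integrable (lebesgue_on \<Omega>) f" by (subst int\<Omega>(2)) (auto simp: f)
    show "integrable (lebesgue_on \<Omega>) (\<lambda>x. (\<chi> i. g i x) $ i)" for i
      by (subst int\<Omega>(2)) (auto simp: g)
    show "C1c \<Omega> (\<psi> k)" for k by (rule C)
    show "(\<lambda>k. \<integral>x. \<bar>f x - \<psi> k x\<bar> \<partial>lebesgue_on \<Omega>) \<longlonglongrightarrow> 0" unfolding l1 by (rule lim)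
    show "(\<lambda>k. \<integral>x. \<bar>(\<chi> i. g i x) $ i - frechet_derivative (\<psi> k) (at x) (axis i 1)\<bar> \<partial>lebesgue_on \<Omega>) \<longlonglongrightarrow> 0" for i
      by (simp add: l2 limD)
  qed
qed

lemma W11o_chain:
  fixes \<Omega> :: "(real^'n::finite) set"
  assumes \<Omega>: "open \<Omega>" and W: "W11loc \<Omega> f g" and K1: "compact K1" "K1 \<subseteq> \<Omega>"
    and K: "compact K" "K \<subseteq> interior K1"
    and f0: "borel_rep K1 f f0" and g0: "\<And>i. borel_rep K1 (\<lambda>x. g x $ i) (g0 i)"
    and b: "\<And>x. 0 \<le> f0 x" "\<And>x. f0 x \<le> M"
    and z: "has_C1_deriv z z'" "\<And>x. x \<notin> K \<Longrightarrow> z x = 0"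
    and G: "\<And>s. 0 \<le> s \<Longrightarrow> s \<le> M \<Longrightarrow> (G has_real_derivative G' s) (at s)"
    and G': "continuous_on {0..M} G'"
  shows "W11o \<Omega> (\<lambda>x. G (f0 x) * z x)
    (\<lambda>x. \<chi> i. G' (f0 x) * g0 i x * z x + G (f0 x) * z' x (axis i 1))"
proof -
  note approx = W11loc_approx[OF \<Omega> W K1 K f0 g0 b]
  obtain F F' where F: "\<And>k::nat. has_C1_deriv (F k) (F' k)" "\<And>k x. 0 \<le> F k x" "\<And>k x. F k x \<le> M"
    and limF: "(\<lambda>k. \<integral>x. indicator K x * \<bar>F k x - f0 x\<bar> \<partial>lborel) \<longlonglongrightarrow> 0"
    and limF': "\<And>i. (\<lambda>k. \<integral>x. indicator K x * \<bar>F' k x (axis i 1) - g0 i x\<bar> \<partial>lborel) \<longlonglongrightarrow> 0"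
    using approx(3) by blast
  have [measurable]: "f0 \<in> borel_measurable borel" using f0 by (simp add: borel_rep_def)
  have [measurable]: "g0 i \<in> borel_measurable borel" for i using g0[of i] by (simp add: borel_rep_def)
  note [measurable] = has_C1_deriv_measurable[OF F(1)] has_C1_deriv_measurable[OF z(1)]
  have [measurable]: "K \<in> sets borel" using K(1) by (simp add: borel_compact)
  have Kfin: "emeasure lborel K < \<infinity>" using emeasure_bounded_finite[OF compact_imp_bounded[OF K(1)]] by simp
  have ind: "integrable lborel (\<lambda>x. C * indicator K x)" for C :: real
    using Kfin by (intro integrable_mult_right integrable_real_indicator) auto
  have contG: "continuous_on {0..M} G"
    using G by (intro continuous_at_imp_continuous_on ballI DERIV_isCont) auto
  \<comment> \<open>h is continuous only on [0, M]; composing with the truncation to [0, M] leaves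
    the values unchanged and gives a continuous function on the line.\<close>
  have clamp: "(\<lambda>x. h (w x)) \<in> borel_measurable borel"
    if h: "continuous_on {0..M} h" and w: "w \<in> borel_measurable borel" "\<And>x. 0 \<le> w x" "\<And>x. w x \<le> M"
    for h :: "real \<Rightarrow> real" and w :: "real^'n \<Rightarrow> real"
  proof -
    have "0 \<le> M" using w(2)[of 0] w(3)[of 0] by linarith
    then have "(\<lambda>s. max 0 (min M s)) ` UNIV \<subseteq> {0..M}" by auto
    moreover have "continuous_on UNIV (\<lambda>s. max 0 (min M s) :: real)"
      by (intro continuous_on_max continuous_on_min continuous_on_const continuous_on_id)
    ultimately have "continuous_on UNIV (\<lambda>s. h (max 0 (min M s)))"
      by (intro continuous_on_compose2[OF h])
    from borel_measurable_continuous_on[OF this w(1)]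
    have "(\<lambda>x. h (max 0 (min M (w x)))) \<in> borel_measurable borel" .
    moreover have "max 0 (min M (w x)) = w x" for x using w(2,3)[of x] by simp
    ultimately show ?thesis by simp
  qed
  note [measurable] = clamp[OF contG _ b] clamp[OF G' _ b] clamp[OF contG _ F(2,3)] clamp[OF G' _ F(2,3)]
  have bounded: "\<exists>B. \<forall>s. 0 \<le> s \<longrightarrow> s \<le> M \<longrightarrow> \<bar>h s\<bar> \<le> B" if "continuous_on {0..M} h" for h :: "real \<Rightarrow> real"
    using compact_imp_bounded[OF compact_continuous_image[OF that compact_Icc]]
    by (simp add: bounded_iff) (meson atLeastAtMost_iff)
  obtain B0 where B0: "\<And>s. 0 \<le> s \<Longrightarrow> s \<le> M \<Longrightarrow> \<bar>G s\<bar> \<le> B0" using bounded[OF contG] by blast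
  obtain B1 where B1: "\<And>s. 0 \<le> s \<Longrightarrow> s \<le> M \<Longrightarrow> \<bar>G' s\<bar> \<le> B1" using bounded[OF G'] by blast
  obtain Z where Z: "\<And>x. \<bar>z x\<bar> \<le> Z" using has_C1_deriv_bounded(1)[OF z(1) K(1) z(2)] by blast
  have "\<forall>i. \<exists>B. \<forall>x. \<bar>z' x (axis i 1)\<bar> \<le> B" using has_C1_deriv_bounded(2)[OF z(1) K(1) z(2)] by blast
  then obtain Z' where Z': "\<And>i x. \<bar>z' x (axis i 1)\<bar> \<le> Z' i" by metis
  have z'0: "z' x v = 0" if "x \<notin> K" for x v
    by (rule has_C1_deriv_zero[OF z(1) compact_imp_closed[OF K(1)] z(2) that])
  have pos: "0 \<le> B0" "0 \<le> B1" "0 \<le> Z"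
    using B0[OF b, of 0] B1[OF b, of 0] Z[of 0] by linarith+
  have intK: "integrable lborel (\<lambda>x. indicator K x * (F k x - f0 x))" for k
  proof (rule Bochner_Integration.integrable_bound[OF ind[of M]])
    show "AE x in lborel. norm (indicator K x * (F k x - f0 x)) \<le> norm (M * indicator K x)"
      using F(2,3)[of k] b by (intro AE_I2) (auto simp: indicator_def abs_if intro: order_trans, (smt (verit))+)
  qed simp
  have "(\<lambda>k. \<integral>x. norm (indicator K x * (F k x - f0 x)) \<partial>lborel) \<longlonglongrightarrow> 0"
    using limF by (simp add: abs_mult)
  \<comment> \<open>G' is merely continuous, so L^1 convergence of F does not carry over directly;
    along an almost everywhere convergent subsequence dominated convergence applies.\<close>
  from tendsto_L1_AE_subseq[OF intK this] obtain r
    where r: "strict_mono r" "AE x in lborel. (\<lambda>n. indicator K x * (F (r n) x - f0 x)) \<longlonglongrightarrow> 0" by blast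
  have conv: "AE x in lborel. x \<in> K \<longrightarrow> (\<lambda>n. F (r n) x) \<longlonglongrightarrow> f0 x"
    using r(2) by eventually_elim (auto simp: LIM_zero_iff)
  have convh: "AE x in lborel. x \<in> K \<longrightarrow> (\<lambda>n. h (F (r n) x)) \<longlonglongrightarrow> h (f0 x)"
    if h: "continuous_on {0..M} h" for h :: "real \<Rightarrow> real"
    using conv
  proof eventually_elim
    case (elim x)
    show ?case
      using elim F(2,3) b by (auto intro!: continuous_on_tendsto_compose[OF h])
  qed
  have dom: "(\<lambda>n. \<integral>x. \<bar>h (f0 x) - h (F (r n) x)\<bar> * w x \<partial>lborel) \<longlonglongrightarrow> 0"
    if h: "continuous_on {0..M} h" and w: "integrable lborel w" "\<And>x. x \<notin> K \<Longrightarrow> w x = 0"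
    for h :: "real \<Rightarrow> real" and w
  proof -
    obtain B where B: "\<And>s. 0 \<le> s \<Longrightarrow> s \<le> M \<Longrightarrow> \<bar>h s\<bar> \<le> B" using bounded[OF h] by blast
    have [measurable]: "w \<in> borel_measurable borel" using w by simp
    note [measurable] = clamp[OF h _ b] clamp[OF h _ F(2,3)]
    have "(\<lambda>n. \<integral>x. \<bar>h (f0 x) - h (F (r n) x)\<bar> * w x \<partial>lborel) \<longlonglongrightarrow> (\<integral>x. 0 \<partial>(lborel :: (real^'n) measure))"
    proof (rule integral_dominated_convergence[where w="\<lambda>x. 2 * B * \<bar>w x\<bar>"])
      show "AE x in lborel. (\<lambda>n. \<bar>h (f0 x) - h (F (r n) x)\<bar> * w x) \<longlonglongrightarrow> 0"
        using convh[OF h]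
      proof eventually_elim
        case (elim x)
        show ?case
        proof (cases "x \<in> K")
          case True
          have "(\<lambda>n. \<bar>h (f0 x) - h (F (r n) x)\<bar> * w x) \<longlonglongrightarrow> \<bar>h (f0 x) - h (f0 x)\<bar> * w x"
            using elim True by (intro tendsto_intros) auto
          then show ?thesis by simp
        qed (simp add: w)
      qed
      show "AE x in lborel. norm (\<bar>h (f0 x) - h (F (r n) x)\<bar> * w x) \<le> 2 * B * \<bar>w x\<bar>" for n
      proof (rule AE_I2)
        fix x
        have "\<bar>h (f0 x) - h (F (r n) x)\<bar> \<le> 2 * B"
          using B[OF b, of x] B[OF F(2,3), of "r n" x] by linarith
        from mult_right_mono[OF this, of "\<bar>w x\<bar>"]
        show "norm (\<bar>h (f0 x) - h (F (r n) x)\<bar> * w x) \<le> 2 * B * \<bar>w x\<bar>" by (simp add: abs_mult)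
      qed
    qed (use w in auto)
    then show ?thesis by simp
  qed
  have zi: "integrable lborel (\<lambda>x. \<bar>z x\<bar>)" "integrable lborel (\<lambda>x. \<bar>z' x (axis i 1)\<bar>)" for i
  proof -
    show "integrable lborel (\<lambda>x. \<bar>z x\<bar>)"
      by (rule Bochner_Integration.integrable_bound[OF ind[of Z]]) (use Z z(2) pos in \<open>auto simp: indicator_def\<close>)
    have "0 \<le> Z' i" using Z'[of 0 i] by linarith
    then show "integrable lborel (\<lambda>x. \<bar>z' x (axis i 1)\<bar>)"
      by (intro Bochner_Integration.integrable_bound[OF ind[of "Z' i"]]) (use Z' z'0 in \<open>auto simp: indicator_def\<close>)
  qed
  have ig: "integrable lborel (g0 i)" for i by (rule approx(2))
  let ?D = "\<lambda>n x v. G (F (r n) x) * z' x v + (G' (F (r n) x) * F' (r n) x v) * z x"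
  show ?thesis
  proof (rule W11o_limit[OF \<Omega> K(1), where \<psi>="\<lambda>n x. G (F (r n) x) * z x" and D="?D"])
    show "K \<subseteq> \<Omega>" using K(2) K1(2) interior_subset by blast
    show "integrable lborel (\<lambda>x. G (f0 x) * z x)"
    proof (rule Bochner_Integration.integrable_bound)
      show "integrable lborel (\<lambda>x. B0 * \<bar>z x\<bar>)" using zi by simp
      show "AE x in lborel. norm (G (f0 x) * z x) \<le> norm (B0 * \<bar>z x\<bar>)"
        using B0[OF b] pos by (intro AE_I2) (auto simp: abs_mult intro!: mult_right_mono)
    qed simp
    show "integrable lborel (\<lambda>x. G' (f0 x) * g0 i x * z x + G (f0 x) * z' x (axis i 1))" for i
    proof (rule Bochner_Integration.integrable_bound)
      show "integrable lborel (\<lambda>x. B1 * Z * \<bar>g0 i x\<bar> + B0 * \<bar>z' x (axis i 1)\<bar>)" using zi ig by simp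
      show "AE x in lborel. norm (G' (f0 x) * g0 i x * z x + G (f0 x) * z' x (axis i 1))
          \<le> norm (B1 * Z * \<bar>g0 i x\<bar> + B0 * \<bar>z' x (axis i 1)\<bar>)"
      proof (rule AE_I2)
        fix x
        have "\<bar>G' (f0 x) * g0 i x * z x\<bar> \<le> B1 * \<bar>g0 i x\<bar> * Z"
          unfolding abs_mult using B1[OF b] Z pos by (intro mult_mono) auto
        moreover have "\<bar>G (f0 x) * z' x (axis i 1)\<bar> \<le> B0 * \<bar>z' x (axis i 1)\<bar>"
          unfolding abs_mult using B0[OF b] by (intro mult_right_mono) auto
        ultimately show "norm (G' (f0 x) * g0 i x * z x + G (f0 x) * z' x (axis i 1))
          \<le> norm (B1 * Z * \<bar>g0 i x\<bar> + B0 * \<bar>z' x (axis i 1)\<bar>)" by (simp add: mult_ac)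
      qed
    qed simp
    show "has_C1_deriv (\<lambda>x. G (F (r n) x) * z x) (?D n)" for n
    proof (intro has_C1_deriv_mult has_C1_deriv_comp F z)
      show "(G has_real_derivative G' (F (r n) x)) (at (F (r n) x))" for x by (intro G F)
      show "continuous_on (range (F (r n))) G'" by (rule continuous_on_subset[OF G']) (use F in auto)
    qed
    have "(\<integral>x. \<bar>G (f0 x) * z x - G (F (r n) x) * z x\<bar> \<partial>lborel) = (\<integral>x. \<bar>G (f0 x) - G (F (r n) x)\<bar> * \<bar>z x\<bar> \<partial>lborel)" for n
      by (simp add: abs_mult flip: left_diff_distrib)
    then show "(\<lambda>n. \<integral>x. \<bar>G (f0 x) * z x - G (F (r n) x) * z x\<bar> \<partial>lborel) \<longlonglongrightarrow> 0"
      using dom[OF contG zi(1)] z(2) by simp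
    fix i
    let ?e = "axis i 1 :: real^'n"
    \<comment> \<open>The three sources of error: the outer derivative, the gradient, and the outer
      function.\<close>
    let ?d1 = "\<lambda>n x. \<bar>G' (f0 x) - G' (F (r n) x)\<bar> * (\<bar>g0 i x\<bar> * \<bar>z x\<bar>)"
    let ?d2 = "\<lambda>n x. (B1 * Z) * (indicator K x * \<bar>F' (r n) x ?e - g0 i x\<bar>)"
    let ?d3 = "\<lambda>n x. \<bar>G (f0 x) - G (F (r n) x)\<bar> * \<bar>z' x ?e\<bar>"
    have gz: "integrable lborel (\<lambda>x. \<bar>g0 i x\<bar> * \<bar>z x\<bar>)"
      by (rule integrable_mult_bounded[where C=Z]) (use ig Z in auto)
    have i13: "integrable lborel (\<lambda>x. \<bar>h (f0 x) - h (F (r n) x)\<bar> * w x)"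
      if h: "continuous_on {0..M} h" and w: "integrable lborel w" for h :: "real \<Rightarrow> real" and w n
    proof -
      obtain B where B: "\<And>s. 0 \<le> s \<Longrightarrow> s \<le> M \<Longrightarrow> \<bar>h s\<bar> \<le> B" using bounded[OF h] by blast
      note [measurable] = clamp[OF h _ b] clamp[OF h _ F(2,3)]
      have "integrable lborel (\<lambda>x. w x * \<bar>h (f0 x) - h (F (r n) x)\<bar>)"
      proof (rule integrable_mult_bounded[OF w])
        show "\<bar>\<bar>h (f0 x) - h (F (r n) x)\<bar>\<bar> \<le> 2 * B" for x
          using B[OF b, of x] B[OF F(2,3), of "r n" x] by linarith
      qed simp
      then show ?thesis by (simp add: mult.commute)
    qed
    have F'i: "integrable lborel (\<lambda>x. indicator K x * \<bar>F' k x ?e - g0 i x\<bar>)" for k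
    proof -
      have "continuous_on K (\<lambda>x. F' k x ?e)"
        using F(1)[of k] by (auto simp: has_C1_deriv_def intro: continuous_on_subset)
      from borel_integrable_compact[OF K(1) this]
      have "integrable lborel (\<lambda>x. indicator K x * F' k x ?e - indicator K x * g0 i x)"
        using integrable_real_mult_indicator[OF _ ig, of K i] by (simp add: mult.commute)
      from integrable_abs[OF this] show ?thesis
        by (simp add: abs_mult flip: right_diff_distrib)
    qed
    have "(\<lambda>n. (\<integral>x. ?d1 n x \<partial>lborel) + (\<integral>x. ?d2 n x \<partial>lborel) + (\<integral>x. ?d3 n x \<partial>lborel)) \<longlonglongrightarrow> 0 + 0 + 0"
    proof (intro tendsto_add)
      show "(\<lambda>n. \<integral>x. ?d1 n x \<partial>lborel) \<longlonglongrightarrow> 0" by (rule dom[OF G' gz]) (simp add: z)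
      show "(\<lambda>n. \<integral>x. ?d3 n x \<partial>lborel) \<longlonglongrightarrow> 0" by (rule dom[OF contG zi(2)]) (simp add: z'0)
      show "(\<lambda>n. \<integral>x. ?d2 n x \<partial>lborel) \<longlonglongrightarrow> 0"
        using tendsto_mult_right_zero[OF LIMSEQ_subseq_LIMSEQ[OF limF'[of i] r(1)], of "B1 * Z"]
        by (simp add: comp_def)
    qed
    then have lim: "(\<lambda>n. \<integral>x. ?d1 n x + ?d2 n x + ?d3 n x \<partial>lborel) \<longlonglongrightarrow> 0"
      using i13[OF G' gz] i13[OF contG zi(2)[of i]] integrable_mult_right[OF F'i, of "B1 * Z"]
      by (simp del: times_divide_eq_left)
    show "(\<lambda>n. \<integral>x. \<bar>(G' (f0 x) * g0 i x * z x + G (f0 x) * z' x ?e) - ?D n x ?e\<bar> \<partial>lborel) \<longlonglongrightarrow> 0"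
    proof (rule tendsto_sandwich[OF _ _ tendsto_const lim])
      show "\<forall>\<^sub>F n in sequentially. (\<integral>x. \<bar>(G' (f0 x) * g0 i x * z x + G (f0 x) * z' x ?e) - ?D n x ?e\<bar> \<partial>lborel)
        \<le> (\<integral>x. ?d1 n x + ?d2 n x + ?d3 n x \<partial>lborel)"
      proof (intro always_eventually allI integral_mono')
        fix n x
        show "integrable lborel (\<lambda>x. ?d1 n x + ?d2 n x + ?d3 n x)"
          by (intro Bochner_Integration.integrable_add i13[OF G' gz] i13[OF contG zi(2)] integrable_mult_right F'i)
        have "(G' (f0 x) * g0 i x * z x + G (f0 x) * z' x ?e) - ?D n x ?e
          = (G' (f0 x) - G' (F (r n) x)) * (g0 i x * z x) + G' (F (r n) x) * z x * (g0 i x - F' (r n) x ?e)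
            + (G (f0 x) - G (F (r n) x)) * z' x ?e"
          by (simp add: algebra_simps)
        moreover have "\<bar>G' (F (r n) x) * z x * (g0 i x - F' (r n) x ?e)\<bar> \<le> ?d2 n x"
        proof (cases "x \<in> K")
          case True
          have "\<bar>G' (F (r n) x) * z x * (g0 i x - F' (r n) x ?e)\<bar> \<le> B1 * Z * \<bar>g0 i x - F' (r n) x ?e\<bar>"
            unfolding abs_mult using B1[OF F(2,3)] Z pos by (intro mult_mono) auto
          then show ?thesis using True by (simp add: abs_minus_commute)
        qed (simp add: z)
        ultimately show "\<bar>(G' (f0 x) * g0 i x * z x + G (f0 x) * z' x ?e) - ?D n x ?e\<bar> \<le> ?d1 n x + ?d2 n x + ?d3 n x"
          by (simp add: abs_mult[symmetric] del: abs_mult)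
      qed (use pos in \<open>auto intro!: add_nonneg_nonneg mult_nonneg_nonneg\<close>)
    qed auto
  qed (auto simp: z z'0)
qed

subsection \<open>Steklov averages\<close>

lemma integrable_lborel_product:
  fixes f :: "'a::euclidean_space \<Rightarrow> real" and g :: "'b::euclidean_space \<Rightarrow> real"
  assumes f: "integrable lborel f" and g: "integrable lborel g"
  shows "integrable lborel (\<lambda>z. f (fst z) * g (snd z))"
proof -
  have [measurable]: "f \<in> borel_measurable borel" "g \<in> borel_measurable borel" using f g by auto
  have "integrable (lborel \<Otimes>\<^sub>M lborel) (\<lambda>(x, y). f x * g y)"
  proof (rule lborel_pair.Fubini_integrable)
    show "integrable lborel (\<lambda>x. \<integral>y. norm (case (x, y) of (x, y) \<Rightarrow> f x * g y) \<partial>lborel)"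
      using f by (simp add: abs_mult)
    show "AE x in lborel. integrable lborel (\<lambda>y. case (x, y) of (x, y) \<Rightarrow> f x * g y)"
      using g by simp
  qed measurable
  then show ?thesis by (simp add: lborel_prod case_prod_unfold)
qed

lemma integral_le_nn_integral:
  fixes f :: "'a \<Rightarrow> real"
  assumes "integrable M f" "(\<integral>\<^sup>+x. ennreal (f x) \<partial>M) \<le> ennreal r" "r \<ge> 0"
  shows "(\<integral>x. f x \<partial>M) \<le> r"
proof -
  have "(\<integral>x. f x \<partial>M) \<le> enn2real (\<integral>\<^sup>+x. ennreal (f x) \<partial>M)"
    using real_lebesgue_integral_def[OF assms(1)] by simp
  also have "\<dots> \<le> r" using assms(2,3) enn2real_leI by blast
  finally show ?thesis .
qed

lemma nn_integral_lborel_fst_snd: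
  fixes f :: "'a::euclidean_space \<times> 'b::euclidean_space \<Rightarrow> ennreal"
  assumes "f \<in> borel_measurable borel"
  shows "(\<integral>\<^sup>+y. \<integral>\<^sup>+x. f (x, y) \<partial>lborel \<partial>lborel) = (\<integral>\<^sup>+z. f z \<partial>lborel)"
    and "(\<integral>\<^sup>+x. \<integral>\<^sup>+y. f (x, y) \<partial>lborel \<partial>lborel) = (\<integral>\<^sup>+z. f z \<partial>lborel)"
proof -
  have m: "f \<in> borel_measurable (lborel \<Otimes>\<^sub>M lborel)" using assms by (simp add: lborel_prod)
  show "(\<integral>\<^sup>+y. \<integral>\<^sup>+x. f (x, y) \<partial>lborel \<partial>lborel) = (\<integral>\<^sup>+z. f z \<partial>lborel)"
    using lborel_pair.nn_integral_snd[of f] m by (simp add: lborel_prod)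
  show "(\<integral>\<^sup>+x. \<integral>\<^sup>+y. f (x, y) \<partial>lborel \<partial>lborel) = (\<integral>\<^sup>+z. f z \<partial>lborel)"
    using lborel.nn_integral_fst[of f lborel] m by (simp add: lborel_prod)
qed

lemma integral_lborel_fst_snd:
  fixes f :: "'a::euclidean_space \<times> 'b::euclidean_space \<Rightarrow> real"
  assumes "integrable lborel f"
  shows "AE y in lborel. integrable lborel (\<lambda>x. f (x, y))"
    and "integrable lborel (\<lambda>y. \<integral>x. f (x, y) \<partial>lborel)"
    and "(\<integral>y. \<integral>x. f (x, y) \<partial>lborel \<partial>lborel) = (\<integral>z. f z \<partial>lborel)"
    and "(\<integral>x. \<integral>y. f (x, y) \<partial>lborel \<partial>lborel) = (\<integral>z. f z \<partial>lborel)"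
proof -
  have *: "integrable (lborel \<Otimes>\<^sub>M lborel) (\<lambda>(x, y). f (x, y))" using assms by (simp add: lborel_prod)
  show "AE y in lborel. integrable lborel (\<lambda>x. f (x, y))" by (rule lborel_pair.AE_integrable_snd[OF *])
  show "integrable lborel (\<lambda>y. \<integral>x. f (x, y) \<partial>lborel)" by (rule lborel_pair.integrable_snd[OF *])
  show "(\<integral>y. \<integral>x. f (x, y) \<partial>lborel \<partial>lborel) = (\<integral>z. f z \<partial>lborel)"
    using lborel_pair.integral_snd[OF *] by (simp add: lborel_prod)
  show "(\<integral>x. \<integral>y. f (x, y) \<partial>lborel \<partial>lborel) = (\<integral>z. f z \<partial>lborel)"
    using lborel_pair.integral_fst[OF *] by (simp add: lborel_prod)
qed

lemma borel_measurable_fst_snd [measurable]: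
  "(fst :: 'a::euclidean_space \<times> 'b::euclidean_space \<Rightarrow> 'a) \<in> borel \<rightarrow>\<^sub>M borel"
  "(snd :: 'a \<times> 'b \<Rightarrow> 'b) \<in> borel \<rightarrow>\<^sub>M borel"
  by (intro borel_measurable_continuous_onI continuous_on_fst continuous_on_snd continuous_on_id)+

text \<open>Integrating \<open>Y b - Y (b - h)\<close> over \<open>b\<close> turns the one-sided inequality at almost every time into
  a Steklov average; the error of freezing the first time argument of \<open>W\<close> at \<open>b\<close> is \<open>o(h)\<close> by
  continuity of translations.\<close>

lemma energy_average:
  fixes W :: "'a::euclidean_space \<Rightarrow> real \<Rightarrow> real \<Rightarrow> real" and Y k :: "real \<Rightarrow> real"
  assumes Wm: "(\<lambda>(x, s, b). W x s b) \<in> borel_measurable borel"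
    and err: "\<And>e. e > 0 \<Longrightarrow> \<exists>h0>0. \<forall>d. \<bar>d\<bar> < h0 \<longrightarrow>
       (\<integral>\<^sup>+z. ennreal \<bar>W (fst z) (snd z + d) (snd z) - W (fst z) (snd z) (snd z)\<bar> \<partial>lborel) \<le> ennreal e"
    and Si: "AE b in lborel. integrable lborel (\<lambda>x. W x b b)"
    and Yc: "continuous_on {0..T} Y" and kc: "continuous_on {0..T} k" and k0: "\<And>b. b \<in> {0..T} \<Longrightarrow> 0 \<le> k b"
    and Sk: "AE b in lborel. b \<in> {0..T} \<longrightarrow> (\<integral>x. W x b b \<partial>lborel) \<le> k b"
    and ineq: "AE b in lborel. b \<in> {0..T} \<longrightarrow> (\<forall>a\<in>{0..b}.
       Y b - Y a \<le> (\<integral>z. indicator {a..b} (snd z) * W (fst z) (snd z) b \<partial>lborel))"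
    and t: "t \<in> {0..T}"
  shows "Y t - Y 0 \<le> integral {0..t} k"
proof (cases "t = 0")
  case True then show ?thesis by simp
next
  case False
  then have t0: "t > 0" "t \<le> T" using t by auto
  have W3 [measurable]: "(\<lambda>z. W (f z) (g z) (h z)) \<in> borel_measurable N"
    if "f \<in> borel_measurable N" "g \<in> borel_measurable N" "h \<in> borel_measurable N" for f g h and N :: "'z measure"
  proof -
    have "(\<lambda>z. (f z, g z, h z)) \<in> measurable N borel"
      using that by (simp add: borel_prod[symmetric])
    from measurable_compose[OF this Wm] show ?thesis by simp
  qed
  show ?thesis
  proof (rule field_le_epsilon)
    fix e :: real assume e: "e > 0"
    obtain h0 where h0: "h0 > 0" and herr: "\<And>d. \<bar>d\<bar> < h0 \<Longrightarrow>
       (\<integral>\<^sup>+z. ennreal \<bar>W (fst z) (snd z + d) (snd z) - W (fst z) (snd z) (snd z)\<bar> \<partial>lborel) \<le> ennreal (e/3)"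
      using err[of "e/3"] e by auto
    have modulus: "\<exists>d>0. \<forall>b\<in>{0..T}. dist b s < d \<longrightarrow> dist (Y b) (Y s) < e/3" if "s \<in> {0..T}" for s
      using Yc[unfolded continuous_on_iff, rule_format, OF that, of "e/3"] e by simp
    obtain d1 where d1: "d1 > 0" "\<And>b. b \<in> {0..T} \<Longrightarrow> dist b t < d1 \<Longrightarrow> dist (Y b) (Y t) < e/3"
      using modulus[OF t] by blast
    obtain d2 where d2: "d2 > 0" "\<And>b. b \<in> {0..T} \<Longrightarrow> dist b 0 < d2 \<Longrightarrow> dist (Y b) (Y 0) < e/3"
      using modulus[of 0] t0 by auto
    \<comment> \<open>h lies below h0 for the freezing error, below t, and below d1 and d2 for the
      continuity of Y at t and at 0.\<close>
    define h where "h = min (h0/2) (min (t/2) (min (d1/2) (d2/2)))"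
    have h: "h > 0" "h < h0" "h < t" "h < d1" "h < d2"
      using h0 t0 d1(1) d2(1) by (auto simp: h_def min_less_iff_disj)
    \<comment> \<open>The freezing error at b over [b - h, b], written with d = s - b. For each d in
      [-h, 0] the integral over b is a translation error of at most e/3, so the total is at most h
      e/3.\<close>
    define E where "E b = (\<integral>\<^sup>+d. indicator {-h..0} d * (\<integral>\<^sup>+x. ennreal \<bar>W x (b + d) b - W x b b\<bar> \<partial>lborel) \<partial>lborel)" for b
    have Em [measurable]: "E \<in> borel_measurable borel"
      unfolding E_def by measurable
    have Eint: "(\<integral>\<^sup>+b. E b \<partial>lborel) \<le> ennreal (h * (e/3))"
    proof -
      have "(\<integral>\<^sup>+b. E b \<partial>lborel)
        = (\<integral>\<^sup>+d. \<integral>\<^sup>+b. indicator {-h..0} d * (\<integral>\<^sup>+x. ennreal \<bar>W x (b + d) b - W x b b\<bar> \<partial>lborel) \<partial>lborel \<partial>lborel)"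
        unfolding E_def by (rule lborel_pair.Fubini') measurable
      also have "\<dots> \<le> (\<integral>\<^sup>+d. ennreal (e/3) * indicator {-h..0} d \<partial>lborel)"
      proof (rule nn_integral_mono)
        fix d :: real
        show "(\<integral>\<^sup>+b. indicator {-h..0} d * (\<integral>\<^sup>+x. ennreal \<bar>W x (b + d) b - W x b b\<bar> \<partial>lborel) \<partial>lborel)
          \<le> ennreal (e/3) * indicator {-h..0} d"
        proof (cases "d \<in> {-h..0}")
          case True
          have "(\<integral>\<^sup>+b. \<integral>\<^sup>+x. ennreal \<bar>W x (b + d) b - W x b b\<bar> \<partial>lborel \<partial>lborel)
            = (\<integral>\<^sup>+z. ennreal \<bar>W (fst z) (snd z + d) (snd z) - W (fst z) (snd z) (snd z)\<bar> \<partial>lborel)"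
            using nn_integral_lborel_fst_snd(1)[of "\<lambda>z. ennreal \<bar>W (fst z) (snd z + d) (snd z) - W (fst z) (snd z) (snd z)\<bar>"]
            by simp
          also have "\<dots> \<le> ennreal (e/3)" using True h by (intro herr) auto
          finally show ?thesis using True by simp
        qed simp
      qed
      also have "\<dots> = ennreal (e/3) * ennreal h"
        using h by (subst nn_integral_cmult_indicator) auto
      also have "\<dots> = ennreal (h * (e/3))" using h e by (simp add: mult.commute flip: ennreal_mult)
      finally show ?thesis .
    qed
    have key: "AE b in lborel. b \<in> {h..t} \<longrightarrow> ennreal (Y b - Y (b - h) - h * k b) \<le> E b"
      using Si Sk ineq
    proof eventually_elim
      case (elim b)
      show ?case
      proof
        assume b: "b \<in> {h..t}"
        then have bT: "b \<in> {0..T}" "b - h \<in> {0..b}" using h t0 by auto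
        let ?i = "\<lambda>z::'a \<times> real. indicator {b - h..b} (snd z) :: real"
        have E_eq: "E b = (\<integral>\<^sup>+z. ennreal \<bar>?i z * (W (fst z) (snd z) b - W (fst z) b b)\<bar> \<partial>lborel)"
        proof -
          have "E b = (\<integral>\<^sup>+d. indicator {b-h..b} (d + b) * (\<integral>\<^sup>+x. ennreal \<bar>W x (d + b) b - W x b b\<bar> \<partial>lborel) \<partial>lborel)"
            unfolding E_def by (intro nn_integral_cong) (auto simp: indicator_def add.commute)
          also have "\<dots> = (\<integral>\<^sup>+s. indicator {b-h..b} s * (\<integral>\<^sup>+x. ennreal \<bar>W x s b - W x b b\<bar> \<partial>lborel) \<partial>lborel)"
            by (rule nn_integral_translation[of "\<lambda>s. indicator {b-h..b} s * (\<integral>\<^sup>+x. ennreal \<bar>W x s b - W x b b\<bar> \<partial>lborel)" b]) measurable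
          also have "\<dots> = (\<integral>\<^sup>+s. (\<integral>\<^sup>+x. ennreal \<bar>?i (x, s) * (W x s b - W x b b)\<bar> \<partial>lborel) \<partial>lborel)"
            by (intro nn_integral_cong) (auto simp: indicator_def)
          also have "\<dots> = (\<integral>\<^sup>+z. ennreal \<bar>?i z * (W (fst z) (snd z) b - W (fst z) b b)\<bar> \<partial>lborel)"
            using nn_integral_lborel_fst_snd(1)[of "\<lambda>z. ennreal \<bar>?i z * (W (fst z) (snd z) b - W (fst z) b b)\<bar>"] by simp
          finally show ?thesis .
        qed
        show "ennreal (Y b - Y (b - h) - h * k b) \<le> E b"
        \<comment> \<open>If E b is infinite the bound is trivial; if it is finite it supplies the
          integrability needed to split the integral.\<close>
        proof (cases "E b = \<infinity>")
          case False
          have i1: "integrable lborel (\<lambda>z. ?i z * (W (fst z) (snd z) b - W (fst z) b b))"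
          proof (rule integrableI_bounded)
            show "(\<integral>\<^sup>+z. ennreal (norm (?i z * (W (fst z) (snd z) b - W (fst z) b b))) \<partial>lborel) < \<infinity>"
              using False unfolding E_eq by (simp add: less_top)
          qed measurable
          have "integrable lborel (indicator {b-h..b} :: real \<Rightarrow> real)" by (rule integrable_real_indicator) (use h in auto)
          from integrable_lborel_product[OF elim(1) this]
          have i2: "integrable lborel (\<lambda>z. ?i z * W (fst z) b b)" by (simp add: mult.commute)
          have v2: "(\<integral>z. ?i z * W (fst z) b b \<partial>lborel) = h * (\<integral>x. W x b b \<partial>lborel)"
          proof -
            from integral_lborel_fst_snd(3)[OF i2]
            have "(\<integral>s. \<integral>x. indicator {b-h..b} s * W x b b \<partial>lborel \<partial>lborel) = (\<integral>z. ?i z * W (fst z) b b \<partial>lborel)"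
              by simp
            moreover have "(\<integral>s. \<integral>x. indicator {b-h..b} s * W x b b \<partial>lborel \<partial>lborel) = h * (\<integral>x. W x b b \<partial>lborel)"
              using h by simp
            ultimately show ?thesis by simp
          qed
          have "Y b - Y (b - h) \<le> (\<integral>z. ?i z * W (fst z) (snd z) b \<partial>lborel)"
            using elim(3) bT by blast
          also have "\<dots> = (\<integral>z. ?i z * (W (fst z) (snd z) b - W (fst z) b b) + ?i z * W (fst z) b b \<partial>lborel)"
            by (intro Bochner_Integration.integral_cong) (auto simp: algebra_simps)
          also have "\<dots> = (\<integral>z. ?i z * (W (fst z) (snd z) b - W (fst z) b b) \<partial>lborel) + h * (\<integral>x. W x b b \<partial>lborel)"
            by (subst Bochner_Integration.integral_add[OF i1 i2]) (simp add: v2)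
          also have "h * (\<integral>x. W x b b \<partial>lborel) \<le> h * k b"
            using elim(2) bT h by (intro mult_left_mono) auto
          finally have "Y b - Y (b - h) - h * k b \<le> (\<integral>z. ?i z * (W (fst z) (snd z) b - W (fst z) b b) \<partial>lborel)" by simp
          also have "\<dots> \<le> \<bar>\<integral>z. ?i z * (W (fst z) (snd z) b - W (fst z) b b) \<partial>lborel\<bar>" by simp
          finally have "ennreal (Y b - Y (b - h) - h * k b) \<le> ennreal \<bar>\<integral>z. ?i z * (W (fst z) (snd z) b - W (fst z) b b) \<partial>lborel\<bar>"
            by (rule ennreal_leI)
          also have "\<dots> \<le> E b"
            unfolding E_eq using integral_norm_bound_ennreal[OF i1] by simp
          finally show ?thesis .
        qed simp
      qed
    qed
    \<comment> \<open>Integration over b telescopes: of Y only the integrals over [t - h, t] and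
      [0, h] survive, each within h e/3 of h times the endpoint value. Together with the freezing
      error and after division by h this makes up e.\<close>
    let ?f = "\<lambda>b. indicator {h..t} b * (Y b - Y (b - h) - h * k b)"
    have cY: "continuous_on {h..t} Y" "continuous_on {h..t} (\<lambda>b. Y (b - h))" "continuous_on {h..t} k"
      using h t0 by (auto intro!: continuous_on_subset[OF Yc] continuous_on_subset[OF kc] continuous_on_compose2[OF Yc] continuous_intros)
    have cf: "continuous_on {h..t} (\<lambda>b. Y b - Y (b - h) - h * k b)"
      by (intro continuous_on_diff continuous_on_mult continuous_on_const cY)
    have fi: "integrable lborel ?f"
      using borel_integrable_compact[OF compact_Icc cf] by simp
    have "(\<integral>b. ?f b \<partial>lborel) \<le> h * (e/3)"
    proof (rule integral_le_nn_integral[OF fi])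
      have "(\<integral>\<^sup>+b. ennreal (?f b) \<partial>lborel) \<le> (\<integral>\<^sup>+b. E b \<partial>lborel)"
        using key by (intro nn_integral_mono_AE) (auto simp: indicator_def elim!: eventually_mono)
      with Eint show "(\<integral>\<^sup>+b. ennreal (?f b) \<partial>lborel) \<le> ennreal (h * (e/3))" by simp
    qed (use h e in simp)
    moreover have "(\<integral>b. ?f b \<partial>lborel) = integral {h..t} (\<lambda>b. Y b - Y (b - h) - h * k b)"
    proof -
      have "set_integrable lborel {h..t} (\<lambda>b. Y b - Y (b - h) - h * k b)"
        unfolding set_integrable_def using fi by simp
      from set_borel_integral_eq_integral(2)[OF this] show ?thesis
        by (simp add: set_lebesgue_integral_def)
    qed
    moreover have "integral {h..t} (\<lambda>b. Y b - Y (b - h) - h * k b)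
      = integral {h..t} Y - integral {h..t} (\<lambda>b. Y (b - h)) - h * integral {h..t} k"
      using cY by (simp add: integral_diff integrable_continuous_interval continuous_intros)
    moreover have "integral {h..t} (\<lambda>b. Y (b - h)) = integral {0..t - h} Y"
      using Henstock_Kurzweil_Integration.integral_shift[where a=h and c="- h" and b=t and f=Y] h t0 continuous_on_subset[OF Yc, of "{0..t - h}"] by (simp add: comp_def)
    moreover have "integral {h..t} Y = integral {0..t} Y - integral {0..h} Y"
      using Henstock_Kurzweil_Integration.integral_combine[where a=0 and c=h and b=t and f=Y] h t0 continuous_on_subset[OF Yc, of "{0..t}"]
      by (simp add: integrable_continuous_interval)
    moreover have "integral {0..t - h} Y = integral {0..t} Y - integral {t - h..t} Y"
      using Henstock_Kurzweil_Integration.integral_combine[where a=0 and c="t - h" and b=t and f=Y] h t0 continuous_on_subset[OF Yc, of "{0..t}"]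
      by (simp add: integrable_continuous_interval)
    moreover have "integral {h..t} k \<le> integral {0..t} k"
    proof (rule integral_subset_le)
      show "k integrable_on {h..t}" by (rule integrable_continuous_interval[OF cY(3)])
      show "k integrable_on {0..t}" using t0 by (intro integrable_continuous_interval continuous_on_subset[OF kc]) auto
    qed (use h t0 k0 in auto)
    moreover have "integral {t - h..t} Y \<ge> h * (Y t - e/3)"
    proof -
      have "integral {t - h..t} (\<lambda>_. Y t - e/3) \<le> integral {t - h..t} Y"
      proof (rule integral_le)
        show "Y integrable_on {t - h..t}" using h t0 by (intro integrable_continuous_interval continuous_on_subset[OF Yc]) auto
        fix b assume "b \<in> {t - h..t}"
        then have "dist (Y b) (Y t) < e/3" using h t0 by (intro d1(2)) (auto simp: dist_real_def)
        then show "Y t - e/3 \<le> Y b" unfolding dist_real_def by linarith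
      qed auto
      then show ?thesis using h by simp
    qed
    moreover have "integral {0..h} Y \<le> h * (Y 0 + e/3)"
    proof -
      have "integral {0..h} Y \<le> integral {0..h} (\<lambda>_. Y 0 + e/3)"
      proof (rule integral_le)
        show "Y integrable_on {0..h}" using h t0 by (intro integrable_continuous_interval continuous_on_subset[OF Yc]) auto
        fix b assume "b \<in> {0..h}"
        then have "dist (Y b) (Y 0) < e/3" using h t0 by (intro d2(2)) (auto simp: dist_real_def)
        then show "Y b \<le> Y 0 + e/3" unfolding dist_real_def by linarith
      qed auto
      then show ?thesis using h by simp
    qed
    moreover have "h * integral {h..t} k \<le> h * integral {0..t} k"
      using h calculation by (intro mult_left_mono) auto
    ultimately have "h * (Y t - e/3) - h * (Y 0 + e/3) - h * integral {0..t} k \<le> h * (e/3)" by linarith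
    then have "h * (Y t - Y 0) \<le> h * (integral {0..t} k + e)" by (simp add: algebra_simps)
    then show "Y t - Y 0 \<le> integral {0..t} k + e" using h by simp
  qed
qed

section \<open>Young's inequality and translates of products\<close>

text \<open>Comparing y with \<eta> x makes one of the two terms alone an upper bound. The exponent
  p - 1 is the growth of the flux in the structure conditions.\<close>

lemma powr_young:
  fixes x y p \<eta> :: real
  assumes p: "p > 1" and x: "x \<ge> 0" and y: "y \<ge> 0" and \<eta>: "\<eta> > 0"
  shows "x powr (p - 1) * y \<le> \<eta> * x powr p + \<eta> powr (1 - p) * y powr p"
proof (cases "y \<le> \<eta> * x")
  case True
  have "x powr (p - 1) * y \<le> x powr (p - 1) * (\<eta> * x)" using True by (intro mult_left_mono) auto
  also have "\<dots> = \<eta> * x powr p" using powr_mult_base[OF x, of "p - 1"] by (simp add: mult_ac)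
  also have "\<dots> \<le> \<eta> * x powr p + \<eta> powr (1 - p) * y powr p" by simp
  finally show ?thesis .
next
  case False
  then have le: "x \<le> y / \<eta>" using \<eta> by (simp add: field_simps)
  have "x powr (p - 1) * y \<le> (y / \<eta>) powr (p - 1) * y"
    using le x p y by (intro mult_right_mono powr_mono2) auto
  also have "\<dots> = \<eta> powr (1 - p) * (y powr (p - 1) * y)"
    using powr_minus[of \<eta> "p - 1"] by (simp add: powr_divide) (simp add: divide_inverse mult_ac)
  also have "y powr (p - 1) * y = y powr p" using powr_mult_base[OF y, of "p - 1"] by (simp add: mult_ac)
  also have "\<eta> powr (1 - p) * y powr p \<le> \<eta> * x powr p + \<eta> powr (1 - p) * y powr p" using \<eta> by simp
  finally show ?thesis .
qed

text \<open>Hoelder pairing in additive form: D lies in L^p, so P, of size D^(p-1), lies in the dual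
  space.\<close>

lemma integrable_powr_product:
  fixes P Q D :: "'a \<Rightarrow> real"
  assumes p: "p > 1" and P: "P \<in> borel_measurable M" "\<And>z. \<bar>P z\<bar> \<le> D z powr (p - 1)" "\<And>z. D z \<ge> 0"
    and D: "integrable M (\<lambda>z. D z powr p)" and Q: "Q \<in> borel_measurable M" "integrable M (\<lambda>z. \<bar>Q z\<bar> powr p)"
  shows "integrable M (\<lambda>z. P z * Q z)"
proof (rule Bochner_Integration.integrable_bound)
  show "integrable M (\<lambda>z. D z powr p + \<bar>Q z\<bar> powr p)" using D Q by simp
  show "AE z in M. norm (P z * Q z) \<le> norm (D z powr p + \<bar>Q z\<bar> powr p)"
  proof (rule AE_I2)
    fix z
    have "\<bar>P z\<bar> * \<bar>Q z\<bar> \<le> D z powr (p - 1) * \<bar>Q z\<bar>" by (intro mult_right_mono P) auto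
    also have "\<dots> \<le> D z powr p + \<bar>Q z\<bar> powr p" using powr_young[OF p P(3)[of z], of "\<bar>Q z\<bar>" 1] by simp
    finally show "norm (P z * Q z) \<le> norm (D z powr p + \<bar>Q z\<bar> powr p)" by (simp add: abs_mult)
  qed
qed (use P Q in simp)

text \<open>Q is unbounded, so L^1 continuity of translations of P is not enough. It handles the set
  |Q| <= k; on the rest Young's inequality puts a small factor on the two translates of D^p and a
  large factor on the tail of |Q|^p.\<close>

lemma product_translation:
  fixes P Q D :: "'a::euclidean_space \<Rightarrow> real"
  assumes p: "p > 1" and P: "integrable lborel P" "\<And>z. \<bar>P z\<bar> \<le> D z powr (p - 1)" "\<And>z. D z \<ge> 0"
    and D: "integrable lborel (\<lambda>z. D z powr p)"
    and Q: "Q \<in> borel_measurable borel" "integrable lborel (\<lambda>z. \<bar>Q z\<bar> powr p)" and e: "e > 0"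
  shows "\<exists>d>0. \<forall>v. norm v < d \<longrightarrow> (\<integral>\<^sup>+z. ennreal (\<bar>P (z + v) - P z\<bar> * \<bar>Q z\<bar>) \<partial>lborel) \<le> ennreal e"
proof -
  note [measurable] = Q(1)
  define I where "I = (\<integral>z. D z powr p \<partial>lborel)"
  have I: "I \<ge> 0" unfolding I_def by (rule Bochner_Integration.integral_nonneg) auto
  \<comment> \<open>The two translates of D^p each cost \<eta> I, together at most e/3; the + 1
    covers I = 0.\<close>
  define \<eta> where "\<eta> = e / (6 * (I + 1))"
  have \<eta>: "\<eta> > 0" using e I by (simp add: \<eta>_def)
  have \<eta>I: "2 * \<eta> * I \<le> e / 3"
  proof -
    have "2 * \<eta> * I \<le> 2 * \<eta> * (I + 1)" using \<eta> by simp
    also have "\<dots> = e / 3" using I by (simp add: \<eta>_def field_simps)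
    finally show ?thesis .
  qed
  define C where "C = \<eta> powr (1 - p)"
  have C: "C > 0" using \<eta> by (simp add: C_def)
  \<comment> \<open>The part of |Q| above level k. The order of choices is \<eta>, then k so that
    the tail compensates C = \<eta>^(1-p), then the shift bound d depending on k.\<close>
  let ?R = "\<lambda>k z. if \<bar>Q z\<bar> \<le> real k then 0 else \<bar>Q z\<bar>"
  have "(\<lambda>k. \<integral>z. (?R k z) powr p \<partial>lborel) \<longlonglongrightarrow> (\<integral>z. 0 \<partial>(lborel :: 'a measure))"
  proof (rule integral_dominated_convergence[where w="\<lambda>z. \<bar>Q z\<bar> powr p"])
    show "AE z in lborel. (\<lambda>k. (?R k z) powr p) \<longlonglongrightarrow> 0"
    proof (rule AE_I2)
      fix z
      have "\<forall>\<^sub>F k in sequentially. (?R k z) powr p = 0"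
        using eventually_ge_at_top[of "nat \<lceil>\<bar>Q z\<bar>\<rceil>"]
        by eventually_elim (auto simp: nat_ceiling_le_eq)
      then show "(\<lambda>k. (?R k z) powr p) \<longlonglongrightarrow> 0" by (rule tendsto_eventually)
    qed
  qed (use Q(2) in auto)
  then have "(\<lambda>k. \<integral>z. (?R k z) powr p \<partial>lborel) \<longlonglongrightarrow> 0" by simp
  from LIMSEQ_D[OF this, of "e / (6 * C)"] e C obtain k where
    k: "\<bar>\<integral>z. (?R k z) powr p \<partial>lborel\<bar> < e / (6 * C)" by auto
  have kC: "2 * C * (\<integral>z. (?R k z) powr p \<partial>lborel) \<le> e / 3"
  proof -
    have "2 * C * (\<integral>z. (?R k z) powr p \<partial>lborel) \<le> 2 * C * (e / (6 * C))"
      using k C by (intro mult_left_mono) auto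
    also have "\<dots> = e / 3" using C by (simp add: field_simps)
    finally show ?thesis .
  qed
  obtain d where d: "d > 0" "\<And>v. norm v < d \<Longrightarrow> (\<integral>z. \<bar>P (z + v) - P z\<bar> \<partial>lborel) < e / (3 * (real k + 1))"
    using L1_translation_continuous[OF P(1), of "e / (3 * (real k + 1))"] e by auto
  have "(\<integral>\<^sup>+z. ennreal (\<bar>P (z + v) - P z\<bar> * \<bar>Q z\<bar>) \<partial>lborel) \<le> ennreal e" if v: "norm v < d" for v
  proof -
    let ?B = "\<lambda>z. real k * \<bar>P (z + v) - P z\<bar> + (\<eta> * D (z + v) powr p + \<eta> * D z powr p + 2 * C * (?R k z) powr p)"
    have iR: "integrable lborel (\<lambda>z. (?R k z) powr p)"
      by (rule Bochner_Integration.integrable_bound[OF Q(2)]) auto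
    have iD: "integrable lborel (\<lambda>z. D (z + v) powr p)" by (rule integrable_translation[OF D])
    have iP: "integrable lborel (\<lambda>z. \<bar>P (z + v) - P z\<bar>)"
      by (intro integrable_abs Bochner_Integration.integrable_diff integrable_translation P)
    have iB: "integrable lborel ?B"
      using iR iD iP D by (intro Bochner_Integration.integrable_add integrable_mult_right) auto
    have pt: "\<bar>P (z + v) - P z\<bar> * \<bar>Q z\<bar> \<le> ?B z" for z
    proof (cases "\<bar>Q z\<bar> \<le> real k")
      case True
      then have "\<bar>P (z + v) - P z\<bar> * \<bar>Q z\<bar> \<le> real k * \<bar>P (z + v) - P z\<bar>"
        by (subst mult.commute) (intro mult_right_mono, auto)
      moreover have "0 \<le> \<eta> * D (z + v) powr p + \<eta> * D z powr p + 2 * C * (?R k z) powr p"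
        using \<eta> C by simp
      ultimately show ?thesis by linarith
    next
      case False
      have "\<bar>P (z + v) - P z\<bar> * \<bar>Q z\<bar> \<le> (D (z + v) powr (p - 1) + D z powr (p - 1)) * \<bar>Q z\<bar>"
        using P(2)[of z] P(2)[of "z + v"] by (intro mult_right_mono) linarith+
      also have "\<dots> \<le> (\<eta> * D (z + v) powr p + C * \<bar>Q z\<bar> powr p) + (\<eta> * D z powr p + C * \<bar>Q z\<bar> powr p)"
        unfolding distrib_right C_def by (intro add_mono powr_young p P \<eta>) auto
      also have "\<dots> \<le> ?B z" using False by simp
      finally show ?thesis .
    qed
    have "(\<integral>\<^sup>+z. ennreal (\<bar>P (z + v) - P z\<bar> * \<bar>Q z\<bar>) \<partial>lborel) \<le> (\<integral>\<^sup>+z. ennreal (?B z) \<partial>lborel)"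
      by (intro nn_integral_mono ennreal_leI pt)
    also have "\<dots> = ennreal (\<integral>z. ?B z \<partial>lborel)"
      using \<eta> C by (intro nn_integral_eq_integral iB) simp
    also have "(\<integral>z. ?B z \<partial>lborel) = real k * (\<integral>z. \<bar>P (z + v) - P z\<bar> \<partial>lborel)
        + (\<eta> * (\<integral>z. D (z + v) powr p \<partial>lborel) + \<eta> * I + 2 * C * (\<integral>z. (?R k z) powr p \<partial>lborel))"
    proof -
      have a: "integrable lborel (\<lambda>z. real k * \<bar>P (z + v) - P z\<bar>)" using iP by simp
      have b: "integrable lborel (\<lambda>z. \<eta> * D (z + v) powr p)" using iD by simp
      have c: "integrable lborel (\<lambda>z. \<eta> * D z powr p)" using D by simp
      have f: "integrable lborel (\<lambda>z. 2 * C * (?R k z) powr p)" using integrable_mult_right[OF iR, of "2 * C"] .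
      show ?thesis unfolding I_def
        by (simp only: Bochner_Integration.integral_add[OF a Bochner_Integration.integrable_add[OF Bochner_Integration.integrable_add[OF b c] f]]
            Bochner_Integration.integral_add[OF Bochner_Integration.integrable_add[OF b c] f]
            Bochner_Integration.integral_add[OF b c] integral_mult_right_zero)
    qed
    also have "(\<integral>z. D (z + v) powr p \<partial>lborel) = I"
      unfolding I_def using borel_measurable_integrable[OF D] by (intro integral_translation) simp
    also have "real k * (\<integral>z. \<bar>P (z + v) - P z\<bar> \<partial>lborel) + (\<eta> * I + \<eta> * I + 2 * C * (\<integral>z. (?R k z) powr p \<partial>lborel)) \<le> e"
    proof -
      have "real k * (\<integral>z. \<bar>P (z + v) - P z\<bar> \<partial>lborel) \<le> (real k + 1) * (e / (3 * (real k + 1)))"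
        using d(2)[OF v] by (intro mult_mono) auto
      also have "\<dots> = e / 3" by (simp add: field_simps)
      finally show ?thesis using \<eta>I kC by linarith
    qed
    finally show ?thesis by (simp add: ennreal_leI)
  qed
  with d(1) show ?thesis by blast
qed

lemma product_translation_bounded:
  fixes P Q :: "'a::euclidean_space \<Rightarrow> real"
  assumes P: "integrable lborel P" and Q: "Q \<in> borel_measurable borel" "\<And>z. \<bar>Q z\<bar> \<le> C" and e: "e > 0"
  shows "\<exists>d>0. \<forall>v. norm v < d \<longrightarrow> (\<integral>\<^sup>+z. ennreal (\<bar>P (z + v) - P z\<bar> * \<bar>Q z\<bar>) \<partial>lborel) \<le> ennreal e"
proof -
  have C: "C \<ge> 0" using Q(2)[of 0] by linarith
  obtain d where d: "d > 0" "\<And>v. norm v < d \<Longrightarrow> (\<integral>z. \<bar>P (z + v) - P z\<bar> \<partial>lborel) < e / (C + 1)"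
    using L1_translation_continuous[OF P, of "e / (C + 1)"] e C by auto
  have "(\<integral>\<^sup>+z. ennreal (\<bar>P (z + v) - P z\<bar> * \<bar>Q z\<bar>) \<partial>lborel) \<le> ennreal e" if v: "norm v < d" for v
  proof -
    have iP: "integrable lborel (\<lambda>z. C * \<bar>P (z + v) - P z\<bar>)"
      by (intro integrable_mult_right integrable_abs Bochner_Integration.integrable_diff integrable_translation P)
    have "(\<integral>\<^sup>+z. ennreal (\<bar>P (z + v) - P z\<bar> * \<bar>Q z\<bar>) \<partial>lborel) \<le> (\<integral>\<^sup>+z. ennreal (C * \<bar>P (z + v) - P z\<bar>) \<partial>lborel)"
      using Q(2) by (intro nn_integral_mono ennreal_leI) (simp add: mult.commute mult_right_mono)
    also have "\<dots> = ennreal (C * (\<integral>z. \<bar>P (z + v) - P z\<bar> \<partial>lborel))"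
      using C nn_integral_eq_integral[OF iP] by simp
    also have "C * (\<integral>z. \<bar>P (z + v) - P z\<bar> \<partial>lborel) \<le> (C + 1) * (e / (C + 1))"
      using d(2)[OF v] C by (intro mult_mono) auto
    finally show ?thesis using C by (simp add: ennreal_leI)
  qed
  with d(1) show ?thesis by blast
qed

section \<open>Gronwall's inequality and measurability of superpositions\<close>

text \<open>Y is only continuous, so the argument runs on the integral majorant Z, which is
  differentiable and satisfies Z' <= \<kappa> Z; hence Z exp(-\<kappa> s) decreases.\<close>

lemma gronwall:
  fixes Y :: "real \<Rightarrow> real"
  assumes Yc: "continuous_on {0..t} Y" and \<kappa>: "\<kappa> \<ge> 0" and t: "t \<ge> 0"
    and Y: "\<And>s. s \<in> {0..t} \<Longrightarrow> Y s - Y 0 \<le> integral {0..s} (\<lambda>b. \<kappa> * (Y b + c))"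
  shows "Y t + c \<le> (Y 0 + c) * exp (\<kappa> * t)"
proof -
  define Z where "Z s = Y 0 + c + integral {0..s} (\<lambda>b. \<kappa> * (Y b + c))" for s
  have kc: "continuous_on {0..t} (\<lambda>b. \<kappa> * (Y b + c))" by (intro continuous_intros Yc)
  have Zd: "(Z has_real_derivative \<kappa> * (Y s + c)) (at s within {0..t})" if "s \<in> {0..t}" for s
    unfolding Z_def
    by (rule DERIV_cong[OF DERIV_add[OF DERIV_const integral_has_real_derivative[OF kc that]]]) simp
  have le: "Y s + c \<le> Z s" if "s \<in> {0..t}" for s using Y[OF that] by (simp add: Z_def)
  have "Z t * exp (- \<kappa> * t) \<le> Z 0 * exp (- \<kappa> * 0)"
  proof (rule DERIV_nonpos_imp_decreasing_open[OF t])
    fix s assume s: "0 < s" "s < t"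
    have "(Z has_real_derivative \<kappa> * (Y s + c)) (at s)"
      using Zd[of s] s at_within_Icc_at[of 0 s t] by simp
    then have "((\<lambda>s. Z s * exp (- \<kappa> * s)) has_real_derivative \<kappa> * (Y s + c) * exp (- \<kappa> * s) + (exp (- \<kappa> * s) * - \<kappa>) * Z s) (at s)"
      by (auto intro!: derivative_eq_intros)
    moreover have "\<kappa> * (Y s + c) * exp (- \<kappa> * s) + (exp (- \<kappa> * s) * - \<kappa>) * Z s \<le> 0"
    proof -
      have "\<kappa> * (Y s + c) * exp (- \<kappa> * s) + (exp (- \<kappa> * s) * - \<kappa>) * Z s = - (\<kappa> * exp (- \<kappa> * s) * (Z s - (Y s + c)))"
        by (simp add: algebra_simps)
      also have "\<dots> \<le> 0" using le[of s] s \<kappa> by simp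
      finally show ?thesis .
    qed
    ultimately show "\<exists>y. ((\<lambda>s. Z s * exp (- \<kappa> * s)) has_real_derivative y) (at s) \<and> y \<le> 0" by blast
  next
    have "continuous_on {0..t} Z" using Zd by (meson DERIV_continuous_on)
    then show "continuous_on {0..t} (\<lambda>s. Z s * exp (- \<kappa> * s))" by (intro continuous_intros)
  qed
  then have "Z t * exp (- \<kappa> * t) \<le> Y 0 + c" by (simp add: Z_def)
  then have "Z t \<le> (Y 0 + c) * exp (\<kappa> * t)" by (simp add: exp_minus field_simps)
  with le[of t] t show ?thesis by simp
qed

text \<open>A simple approximation of f takes finitely many values, and measurability in z is given
  for each of them; continuity in the second argument passes to the limit.\<close>

lemma caratheodory_measurable:
  fixes F :: "'z \<Rightarrow> 'b::euclidean_space \<Rightarrow> 'c::euclidean_space"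
  assumes F: "\<And>v. (\<lambda>z. F z v) \<in> borel_measurable M" and c: "\<And>z. z \<in> space M \<Longrightarrow> continuous_on UNIV (F z)"
    and f: "f \<in> borel_measurable M"
  shows "(\<lambda>z. F z (f z)) \<in> borel_measurable M"
proof -
  obtain s where s: "\<And>i::nat. simple_function M (s i)" "\<And>x. x \<in> space M \<Longrightarrow> (\<lambda>i. s i x) \<longlonglongrightarrow> f x"
    using borel_measurable_implies_sequence_metric[OF f, of 0] by blast
  show ?thesis
  proof (rule borel_measurable_LIMSEQ_metric)
    fix i
    show "(\<lambda>z. F z (s i z)) \<in> borel_measurable M"
    proof (rule measurable_compose_countable'[where f="\<lambda>v z. F z v" and I="s i ` space M"])
      show "s i \<in> measurable M (count_space (s i ` space M))"
        using s(1)[of i] by (subst measurable_count_space_eq2) (auto simp: simple_function_def)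
    qed (use F s(1)[of i] in \<open>auto simp: simple_function_def countable_finite\<close>)
  next
    fix z assume z: "z \<in> space M"
    have "isCont (F z) (f z)" using c[OF z] by (simp add: continuous_on_eq_continuous_at)
    then show "(\<lambda>i. F z (s i z)) \<longlonglongrightarrow> F z (f z)"
      by (rule isCont_tendsto_compose[OF _ s(2)[OF z]])
  qed
qed

subsection \<open>Pointwise energy estimate\<close>

text \<open>The exponent \<open>n = p / (2 - p)\<close> splits the cases \<open>w \<zeta>\<^sup>n \<ge> \<nu>\<close> and \<open>w \<zeta>\<^sup>n < \<nu>\<close>; the loss of \<open>\<zeta>\<^sup>p\<close> from
  differentiating the cutoff is absorbed by the singular exponent \<open>p < 2\<close>.\<close>

lemma cutoff_absorption:
  fixes p r m w \<nu> \<zeta> :: real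
  assumes p: "1 < p" "p < 2" and r: "r > 1" and m: "m \<ge> p + p / (2 - p) * (r - 2 + p)"
    and \<nu>: "\<nu> > 0" and w: "w \<ge> \<nu>" and \<zeta>: "0 < \<zeta>" "\<zeta> \<le> 1"
  shows "\<nu> powr (2 - p) * (w powr (r - 2 + p) * \<zeta> powr (m - p)) \<le> w powr r * \<zeta> powr m + \<nu> powr r"
proof -
  define n where "n = p / (2 - p)"
  have n: "n * (2 - p) = p" "n > 0" using p by (auto simp: n_def)
  have w0: "w > 0" using \<nu> w by simp
  show ?thesis
  proof (cases "\<nu> \<le> w * \<zeta> powr n")
    case True
    have "\<nu> powr (2 - p) \<le> (w * \<zeta> powr n) powr (2 - p)"
      using True \<nu> p by (intro powr_mono2) auto
    also have "\<dots> = w powr (2 - p) * \<zeta> powr p" by (simp add: powr_mult powr_powr n)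
    finally have "\<nu> powr (2 - p) * (w powr (r - 2 + p) * \<zeta> powr (m - p))
      \<le> (w powr (2 - p) * \<zeta> powr p) * (w powr (r - 2 + p) * \<zeta> powr (m - p))"
      by (intro mult_right_mono) auto
    also have "\<dots> = (w powr (2 - p) * w powr (r - 2 + p)) * (\<zeta> powr p * \<zeta> powr (m - p))" by (simp add: mult_ac)
    also have "\<dots> = w powr r * \<zeta> powr m" by (simp flip: powr_add)
    finally show ?thesis by (smt (verit) powr_ge_zero)
  next
    case False
    then have "w \<le> \<nu> * \<zeta> powr (- n)" using \<zeta> by (simp add: powr_minus field_simps)
    \<comment> \<open>The exponent r - 2 + p is positive because r > 1 and p > 1, although r - 2 may
      be negative.\<close>
    then have "w powr (r - 2 + p) \<le> (\<nu> * \<zeta> powr (- n)) powr (r - 2 + p)"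
      using w0 p r by (intro powr_mono2) auto
    also have "\<dots> = \<nu> powr (r - 2 + p) * \<zeta> powr (- n * (r - 2 + p))" by (simp add: powr_mult powr_powr)
    finally have "\<nu> powr (2 - p) * (w powr (r - 2 + p) * \<zeta> powr (m - p))
      \<le> \<nu> powr (2 - p) * (\<nu> powr (r - 2 + p) * \<zeta> powr (- n * (r - 2 + p)) * \<zeta> powr (m - p))"
      by (intro mult_left_mono mult_right_mono) auto
    also have "\<dots> = (\<nu> powr (2 - p) * \<nu> powr (r - 2 + p)) * (\<zeta> powr (- n * (r - 2 + p)) * \<zeta> powr (m - p))"
      by (simp add: mult_ac)
    also have "\<dots> = \<nu> powr r * \<zeta> powr (- n * (r - 2 + p) + (m - p))" by (simp flip: powr_add)
    also have "\<dots> \<le> \<nu> powr r * 1"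
    proof (intro mult_left_mono)
      \<comment> \<open>The lower bound on m says precisely that this exponent of \<zeta> <= 1 is
        nonnegative.\<close>
      have "0 \<le> - n * (r - 2 + p) + (m - p)" using m by (simp add: n_def)
      then show "\<zeta> powr (- n * (r - 2 + p) + (m - p)) \<le> 1"
        using powr_mono'[of 0 "- n * (r - 2 + p) + (m - p)" \<zeta>] \<zeta> by simp
    qed simp
    finally show ?thesis by (smt (verit) mult_nonneg_nonneg powr_ge_zero)
  qed
qed

text \<open>The contribution of one coordinate direction, with K the constant C of the structure
  conditions and d the derivative of the cutoff. \<Gamma> is quantified before w, \<nu>, t and K, so
  it depends on the exponents and structure constants only. Coercivity absorbs all powers of \<xi>;
  what remains is bounded after multiplication by t.\<close>

lemma pointwise_energy:
  fixes p r C\<^sub>o C\<^sub>1 L :: real and m :: nat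
  assumes p: "1 < p" "p < 2" and r: "r > 1" and Co: "C\<^sub>o > 0" and C1: "C\<^sub>1 > 0" and L: "L \<ge> 0"
    and m: "real m \<ge> p + p / (2 - p) * (r - 2 + p)" "m \<ge> 2"
  shows "\<exists>\<Gamma>\<ge>0. \<forall>w \<nu> t K \<zeta> d \<xi> A. \<nu> > 0 \<longrightarrow> w \<ge> \<nu> \<longrightarrow> t > 0 \<longrightarrow> K \<ge> 0 \<longrightarrow> 0 \<le> \<zeta> \<longrightarrow> \<zeta> \<le> 1 \<longrightarrow>
    t * \<bar>d\<bar> powr p \<le> L * \<nu> powr (2 - p) \<longrightarrow> t * K powr p \<le> \<nu>\<^sup>2 \<longrightarrow> t * K powr p \<le> \<nu> powr (2 - p) \<longrightarrow>
    t * K powr p \<le> \<nu> \<longrightarrow> A * \<xi> \<ge> C\<^sub>o * \<bar>\<xi>\<bar> powr p - K powr p \<longrightarrow>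
    \<bar>A\<bar> \<le> C\<^sub>1 * \<bar>\<xi>\<bar> powr (p - 1) + K powr (p - 1) \<longrightarrow>
    K * (\<bar>\<xi>\<bar> powr (p - 1) + K powr (p - 1)) * (w powr (r - 1) * \<zeta> ^ m)
      - A * ((r - 1) * w powr (r - 2) * \<xi> * \<zeta> ^ m + w powr (r - 1) * (real m * \<zeta> ^ (m - 1) * d))
    \<le> \<Gamma> / t * (w powr r * \<zeta> ^ m + \<nu> powr r)"
proof -
  \<comment> \<open>Chosen so that the terms \<eta> |\<xi>|^p, with total coefficient m
    \<open>C\<^sub>1\<close> from the flux on the cutoff gradient and 1 from the source, cancel the
    coercive term exactly.\<close>
  define \<eta> where "\<eta> = (r - 1) * C\<^sub>o / (m * C\<^sub>1 + 1)"
  have \<eta>: "\<eta> > 0" unfolding \<eta>_def using r Co C1 by (intro divide_pos_pos mult_pos_pos add_nonneg_pos) auto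
  have abs\<eta>: "(m * C\<^sub>1 + 1) * \<eta> = (r - 1) * C\<^sub>o"
    unfolding \<eta>_def using C1 m(2) by (simp add: add_pos_pos less_imp_neq[symmetric])
  define H where "H = \<eta> powr (1 - p)"
  have H: "H \<ge> 0" by (simp add: H_def)
  \<comment> \<open>The sum of the coefficients in front of the bounds F1 to F4: r - 1 from the
    defect of coercivity, the terms with m from the flux on the cutoff gradient, and H + 1 from the
    source.\<close>
  define \<Gamma> where "\<Gamma> = (r - 1) + m * C\<^sub>1 * H * L + m * (1 + L) + H + 1"
  have \<Gamma>: "\<Gamma> \<ge> 0" unfolding \<Gamma>_def using r C1 H L by (intro add_nonneg_nonneg mult_nonneg_nonneg) auto
  show ?thesis
  proof (intro exI[of _ \<Gamma>] conjI allI impI \<Gamma>)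
    fix w \<nu> t K \<zeta> d \<xi> A :: real
    assume \<nu>: "\<nu> > 0" and w: "w \<ge> \<nu>" and t: "t > 0" and K: "K \<ge> 0" and \<zeta>: "0 \<le> \<zeta>" "\<zeta> \<le> 1"
      and d: "t * \<bar>d\<bar> powr p \<le> L * \<nu> powr (2 - p)"
      and K1: "t * K powr p \<le> \<nu>\<^sup>2" and K2: "t * K powr p \<le> \<nu> powr (2 - p)" and K3: "t * K powr p \<le> \<nu>"
      and A1: "A * \<xi> \<ge> C\<^sub>o * \<bar>\<xi>\<bar> powr p - K powr p"
      and A2: "\<bar>A\<bar> \<le> C\<^sub>1 * \<bar>\<xi>\<bar> powr (p - 1) + K powr (p - 1)"
    let ?lhs = "K * (\<bar>\<xi>\<bar> powr (p - 1) + K powr (p - 1)) * (w powr (r - 1) * \<zeta> ^ m)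
      - A * ((r - 1) * w powr (r - 2) * \<xi> * \<zeta> ^ m + w powr (r - 1) * (real m * \<zeta> ^ (m - 1) * d))"
    let ?F = "w powr r * \<zeta> ^ m + \<nu> powr r"
    have w0: "w > 0" using \<nu> w by simp
    show "?lhs \<le> \<Gamma> / t * ?F"
    \<comment> \<open>The substitution y below divides by \<zeta>. Where \<zeta> = 0, m >= 2 makes
      the power m - 1 vanish too.\<close>
    proof (cases "\<zeta> = 0")
      case True
      then have z: "\<zeta> ^ m = 0" "\<zeta> ^ (m - 1) = 0" using m(2) by (auto simp: power_0_left)
      show ?thesis unfolding z using \<Gamma> t by simp
    next
      case False
      then have \<zeta>0: "\<zeta> > 0" using \<zeta> by simp
      \<comment> \<open>In terms of X and y every product becomes X times a power; y is chosen so
        that the weight on the cutoff gradient is X y, with |\<xi>| and y on an equal footing in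
        Young's inequality.\<close>
      define X where "X = w powr (r - 2) * \<zeta> ^ m"
      define y where "y = w * \<bar>d\<bar> / \<zeta>"
      define s where "s = \<bar>\<xi>\<bar>"
      have X: "X \<ge> 0" using \<zeta> by (simp add: X_def)
      have y: "y \<ge> 0" using w0 \<zeta> by (simp add: y_def)
      have s: "s \<ge> 0" by (simp add: s_def)
      have wr1: "w powr (r - 1) = w powr (r - 2) * w"
        using powr_mult_base[of w "r - 2"] w0 by (simp add: mult.commute)
      have wr: "w powr r = w powr (r - 2) * w\<^sup>2"
        using powr_mult_base[of w "r - 1"] w0 wr1 by (simp add: power2_eq_square mult_ac)
      have XF: "X * w\<^sup>2 \<le> ?F" by (simp add: X_def wr mult_ac)
      have X1: "w powr (r - 1) * \<zeta> ^ m = X * w" by (simp add: X_def wr1 mult_ac)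
      have X2: "w powr (r - 1) * \<zeta> ^ (m - 1) * \<bar>d\<bar> = X * y"
      proof -
        have "\<zeta> ^ m = \<zeta> * \<zeta> ^ (m - 1)" using m(2) by (metis One_nat_def Suc_pred less_le_trans pos2 power_Suc)
        then show ?thesis using \<zeta>0 by (simp add: X_def y_def wr1 mult_ac)
      qed
      \<comment> \<open>F1, F3 and F4 each use one of the three smallness conditions on t K^p
        together with w >= \<nu>; F2 is the cutoff absorption.\<close>
      have F1: "t * (X * K powr p) \<le> ?F"
      proof -
        have "t * (X * K powr p) = X * (t * K powr p)" by simp
        also have "\<dots> \<le> X * \<nu>\<^sup>2" by (intro mult_left_mono K1 X)
        also have "\<dots> \<le> X * w\<^sup>2" using w \<nu> by (intro mult_left_mono power_mono X) auto
        finally show ?thesis using XF by simp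
      qed
      have pw: "w powr (r - 2) * w powr p = w powr (r - 2 + p)" by (simp add: powr_add)
      have F2: "t * (X * y powr p) \<le> L * ?F"
      proof -
        have z: "\<zeta> ^ m = \<zeta> powr real m" using \<zeta>0 by (simp add: powr_realpow)
        have "X * y powr p = w powr (r - 2) * \<zeta> powr real m * (w powr p * \<bar>d\<bar> powr p / \<zeta> powr p)"
          by (simp add: X_def y_def z powr_mult powr_divide)
        also have "\<dots> = (w powr (r - 2) * w powr p) * (\<zeta> powr real m / \<zeta> powr p) * \<bar>d\<bar> powr p"
          by (simp add: mult_ac)
        also have "\<dots> = \<bar>d\<bar> powr p * (w powr (r - 2 + p) * \<zeta> powr (real m - p))"
          unfolding pw by (simp only: powr_diff[of \<zeta> "real m" p] mult_ac)
        finally have "t * (X * y powr p) = (t * \<bar>d\<bar> powr p) * (w powr (r - 2 + p) * \<zeta> powr (real m - p))"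
          by simp
        also have "\<dots> \<le> (L * \<nu> powr (2 - p)) * (w powr (r - 2 + p) * \<zeta> powr (real m - p))"
          by (intro mult_right_mono d) auto
        also have "\<dots> = L * (\<nu> powr (2 - p) * (w powr (r - 2 + p) * \<zeta> powr (real m - p)))" by simp
        also have "\<dots> \<le> L * ?F"
          unfolding z by (intro mult_left_mono cutoff_absorption p r m \<nu> w \<zeta>0 \<zeta> L)
        finally show ?thesis .
      qed
      have F3: "t * (X * (K powr p * w powr p)) \<le> ?F"
      proof -
        have "t * (X * (K powr p * w powr p)) = (t * K powr p) * (X * w powr p)" by simp
        also have "\<dots> \<le> w powr (2 - p) * (X * w powr p)"
        proof (intro mult_right_mono)
          have "\<nu> powr (2 - p) \<le> w powr (2 - p)" using \<nu> w p by (intro powr_mono2) auto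
          with K2 show "t * K powr p \<le> w powr (2 - p)" by simp
        qed (use X in simp)
        also have "\<dots> = X * (w powr (2 - p) * w powr p)" by simp
        also have "w powr (2 - p) * w powr p = w\<^sup>2" using w0 by (simp flip: powr_add)
        finally show ?thesis using XF by simp
      qed
      have F4: "t * (X * (K powr p * w)) \<le> ?F"
      proof -
        have "t * (X * (K powr p * w)) = (t * K powr p) * (X * w)" by simp
        also have "\<dots> \<le> w * (X * w)" using K3 w X w0 by (intro mult_right_mono) auto
        also have "\<dots> = X * w\<^sup>2" by (simp add: power2_eq_square)
        finally show ?thesis using XF by simp
      qed
      have Kp: "K * K powr (p - 1) = K powr p" using powr_mult_base[OF K, of "p - 1"] by simp
      \<comment> \<open>j1 is coercivity, j2 the flux against the cutoff gradient, j3 the source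
        term.\<close>
      have j1: "- A * ((r - 1) * w powr (r - 2) * \<xi> * \<zeta> ^ m) \<le> (r - 1) * (X * (K powr p - C\<^sub>o * s powr p))"
      proof -
        have "- A * ((r - 1) * w powr (r - 2) * \<xi> * \<zeta> ^ m) = (r - 1) * (X * - (A * \<xi>))" by (simp add: X_def mult_ac)
        also have "\<dots> \<le> (r - 1) * (X * (K powr p - C\<^sub>o * s powr p))"
          using A1 r X by (intro mult_left_mono) (auto simp: s_def)
        finally show ?thesis .
      qed
      have j2: "- A * (w powr (r - 1) * (real m * \<zeta> ^ (m - 1) * d))
        \<le> m * (X * (C\<^sub>1 * (\<eta> * s powr p + H * y powr p) + (K powr p + y powr p)))"
      proof -
        have "- A * (w powr (r - 1) * (real m * \<zeta> ^ (m - 1) * d)) \<le> \<bar>A * (w powr (r - 1) * (real m * \<zeta> ^ (m - 1) * d))\<bar>"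
          by simp
        also have "\<dots> = \<bar>A\<bar> * (m * (w powr (r - 1) * \<zeta> ^ (m - 1) * \<bar>d\<bar>))" using \<zeta> by (simp add: abs_mult mult_ac)
        also have "\<dots> = m * (X * (\<bar>A\<bar> * y))" unfolding X2 by simp
        also have "\<dots> \<le> m * (X * ((C\<^sub>1 * s powr (p - 1) + K powr (p - 1)) * y))"
          using A2 X y by (intro mult_left_mono mult_right_mono) (auto simp: s_def)
        also have "(C\<^sub>1 * s powr (p - 1) + K powr (p - 1)) * y = C\<^sub>1 * (s powr (p - 1) * y) + K powr (p - 1) * y"
          by (simp add: algebra_simps)
        also have "m * (X * (C\<^sub>1 * (s powr (p - 1) * y) + K powr (p - 1) * y))
          \<le> m * (X * (C\<^sub>1 * (\<eta> * s powr p + H * y powr p) + (K powr p + y powr p)))"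
          using powr_young[OF p(1) s y \<eta>] powr_young[OF p(1) K y, of 1] C1 X
          by (intro mult_left_mono add_mono) (auto simp: H_def)
        finally show ?thesis .
      qed
      have j3: "K * (\<bar>\<xi>\<bar> powr (p - 1) + K powr (p - 1)) * (w powr (r - 1) * \<zeta> ^ m)
        \<le> X * (\<eta> * s powr p + H * (K powr p * w powr p)) + X * (K powr p * w)"
      proof -
        have "K * (\<bar>\<xi>\<bar> powr (p - 1) + K powr (p - 1)) * (w powr (r - 1) * \<zeta> ^ m)
          = X * (s powr (p - 1) * (K * w)) + X * (K powr p * w)"
          unfolding X1 Kp[symmetric] s_def by (simp add: algebra_simps)
        also have "s powr (p - 1) * (K * w) \<le> \<eta> * s powr p + H * (K powr p * w powr p)"
          using powr_young[OF p(1) s _ \<eta>, of "K * w"] K w0 by (simp add: H_def powr_mult)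
        finally show ?thesis using X by (simp add: mult_left_mono)
      qed
      have "?lhs \<le> (r - 1) * (X * (K powr p - C\<^sub>o * s powr p))
        + m * (X * (C\<^sub>1 * (\<eta> * s powr p + H * y powr p) + (K powr p + y powr p)))
        + (X * (\<eta> * s powr p + H * (K powr p * w powr p)) + X * (K powr p * w))"
        using j1 j2 j3 by (simp add: distrib_left)
      also have "\<dots> = (X * s powr p) * ((m * C\<^sub>1 + 1) * \<eta> - (r - 1) * C\<^sub>o)
        + ((r - 1) * (X * K powr p) + m * C\<^sub>1 * H * (X * y powr p) + m * (X * K powr p) + m * (X * y powr p)
        + H * (X * (K powr p * w powr p)) + X * (K powr p * w))"
        by (simp add: algebra_simps)
      also have "\<dots> = (r - 1) * (X * K powr p) + m * C\<^sub>1 * H * (X * y powr p) + m * (X * K powr p) + m * (X * y powr p)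
        + H * (X * (K powr p * w powr p)) + X * (K powr p * w)" by (simp add: abs\<eta>)
      finally have "t * ?lhs \<le> t * ((r - 1) * (X * K powr p) + m * C\<^sub>1 * H * (X * y powr p) + m * (X * K powr p) + m * (X * y powr p)
        + H * (X * (K powr p * w powr p)) + X * (K powr p * w))"
        using t by (intro mult_left_mono) auto
      also have "\<dots> = (r - 1) * (t * (X * K powr p)) + m * C\<^sub>1 * H * (t * (X * y powr p)) + m * (t * (X * K powr p))
        + m * (t * (X * y powr p)) + H * (t * (X * (K powr p * w powr p))) + t * (X * (K powr p * w))"
        by (simp add: algebra_simps)
      also have "\<dots> \<le> (r - 1) * ?F + m * C\<^sub>1 * H * (L * ?F) + m * ?F + m * (L * ?F) + H * ?F + ?F"
        using r C1 H by (intro add_mono mult_left_mono F1 F2 F3 F4) auto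
      also have "\<dots> = \<Gamma> * ?F" by (simp add: \<Gamma>_def algebra_simps)
      finally show ?thesis using t by (simp add: field_simps)
    qed
  qed
qed

subsection \<open>Time-independent test functions\<close>

lemma LlocI:
  assumes f: "f \<in> borel_measurable borel" and h: "integrable lborel h" "\<And>x. x \<in> S \<Longrightarrow> \<bar>f x\<bar> powr q \<le> h x"
  shows "Lloc q S f"
  unfolding Lloc_def
proof (intro allI impI conjI; elim conjE)
  fix K assume K: "compact K" "K \<subseteq> S"
  have m: "f \<in> borel_measurable lebesgue" using f by (simp add: measurable_completion)
  then show fm: "f \<in> borel_measurable (lebesgue_on K)" by (rule measurable_restrict_space1)
  have "integrable lebesgue h" using h(1) borel_measurable_integrable[OF h(1)] by (simp add: integrable_completion)
  then have "integrable (lebesgue_on K) h"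
    using integrable_mult_indicator[OF compact_lebesgue[OF K(1)], of h]
    by (simp add: integrable_restrict_space compact_lebesgue K)
  then show "integrable (lebesgue_on K) (\<lambda>x. \<bar>f x\<bar> powr q)"
  proof (rule Bochner_Integration.integrable_bound)
    have "norm (\<bar>f x\<bar> powr q) \<le> norm (h x)" if "x \<in> K" for x
    proof -
      have "0 \<le> \<bar>f x\<bar> powr q" by simp
      with h(2)[of x] that K(2) show ?thesis by auto
    qed
    then show "AE x in lebesgue_on K. norm (\<bar>f x\<bar> powr q) \<le> norm (h x)" by (intro AE_I2) simp
  qed (use fm in measurable)
qed

lemma borel_Times_Icc:
  fixes \<Omega> :: "'a::euclidean_space set" and I :: "real set"
  assumes "\<Omega> \<in> sets borel" "I \<in> sets borel"
  shows "\<Omega> \<times> I \<in> sets borel"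
proof -
  have "\<Omega> \<times> I = (fst -` \<Omega> \<inter> space borel) \<inter> (snd -` I \<inter> space borel)" by auto
  then show ?thesis using measurable_sets[OF borel_measurable_fst_snd(1) assms(1)] measurable_sets[OF borel_measurable_fst_snd(2) assms(2)]
    by (metis sets.Int)
qed

text \<open>By Fubini's theorem: for each fixed x the time derivative of the compactly supported
  test function integrates to zero along the time line.\<close>

lemma weak_deriv_time_0:
  fixes \<psi> :: "real^'n::finite \<Rightarrow> real"
  assumes \<psi>: "integrable lborel \<psi>" and \<Omega>: "open \<Omega>"
  shows "weak_deriv (\<Omega> \<times> {0<..<T::real}) (0, 1) (\<lambda>z. \<psi> (fst z)) (\<lambda>_. 0)"
  unfolding weak_deriv_def
proof (intro conjI allI impI)
  let ?S = "\<Omega> \<times> {0<..<T}"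
  have m [measurable]: "\<psi> \<in> borel_measurable borel" using \<psi> by simp
  have "integrable lborel (indicator {0..max 0 T} :: real \<Rightarrow> real)" by (rule integrable_real_indicator) auto
  from integrable_lborel_product[OF integrable_abs[OF \<psi>] this]
  show "Lloc 1 ?S (\<lambda>z. \<psi> (fst z))" by (rule LlocI[rotated]) (auto simp: indicator_def)
  show "Lloc 1 ?S (\<lambda>_. 0)" by (rule LlocI[where h="\<lambda>_. 0"]) auto
  fix \<phi> assume "C1c ?S \<phi>"
  then obtain \<phi>' where \<phi>': "has_C1_deriv \<phi> \<phi>'" and K: "compact (closure {x. \<phi> x \<noteq> 0})" "closure {x. \<phi> x \<noteq> 0} \<subseteq> ?S"
    by (auto simp: C1c_iff)
  let ?K = "closure {x. \<phi> x \<noteq> 0}"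
  let ?v = "(0, 1) :: (real^'n) \<times> real"
  have z: "\<phi> x = 0" if "x \<notin> ?K" for x using that closure_subset[of "{x. \<phi> x \<noteq> 0}"] by auto
  have z': "\<phi>' x v = 0" if "x \<notin> ?K" for x v by (rule has_C1_deriv_zero[OF \<phi>' closed_closure z that])
  note [measurable] = has_C1_deriv_measurable[OF \<phi>']
  obtain B where B: "\<And>x. \<bar>\<phi>' x ?v\<bar> \<le> B" using has_C1_deriv_bounded(2)[OF \<phi>' K(1) z] by blast
  have S: "?S \<in> sets lebesgue" using \<Omega> borel_Times_Icc[of \<Omega> "{0<..<T}"] by simp
  have "borel_rep ?S (\<lambda>z. \<psi> (fst z) * \<phi>' z ?v) (\<lambda>z. \<psi> (fst z) * \<phi>' z ?v)"
  proof (rule borel_rep_self)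
    fix x assume "x \<notin> ?S"
    then have "x \<notin> ?K" using K(2) by blast
    then show "\<psi> (fst x) * \<phi>' x ?v = 0" by (simp add: z')
  qed simp
  then have "(\<integral>z. \<psi> (fst z) * \<phi>' z ?v \<partial>lebesgue_on ?S) = (\<integral>z. \<psi> (fst z) * \<phi>' z ?v \<partial>lborel)"
    by (rule borel_rep_integral(1)[OF S])
  also have "\<dots> = (\<integral>x. \<integral>s. \<psi> x * \<phi>' (x, s) ?v \<partial>lborel \<partial>lborel)"
  proof -
    \<comment> \<open>A function of x alone is not integrable over all times; a bounded time
      interval can be inserted because the derivative of \<phi> vanishes outside it.\<close>
    have ind: "integrable lborel (indicator {0..max 0 T} :: real \<Rightarrow> real)" by (rule integrable_real_indicator) auto
    have "integrable lborel (\<lambda>z::(real^'n)\<times>real. \<psi> (fst z) * indicator {0..max 0 T} (snd z) * \<phi>' z ?v)"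
      by (rule integrable_mult_bounded[OF integrable_lborel_product[OF \<psi> ind] _ B]) simp
    moreover have "\<psi> (fst z) * indicator {0..max 0 T} (snd z) * \<phi>' z ?v = \<psi> (fst z) * \<phi>' z ?v" for z
      using z'[of z ?v] K(2) by (cases "z \<in> ?K") (auto simp: indicator_def)
    ultimately have "integrable lborel (\<lambda>z. \<psi> (fst z) * \<phi>' z ?v)" by simp
    from integral_lborel_fst_snd(4)[OF this] show ?thesis by simp
  qed
  also have "\<dots> = 0"
  proof -
    have "(\<integral>s. \<phi>' (x, s) ?v \<partial>lborel) = 0" for x
    proof -
      have "has_C1_deriv (\<lambda>s. \<phi> (x, s)) (\<lambda>s h. \<phi>' (x, s) (0, h))"
        unfolding has_C1_deriv_def
      proof (intro conjI allI)
        fix s :: real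
        have "(\<phi> has_derivative \<phi>' (x, s)) (at (x, s))" using \<phi>' by (simp add: has_C1_deriv_def)
        moreover have "((\<lambda>s. (x, s)) has_derivative (\<lambda>h. (0, h))) (at s)"
          by (intro has_derivative_Pair has_derivative_const has_derivative_ident)
        ultimately show "((\<lambda>s. \<phi> (x, s)) has_derivative (\<lambda>h. \<phi>' (x, s) (0, h))) (at s)"
          by (rule has_derivative_compose[rotated])
      next
        fix v :: real
        have "continuous_on UNIV (\<lambda>z. \<phi>' z (0, v))" using \<phi>' by (simp add: has_C1_deriv_def)
        then show "continuous_on UNIV (\<lambda>s. \<phi>' (x, s) (0, v))"
          by (rule continuous_on_compose2) (auto intro!: continuous_on_Pair continuous_on_const continuous_on_id)
      qed
      moreover have "compact (snd ` ?K)"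
        by (intro compact_continuous_image continuous_on_snd continuous_on_id K)
      moreover have "\<phi> (x, s) = 0" if "s \<notin> snd ` ?K" for s
        using that by (intro z) force
      ultimately show ?thesis by (rule integral_deriv_eq_0)
    qed
    then show ?thesis by simp
  qed
  finally show "(\<integral>z. \<psi> (fst z) * frechet_derivative \<phi> (at z) ?v \<partial>lebesgue_on ?S) = - (\<integral>z. 0 * \<phi> z \<partial>lebesgue_on ?S)"
    unfolding has_C1_deriv_frechet[OF \<phi>'] by simp
qed

text \<open>A function of x alone is admissible with time derivative zero, so the term with
  \<open>u\<close> times that derivative drops out and the same weight appears at both end times.
  The coefficients enter only as functions \<open>a\<close> and \<open>f\<close> of the space-time
  point.\<close>

lemma weak_inequality_stationary_test:
  fixes \<Omega> :: "(real^'n::finite) set"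
  assumes \<Omega>: "open \<Omega>" and T: "T > 0"
    and H: "\<And>t\<^sub>1 t\<^sub>2 K \<phi> \<phi>\<^sub>t D\<phi>.
          0 \<le> t\<^sub>1 \<and> t\<^sub>1 \<le> t\<^sub>2 \<and> t\<^sub>2 \<le> T \<and> compact K \<and> K \<subseteq> \<Omega> \<and>
          W12_L2loc \<Omega> T \<phi> \<phi>\<^sub>t \<and> Lp_Wo \<Omega> T p \<phi> D\<phi> \<and>
          (AE z in lebesgue_on (\<Omega> \<times> {0..T}). \<phi> z \<ge> 0) \<and>
          (AE z in lebesgue_on (\<Omega> \<times> {0..T}). fst z \<notin> K \<longrightarrow> \<phi> z = 0) \<Longrightarrow>
          ((\<integral>x. u (x, t\<^sub>2) * \<phi> (x, t\<^sub>2) \<partial>lebesgue_on K)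
             - (\<integral>x. u (x, t\<^sub>1) * \<phi> (x, t\<^sub>1) \<partial>lebesgue_on K)
             + (\<integral>z. - u z * \<phi>\<^sub>t z + (\<Sum>i\<in>UNIV. a z $ i * D\<phi> z $ i) \<partial>lebesgue_on (K \<times> {t\<^sub>1..t\<^sub>2})))
          \<le> (\<integral>z. f z * \<phi> z \<partial>lebesgue_on (K \<times> {t\<^sub>1..t\<^sub>2}))"
    and K: "compact K" "K \<subseteq> \<Omega>" and W: "W11o \<Omega> \<psi> D\<psi>"
    and \<psi>: "\<psi> \<in> borel_measurable borel" "\<And>x. 0 \<le> \<psi> x" "\<And>x. \<psi> x \<le> B" "\<And>x. x \<notin> K \<Longrightarrow> \<psi> x = 0"
    and D\<psi>: "\<And>i. integrable lborel (\<lambda>x. D\<psi> x $ i)" "\<And>x. x \<notin> K \<Longrightarrow> D\<psi> x = 0"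
      "\<And>i. integrable lborel (\<lambda>x. \<bar>D\<psi> x $ i\<bar> powr p i)"
    and t: "0 \<le> t\<^sub>1" "t\<^sub>1 \<le> t\<^sub>2" "t\<^sub>2 \<le> T"
  shows "(\<integral>x. u (x, t\<^sub>2) * \<psi> x \<partial>lebesgue_on K) - (\<integral>x. u (x, t\<^sub>1) * \<psi> x \<partial>lebesgue_on K)
      + (\<integral>z. (\<Sum>i\<in>UNIV. a z $ i * D\<psi> (fst z) $ i) \<partial>lebesgue_on (K \<times> {t\<^sub>1..t\<^sub>2}))
    \<le> (\<integral>z. f z * \<psi> (fst z) \<partial>lebesgue_on (K \<times> {t\<^sub>1..t\<^sub>2}))"
proof -
  let ?I = "indicator {0..T} :: real \<Rightarrow> real"
  have iT: "integrable lborel ?I" by (rule integrable_real_indicator) (use T in auto)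
  note [measurable] = \<psi>(1)
  have [measurable]: "(\<lambda>x. D\<psi> x $ i) \<in> borel_measurable borel" for i
    using borel_measurable_integrable[OF D\<psi>(1)[of i]] by simp
  have KB: "integrable lborel (\<lambda>x. C * indicator K x)" for C :: real
    using K(1) emeasure_bounded_finite[OF compact_imp_bounded[OF K(1)]]
    by (intro integrable_mult_right integrable_real_indicator) (auto simp: borel_compact)
  have \<psi>i: "integrable lborel \<psi>"
  proof (rule Bochner_Integration.integrable_bound[OF KB[of B]])
    show "AE x in lborel. norm (\<psi> x) \<le> norm (B * indicator K x)"
    proof (rule AE_I2)
      fix x show "norm (\<psi> x) \<le> norm (B * indicator K x)"
        using \<psi>(2-4)[of x] by (cases "x \<in> K") auto
    qed
  qed simp
  have \<psi>2: "\<bar>\<psi> x\<bar> powr 2 \<le> B\<^sup>2 * indicator K x" for x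
    using \<psi>(2-4)[of x] by (cases "x \<in> K") (auto simp: intro!: power_mono)
  have \<Omega>T: "\<Omega> \<times> {0..T} \<in> sets lebesgue"
    using \<Omega> borel_Times_Icc[of \<Omega> "{0..T}"] by simp
  have prod: "integrable (lebesgue_on (\<Omega> \<times> {0..T})) (\<lambda>z. h (fst z))"
    if h: "integrable lborel h" "\<And>x. x \<notin> K \<Longrightarrow> h x = 0" for h :: "real^'n \<Rightarrow> real"
  proof -
    have "borel_rep (\<Omega> \<times> {0..T}) (\<lambda>z. h (fst z)) (\<lambda>z. h (fst z) * ?I (snd z))"
      unfolding borel_rep_def
    proof
      show "(\<lambda>z. h (fst z) * ?I (snd z)) \<in> borel_measurable borel"
        using borel_measurable_integrable[OF integrable_lborel_product[OF h(1) iT]] by simp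
      show "AE z in lborel. h (fst z) * ?I (snd z) = (if z \<in> \<Omega> \<times> {0..T} then h (fst z) else 0)"
      proof (rule AE_I2)
        fix z :: "(real^'n) \<times> real"
        show "h (fst z) * ?I (snd z) = (if z \<in> \<Omega> \<times> {0..T} then h (fst z) else 0)"
          using h(2)[of "fst z"] K(2) by (cases z) (auto simp: indicator_def)
      qed
    qed
    from borel_rep_integral(2)[OF \<Omega>T this] show ?thesis
      using integrable_lborel_product[OF h(1) iT] by simp
  qed
  have W12: "W12_L2loc \<Omega> T (\<lambda>z. \<psi> (fst z)) (\<lambda>_. 0)"
    unfolding W12_L2loc_def C_L2loc_def
  proof (intro conjI ballI allI impI)
    show "Lloc 2 \<Omega> (\<lambda>x. \<psi> (fst (x, t)))" for t :: real
      using LlocI[OF \<psi>(1) KB[of "B\<^sup>2"] \<psi>2] by simp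
    show "((\<lambda>t. \<integral>x. (\<psi> (fst (x, t)) - \<psi> (fst (x, t\<^sub>0)))\<^sup>2 \<partial>lebesgue_on K') \<longlongrightarrow> 0) (at t\<^sub>0 within {0..T})" for K' and t\<^sub>0 :: real
      by simp
    show "Lloc 2 (\<Omega> \<times> {0..T}) (\<lambda>z. \<psi> (fst z))"
      by (rule LlocI[OF _ integrable_lborel_product[OF KB[of "B\<^sup>2"] iT]]) (use \<psi>2 in \<open>auto simp: indicator_def\<close>)
    show "Lloc 2 (\<Omega> \<times> {0..T}) (\<lambda>_. 0)" by (rule LlocI[where h="\<lambda>_. 0"]) auto
    show "weak_deriv (\<Omega> \<times> {0<..<T}) (0, 1) (\<lambda>z. \<psi> (fst z)) (\<lambda>_. 0)"
      by (rule weak_deriv_time_0[OF \<psi>i \<Omega>])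
  qed
  have Wo: "Lp_Wo \<Omega> T p (\<lambda>z. \<psi> (fst z)) (\<lambda>z. D\<psi> (fst z))"
    unfolding Lp_Wo_def
  proof (intro conjI allI)
    show "AE t in lebesgue_on {0..T}. W11o \<Omega> (\<lambda>x. \<psi> (fst (x, t))) (\<lambda>x. D\<psi> (fst (x, t)))"
      using W by simp
    show "integrable (lebesgue_on (\<Omega> \<times> {0..T})) (\<lambda>z. \<psi> (fst z))" by (rule prod[OF \<psi>i \<psi>(4)])
    show "integrable (lebesgue_on (\<Omega> \<times> {0..T})) (\<lambda>z. D\<psi> (fst z) $ i)" for i
      by (rule prod[OF D\<psi>(1)]) (simp add: D\<psi>(2))
    show "Lloc (p i) (\<Omega> \<times> {0..T}) (\<lambda>z. D\<psi> (fst z) $ i)" for i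
      by (rule LlocI[OF _ integrable_lborel_product[OF D\<psi>(3)[of i] iT]]) auto
  qed
  show ?thesis
    using H[of t\<^sub>1 t\<^sub>2 K "\<lambda>z. \<psi> (fst z)" "\<lambda>_. 0" "\<lambda>z. D\<psi> (fst z)"] t K W12 Wo \<psi>(2,4) by simp
qed

section \<open>Convexity of powers and time slices\<close>

text \<open>A convex graph lies above its tangent. The tangent is taken at t, the later value in the
  application, because that is the time at which the test function is frozen.\<close>

lemma powr_tangent_le:
  fixes s t r :: real
  assumes "s > 0" "t > 0" "r > 1"
  shows "t powr r / r - s powr r / r \<le> t powr (r - 1) * (t - s)"
proof -
  have "s powr r - t powr r \<ge> (r * t powr (r - 1)) * (s - t)"
  proof (rule convex_on_imp_above_tangent[where A="{0<..}"])
    show "convex_on {0<..} (\<lambda>x. x powr r)" using assms by (intro powr_convex) simp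
    have "((\<lambda>x. x powr r) has_real_derivative r * t powr (r - 1)) (at t)"
      using assms(2) by (rule has_real_derivative_powr)
    then show "((\<lambda>x. x powr r) has_real_derivative r * t powr (r - 1)) (at t within {0<..})"
      by (rule has_field_derivative_at_within)
    show "connected {0::real<..}" by (rule convex_connected) simp
    show "t \<in> interior {0<..}" "s \<in> {0<..}" using assms by (simp_all add: interior_open)
  qed
  then have "t powr r - s powr r \<le> r * (t powr (r - 1) * (t - s))" by (simp add: algebra_simps)
  then have "(t powr r - s powr r) / r \<le> t powr (r - 1) * (t - s)"
    using assms(3) by (simp add: divide_le_eq mult.commute)
  then show ?thesis by (simp add: diff_divide_distrib)
qed

text \<open>P is arbitrary, so its exceptional set is first enlarged to a Borel null set, for which
  almost all slices are null.\<close>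

lemma AE_lborel_slices:
  fixes P :: "'a::euclidean_space \<times> 'b::euclidean_space \<Rightarrow> bool"
  assumes "AE z in lborel. P z"
  shows "AE t in lborel. AE x in lborel. P (x, t)"
proof -
  obtain N where N: "N \<in> null_sets lborel" "{z. \<not> P z} \<subseteq> N"
    using assms by (auto elim!: AE_E simp: null_sets_def)
  have "AE z in lborel. z \<notin> N" by (rule AE_not_in[OF N(1)])
  then have "AE z in (lborel \<Otimes>\<^sub>M lborel :: ('a \<times> 'b) measure). (fst z, snd z) \<notin> N"
    unfolding lborel_prod prod.collapse .
  moreover have m: "{z \<in> space (lborel \<Otimes>\<^sub>M lborel :: ('a \<times> 'b) measure). (fst z, snd z) \<notin> N} \<in> sets (lborel \<Otimes>\<^sub>M lborel)"
  proof -
    have "N \<in> sets borel" using N(1) by auto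
    moreover have "{z \<in> space (lborel \<Otimes>\<^sub>M lborel :: ('a \<times> 'b) measure). (fst z, snd z) \<notin> N} = - N"
      by (auto simp: space_pair_measure)
    ultimately show ?thesis unfolding lborel_prod by simp
  qed
  ultimately have "AE t in lborel. AE x in lborel. (x, t) \<notin> N"
    using lborel_pair.AE_commute[OF m] lborel_pair.AE_pair_iff[OF m] by blast
  then show ?thesis
  proof eventually_elim
    case (elim t)
    then show ?case by eventually_elim (use N(2) in blast)
  qed
qed

lemma AE_real_interval_nonempty:
  fixes P :: "real \<Rightarrow> bool"
  assumes "AE t in lborel. P t" "a < b"
  shows "\<exists>t. a < t \<and> t < b \<and> P t"
proof (rule ccontr)
  assume "\<not> ?thesis"
  with assms(1) have "AE t in lborel. t \<notin> {a<..<b}" by (auto elim: eventually_mono)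
  then have "{a<..<b} \<in> null_sets lborel" using AE_iff_null_sets[of "{a<..<b}" lborel] by simp
  then have "emeasure lborel {a<..<b} = 0" by (rule null_setsD1)
  moreover have "emeasure lborel {a<..<b} = ennreal (b - a)" using assms(2) by (intro emeasure_lborel_Ioo) simp
  ultimately show False using assms(2) by (simp add: ennreal_eq_0_iff)
qed

text \<open>A bound valid almost everywhere in space-time passes to every single time slice, because the
  distance to the interval \<open>[0, M]\<close> is dominated by the distance to a nearby good slice.\<close>

lemma C_L2loc_slice_bounds:
  fixes \<Omega> :: "(real^'n::finite) set"
  assumes u: "C_L2loc \<Omega> T u" and T: "T > 0" and K: "compact K" "K \<subseteq> \<Omega>"
    and b: "AE z in lebesgue_on (K \<times> {0..T}). 0 \<le> u z \<and> u z \<le> M" and s: "s \<in> {0..T}" and M: "M \<ge> 0"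
  shows "AE x in lebesgue_on K. 0 \<le> u (x, s) \<and> u (x, s) \<le> M"
proof -
  let ?KT = "K \<times> {0..T}"
  have Ks: "K \<in> sets lebesgue" using compact_lebesgue[OF K(1)] .
  have "AE z in lborel. z \<in> ?KT \<longrightarrow> 0 \<le> u z \<and> u z \<le> M"
    using b unfolding AE_lebesgue_on_iff[OF compact_lebesgue[OF compact_Times[OF K(1) compact_Icc]]] .
  from AE_lborel_slices[OF this]
  have good: "AE t in lborel. AE x in lborel. (x, t) \<in> ?KT \<longrightarrow> 0 \<le> u (x, t) \<and> u (x, t) \<le> M" .
  \<comment> \<open>The signed distance of y to [0, M]. Its modulus is at most the distance of y to
    any point of the interval, in particular to a value of \<open>u\<close> at a good time.\<close>
  define dd where "dd y = y - max 0 (min M y)" for y :: real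
  have L2: "u \<in> borel_measurable (lebesgue_on K)" "integrable (lebesgue_on K) (\<lambda>x. (u x)\<^sup>2)"
    if "Lloc 2 \<Omega> u" for u :: "real^'n \<Rightarrow> real"
    using that K by (auto simp: Lloc_def)
  have sl: "Lloc 2 \<Omega> (\<lambda>x. u (x, t))" if "t \<in> {0..T}" for t
    using u that by (auto simp: C_L2loc_def)
  have idiff: "integrable (lebesgue_on K) (\<lambda>x. (u (x, t) - u (x, t'))\<^sup>2)" if "t \<in> {0..T}" "t' \<in> {0..T}" for t t'
  proof (rule Bochner_Integration.integrable_bound)
    show "integrable (lebesgue_on K) (\<lambda>x. 2 * (u (x, t))\<^sup>2 + 2 * (u (x, t'))\<^sup>2)"
      using L2(2)[OF sl[OF that(1)]] L2(2)[OF sl[OF that(2)]] by simp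
    show "AE x in lebesgue_on K. norm ((u (x, t) - u (x, t'))\<^sup>2) \<le> norm (2 * (u (x, t))\<^sup>2 + 2 * (u (x, t'))\<^sup>2)"
    proof (rule AE_I2)
      fix x
      have "0 \<le> (u (x, t) + u (x, t'))\<^sup>2" by simp
      then have "(u (x, t) - u (x, t'))\<^sup>2 \<le> 2 * (u (x, t))\<^sup>2 + 2 * (u (x, t'))\<^sup>2"
        by (simp add: power2_eq_square algebra_simps)
      also have "\<dots> \<le> norm (2 * (u (x, t))\<^sup>2 + 2 * (u (x, t'))\<^sup>2)" unfolding real_norm_def by (rule abs_ge_self)
      finally show "norm ((u (x, t) - u (x, t'))\<^sup>2) \<le> norm (2 * (u (x, t))\<^sup>2 + 2 * (u (x, t'))\<^sup>2)"
        by simp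
    qed
  qed (use L2(1)[OF sl[OF that(1)]] L2(1)[OF sl[OF that(2)]] in simp)
  have dm: "(\<lambda>x. dd (u (x, s))) \<in> borel_measurable (lebesgue_on K)"
    unfolding dd_def using L2(1)[OF sl[OF s]] by simp
  have id: "integrable (lebesgue_on K) (\<lambda>x. (dd (u (x, s)))\<^sup>2)"
  proof (rule Bochner_Integration.integrable_bound[OF L2(2)[OF sl[OF s]]])
    have "\<bar>dd y\<bar> \<le> \<bar>y\<bar>" for y using M by (auto simp: dd_def)
    then have "(dd y)\<^sup>2 \<le> y\<^sup>2" for y using abs_le_square_iff by blast
    then show "AE x in lebesgue_on K. norm ((dd (u (x, s)))\<^sup>2) \<le> norm ((u (x, s))\<^sup>2)" by simp
  qed (use dm in simp)
  have "(\<integral>x. (dd (u (x, s)))\<^sup>2 \<partial>lebesgue_on K) \<le> e" if e: "e > 0" for e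
  proof -
    have "((\<lambda>t. \<integral>x. (u (x, t) - u (x, s))\<^sup>2 \<partial>lebesgue_on K) \<longlongrightarrow> 0) (at s within {0..T})"
      using u K s by (auto simp: C_L2loc_def)
    then have "\<forall>\<^sub>F t in at s within {0..T}. dist (\<integral>x. (u (x, t) - u (x, s))\<^sup>2 \<partial>lebesgue_on K) 0 < e"
      using e by (rule tendstoD)
    then obtain d where d: "d > 0" "\<And>t. t \<in> {0..T} \<Longrightarrow> t \<noteq> s \<Longrightarrow> dist t s < d \<Longrightarrow>
        dist (\<integral>x. (u (x, t) - u (x, s))\<^sup>2 \<partial>lebesgue_on K) 0 < e"
      unfolding eventually_at by blast
    obtain t where t: "t \<in> {0..T}" "t \<noteq> s" "dist t s < d"
      and tg: "AE x in lborel. (x, t) \<in> ?KT \<longrightarrow> 0 \<le> u (x, t) \<and> u (x, t) \<le> M"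
    \<comment> \<open>Good times have full measure, so one exists arbitrarily near s; it is sought
      on a side of s on which [0, T] extends.\<close>
    proof (cases "s < T")
      case True
      obtain t where "s < t" "t < min T (s + d)" "AE x in lborel. (x, t) \<in> ?KT \<longrightarrow> 0 \<le> u (x, t) \<and> u (x, t) \<le> M"
        using AE_real_interval_nonempty[OF good, of s "min T (s + d)"] True d(1) by auto
      then show ?thesis using s by (intro that[of t]) (auto simp: dist_real_def)
    next
      case False
      obtain t where "max 0 (s - d) < t" "t < s" "AE x in lborel. (x, t) \<in> ?KT \<longrightarrow> 0 \<le> u (x, t) \<and> u (x, t) \<le> M"
        using AE_real_interval_nonempty[OF good, of "max 0 (s - d)" s] False d(1) T s by auto
      then show ?thesis using s by (intro that[of t]) (auto simp: dist_real_def)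
    qed
    have "(\<integral>x. (dd (u (x, s)))\<^sup>2 \<partial>lebesgue_on K) \<le> (\<integral>x. (u (x, t) - u (x, s))\<^sup>2 \<partial>lebesgue_on K)"
    proof (rule integral_mono_AE[OF id idiff[OF t(1) s]])
      have "AE x in lebesgue_on K. 0 \<le> u (x, t) \<and> u (x, t) \<le> M"
        unfolding AE_lebesgue_on_iff[OF Ks] using tg by (rule eventually_mono) (use t in auto)
      then show "AE x in lebesgue_on K. (dd (u (x, s)))\<^sup>2 \<le> (u (x, t) - u (x, s))\<^sup>2"
      proof eventually_elim
        case (elim x)
        then have "\<bar>dd (u (x, s))\<bar> \<le> \<bar>u (x, t) - u (x, s)\<bar>" by (auto simp: dd_def)
        then show ?case by (rule abs_le_square_iff[THEN iffD1])
      qed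
    qed
    also have "\<dots> \<le> e" using d(2)[OF t] by simp
    finally show ?thesis .
  qed
  then have "(\<integral>x. (dd (u (x, s)))\<^sup>2 \<partial>lebesgue_on K) \<le> 0" by (rule field_le_epsilon[of _ 0, simplified])
  moreover have "(\<integral>x. (dd (u (x, s)))\<^sup>2 \<partial>lebesgue_on K) \<ge> 0" by simp
  ultimately have "AE x in lebesgue_on K. (dd (u (x, s)))\<^sup>2 = 0"
    using integral_nonneg_eq_0_iff_AE[OF id] by simp
  then show ?thesis
    by (rule eventually_mono) (use M in \<open>auto simp: dd_def max_def min_def split: if_splits\<close>)
qed

text \<open>On [0, M] the shifted power is Lipschitz with constant (M + \<nu>)^(r-1), by the tangent
  inequality in both directions. The bound v <= e + v^2 / e then turns continuity in L^2 into
  continuity of the integral over the set K of finite measure.\<close>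

lemma C_L2loc_powr_continuous:
  fixes \<Omega> :: "(real^'n::finite) set"
  assumes u: "C_L2loc \<Omega> T u" and K: "compact K" "K \<subseteq> \<Omega>"
    and b: "\<And>s. s \<in> {0..T} \<Longrightarrow> AE x in lebesgue_on K. 0 \<le> u (x, s) \<and> u (x, s) \<le> M"
    and z: "z \<in> borel_measurable borel" "\<And>x. \<bar>z x\<bar> \<le> Z" and \<nu>: "\<nu> > 0" and r: "r > 1"
  shows "s \<in> {0..T} \<Longrightarrow> integrable (lebesgue_on K) (\<lambda>x. (u (x, s) + \<nu>) powr r / r * z x)"
    and "continuous_on {0..T} (\<lambda>s. \<integral>x. (u (x, s) + \<nu>) powr r / r * z x \<partial>lebesgue_on K)"
proof -
  let ?f = "\<lambda>s x. (u (x, s) + \<nu>) powr r / r * z x"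
  have Z: "Z \<ge> 0" using z(2)[of 0] by linarith
  have zm [measurable]: "z \<in> borel_measurable (lebesgue_on K)"
    using z(1) by (intro measurable_restrict_space1) (simp add: measurable_completion)
  have um: "(\<lambda>x. u (x, s)) \<in> borel_measurable (lebesgue_on K)" "integrable (lebesgue_on K) (\<lambda>x. (u (x, s))\<^sup>2)"
    if "s \<in> {0..T}" for s
    using u K that by (auto simp: C_L2loc_def Lloc_def)
  interpret K: finite_measure "lebesgue_on K"
    by (rule finite_measure_lebesgue_on) (rule lmeasurable_compact[OF K(1)])
  show int: "integrable (lebesgue_on K) (?f s)" if s: "s \<in> {0..T}" for s
  proof (rule K.integrable_const_bound[of _ "(M + \<nu>) powr r / r * Z"])
    show "AE x in lebesgue_on K. norm (?f s x) \<le> (M + \<nu>) powr r / r * Z"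
      using b[OF s]
    proof eventually_elim
      case (elim x)
      have "(u (x, s) + \<nu>) powr r / r \<le> (M + \<nu>) powr r / r"
        using elim \<nu> r by (intro divide_right_mono powr_mono2) auto
      then show ?case unfolding real_norm_def abs_mult using z(2)[of x] Z r by (intro mult_mono) auto
    qed
  qed (use um[OF s] in simp)
  define L where "L = (M + \<nu>) powr (r - 1) * Z"
  have L: "L \<ge> 0" using Z by (simp add: L_def)
  have lip: "\<bar>?f s x - ?f t x\<bar> \<le> L * \<bar>u (x, s) - u (x, t)\<bar>"
    if "0 \<le> u (x, s) \<and> u (x, s) \<le> M" "0 \<le> u (x, t) \<and> u (x, t) \<le> M" for s t x
  proof -
    have *: "(y + \<nu>) powr r / r - (y' + \<nu>) powr r / r \<le> (M + \<nu>) powr (r - 1) * \<bar>y - y'\<bar>"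
      if y: "0 \<le> y" "y \<le> M" "0 \<le> y'" for y y'
    proof -
      have "(y + \<nu>) powr r / r - (y' + \<nu>) powr r / r \<le> (y + \<nu>) powr (r - 1) * (y - y')"
        using powr_tangent_le[of "y' + \<nu>" "y + \<nu>" r] y \<nu> r by simp
      also have "\<dots> \<le> (y + \<nu>) powr (r - 1) * \<bar>y - y'\<bar>" by (intro mult_left_mono) auto
      also have "\<dots> \<le> (M + \<nu>) powr (r - 1) * \<bar>y - y'\<bar>" using y \<nu> r by (intro mult_right_mono powr_mono2) auto
      finally show ?thesis .
    qed
    have "\<bar>(u (x, s) + \<nu>) powr r / r - (u (x, t) + \<nu>) powr r / r\<bar> \<le> (M + \<nu>) powr (r - 1) * \<bar>u (x, s) - u (x, t)\<bar>"
      using *[of "u (x, s)" "u (x, t)"] *[of "u (x, t)" "u (x, s)"] that by (auto simp: abs_le_iff abs_minus_commute)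
    then have "\<bar>(u (x, s) + \<nu>) powr r / r - (u (x, t) + \<nu>) powr r / r\<bar> * \<bar>z x\<bar>
        \<le> (M + \<nu>) powr (r - 1) * \<bar>u (x, s) - u (x, t)\<bar> * Z"
      using z(2)[of x] by (intro mult_mono) auto
    moreover have "?f s x - ?f t x = ((u (x, s) + \<nu>) powr r / r - (u (x, t) + \<nu>) powr r / r) * z x"
      by (simp only: left_diff_distrib)
    ultimately show ?thesis by (simp add: abs_mult L_def mult_ac)
  qed
  show "continuous_on {0..T} (\<lambda>s. integral\<^sup>L (lebesgue_on K) (?f s))"
    unfolding continuous_on_def
  proof
    fix t assume t: "t \<in> {0..T}"
    define \<mu> where "\<mu> = measure (lebesgue_on K) (space (lebesgue_on K))"
    have key: "\<bar>integral\<^sup>L (lebesgue_on K) (?f s) - integral\<^sup>L (lebesgue_on K) (?f t)\<bar>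
        \<le> L * (e * \<mu> + (\<integral>x. (u (x, s) - u (x, t))\<^sup>2 \<partial>lebesgue_on K) / e)" if s: "s \<in> {0..T}" and e: "e > 0" for s e
    proof -
      have is2: "integrable (lebesgue_on K) (\<lambda>x. (u (x, s) - u (x, t))\<^sup>2)"
      proof (rule K.integrable_const_bound[of _ "M\<^sup>2"])
        show "AE x in lebesgue_on K. norm ((u (x, s) - u (x, t))\<^sup>2) \<le> M\<^sup>2"
          using b[OF s] b[OF t]
        proof eventually_elim
          case (elim x)
          then have "\<bar>u (x, s) - u (x, t)\<bar> \<le> \<bar>M\<bar>" by auto
          then show ?case by (simp add: abs_le_square_iff)
        qed
      qed (use um(1)[OF s] um(1)[OF t] in simp)
      have "\<bar>integral\<^sup>L (lebesgue_on K) (?f s) - integral\<^sup>L (lebesgue_on K) (?f t)\<bar>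
        = \<bar>\<integral>x. ?f s x - ?f t x \<partial>lebesgue_on K\<bar>"
        using int[OF s] int[OF t] by simp
      also have "\<dots> \<le> (\<integral>x. L * (e + (u (x, s) - u (x, t))\<^sup>2 / e) \<partial>lebesgue_on K)"
      proof (rule integral_abs_bound[THEN order_trans], rule integral_mono_AE)
        show "AE x in lebesgue_on K. \<bar>?f s x - ?f t x\<bar> \<le> L * (e + (u (x, s) - u (x, t))\<^sup>2 / e)"
          using b[OF s] b[OF t]
        proof eventually_elim
          case (elim x)
          let ?v = "\<bar>u (x, s) - u (x, t)\<bar>"
          have "?v \<le> e + ?v\<^sup>2 / e"
          proof (cases "?v \<le> e")
            case True
            have "0 \<le> ?v\<^sup>2 / e" using e by simp
            with True show ?thesis by linarith
          next
            case False
            then have "?v * e \<le> ?v\<^sup>2" unfolding power2_eq_square by (intro mult_left_mono) auto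
            then have "?v \<le> ?v\<^sup>2 / e" using e by (simp add: pos_le_divide_eq)
            then show ?thesis using e by linarith
          qed
          then have "L * ?v \<le> L * (e + (u (x, s) - u (x, t))\<^sup>2 / e)" using L by (intro mult_left_mono) auto
          with lip[of x s t] elim show ?case by linarith
        qed
      qed (use int[OF s] int[OF t] is2 in auto)
      also have "\<dots> = L * (e * \<mu> + (\<integral>x. (u (x, s) - u (x, t))\<^sup>2 \<partial>lebesgue_on K) / e)"
        using is2 by (simp add: \<mu>_def mult.commute)
      finally show ?thesis .
    qed
    show "((\<lambda>s. integral\<^sup>L (lebesgue_on K) (?f s)) \<longlongrightarrow> integral\<^sup>L (lebesgue_on K) (?f t)) (at t within {0..T})"
    proof (rule tendstoI)
      fix e :: real assume e: "e > 0"
      define D where "D = (L + 1) * (\<mu> + 1)"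
      define e1 where "e1 = e / (2 * D)"
      have \<mu>: "\<mu> \<ge> 0" by (simp add: \<mu>_def)
      have D: "D > 0" unfolding D_def using L \<mu> by (intro mult_pos_pos) auto
      have e1: "e1 > 0" using e D by (simp add: e1_def)
      have e1': "L * (e1 * \<mu>) \<le> e / 2"
      proof -
        have "L * (e1 * \<mu>) \<le> (L + 1) * (e1 * (\<mu> + 1))" using L \<mu> e1 by (intro mult_mono) auto
        also have "\<dots> = e1 * D" by (simp add: D_def)
        also have "\<dots> = e / 2" using D by (simp add: e1_def)
        finally show ?thesis .
      qed
      have lim: "((\<lambda>s. \<integral>x. (u (x, s) - u (x, t))\<^sup>2 \<partial>lebesgue_on K) \<longlongrightarrow> 0) (at t within {0..T})"
        using u K t by (auto simp: C_L2loc_def)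
      have "((\<lambda>s. L * ((\<integral>x. (u (x, s) - u (x, t))\<^sup>2 \<partial>lebesgue_on K) / e1)) \<longlongrightarrow> L * (0 / e1)) (at t within {0..T})"
        using e1 by (intro tendsto_mult tendsto_divide tendsto_const lim) auto
      then have "\<forall>\<^sub>F s in at t within {0..T}. L * ((\<integral>x. (u (x, s) - u (x, t))\<^sup>2 \<partial>lebesgue_on K) / e1) < e / 2"
        using e by (intro order_tendstoD(2)) auto
      moreover have "\<forall>\<^sub>F s in at t within {0..T}. s \<in> {0..T}" by (simp add: eventually_at_filter)
      ultimately show "\<forall>\<^sub>F s in at t within {0..T}. dist (integral\<^sup>L (lebesgue_on K) (?f s)) (integral\<^sup>L (lebesgue_on K) (?f t)) < e"
      proof eventually_elim
        case (elim s)
        then show ?case using key[OF elim(2) e1] e1' unfolding dist_real_def distrib_left by linarith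
      qed
    qed
  qed
qed

section \<open>Representatives of composed coefficients\<close>

lemma powr_add_le:
  fixes a b p :: real
  assumes "a \<ge> 0" "b \<ge> 0" "p \<ge> 0"
  shows "(a + b) powr p \<le> 2 powr p * (a powr p + b powr p)"
proof -
  have "(a + b) powr p \<le> (2 * max a b) powr p" using assms by (intro powr_mono2) auto
  also have "\<dots> = 2 powr p * max a b powr p" by (simp add: powr_mult)
  also have "\<dots> \<le> 2 powr p * (a powr p + b powr p)" by (intro mult_left_mono) (auto simp: max_def)
  finally show ?thesis .
qed

lemma borel_rep_AE_cong:
  assumes "borel_rep S f F" "AE x in lborel. x \<in> S \<longrightarrow> f x = g x"
  shows "borel_rep S g F"
proof -
  have "AE x in lborel. F x = (if x \<in> S then f x else 0)" using assms(1) by (simp add: borel_rep_def)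
  with assms(2) have "AE x in lborel. F x = (if x \<in> S then g x else 0)" by eventually_elim auto
  with assms(1) show ?thesis by (simp add: borel_rep_def)
qed

lemma borel_rep_AE_change:
  assumes "borel_rep S f F" "G \<in> borel_measurable borel" "AE x in lborel. F x = G x"
  shows "borel_rep S f G"
proof -
  have "AE x in lborel. F x = (if x \<in> S then f x else 0)" using assms(1) by (simp add: borel_rep_def)
  with assms(3) have "AE x in lborel. G x = (if x \<in> S then f x else 0)" by eventually_elim auto
  with assms(2) show ?thesis by (simp add: borel_rep_def)
qed

text \<open>Continuity in (s, \<xi>) holds only for almost every point, whereas
  \<open>caratheodory_measurable\<close> wants it everywhere. F is set to 0 on a Borel null set
  covering the exceptions, which a representative does not see. The inner product with v serves both
  the components of A and the scalar B.\<close>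

lemma caratheodory_borel_rep:
  fixes \<Omega> :: "(real^'n::finite) set" and F :: "(real^'n) \<times> real \<Rightarrow> real \<Rightarrow> real^'n \<Rightarrow> 'b::euclidean_space"
  assumes F: "caratheodory \<Omega> T F" and \<Omega>: "open \<Omega>" and Q: "compact Q" "Q \<subseteq> \<Omega> \<times> {0..T}"
    and u: "u \<in> borel_measurable (lebesgue_on Q)" and Du: "\<And>i. (\<lambda>w. Du w $ i) \<in> borel_measurable (lebesgue_on Q)"
  shows "\<exists>G. borel_rep Q (\<lambda>w. F w (u w) (Du w) \<bullet> v) G"
proof -
  let ?S = "\<Omega> \<times> {0..T}"
  have S: "?S \<in> sets lebesgue" using \<Omega> borel_Times_Icc[of \<Omega> "{0..T}"] by simp
  have Qs: "Q \<in> sets lebesgue" by (rule compact_lebesgue[OF Q(1)])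
  have "AE w in lborel. w \<in> ?S \<longrightarrow> continuous_on UNIV (\<lambda>(s, \<xi>). F w s \<xi>)"
    using F S by (simp add: caratheodory_def AE_lebesgue_on_iff)
  then obtain N where N: "N \<in> null_sets lborel" "{w. \<not> (w \<in> ?S \<longrightarrow> continuous_on UNIV (\<lambda>(s, \<xi>). F w s \<xi>))} \<subseteq> N"
    by (auto elim!: AE_E simp: null_sets_def)
  have Nb: "N \<in> sets borel" using N(1) by auto
  define F' where "F' w v = (if w \<in> N then 0 else F w (fst v) (snd v))" for w and v :: "real \<times> (real^'n)"
  have Dum: "Du \<in> borel_measurable (lebesgue_on Q)"
  proof (rule borel_measurable_euclidean_space[THEN iffD2], rule ballI)
    fix b :: "real^'n" assume "b \<in> Basis"
    then obtain i where "b = axis i 1" by (auto simp: Basis_vec_def)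
    then show "(\<lambda>w. Du w \<bullet> b) \<in> borel_measurable (lebesgue_on Q)" using Du[of i] by (simp add: inner_axis)
  qed
  have "(\<lambda>w. F' w (u w, Du w)) \<in> borel_measurable (lebesgue_on Q)"
  proof (rule caratheodory_measurable[where F=F' and f="\<lambda>w. (u w, Du w)"])
    fix v :: "real \<times> (real^'n)"
    have "(\<lambda>w. F w (fst v) (snd v)) \<in> borel_measurable (lebesgue_on ?S)"
      using F by (simp add: caratheodory_def)
    then have "(\<lambda>w. F w (fst v) (snd v)) \<in> borel_measurable (lebesgue_on Q)"
      by (rule measurable_restrict_mono[OF _ Q(2)])
    moreover have "Measurable.pred (lebesgue_on Q) (\<lambda>w. w \<in> N)"
    proof -
      have "{w \<in> Q. w \<in> N} = Q \<inter> N" by auto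
      moreover have "Q \<inter> N \<in> sets (lebesgue_on Q)"
        using Nb by (subst sets_restrict_space) (auto intro!: image_eqI[of _ _ N])
      ultimately show ?thesis by (simp add: pred_def)
    qed
    ultimately show "(\<lambda>w. F' w v) \<in> borel_measurable (lebesgue_on Q)"
      unfolding F'_def by measurable
  next
    fix w assume "w \<in> space (lebesgue_on Q)"
    then have w: "w \<in> ?S" using Q(2) by auto
    show "continuous_on UNIV (F' w)"
    proof (cases "w \<in> N")
      case True
      then have "F' w = (\<lambda>_. 0)" by (auto simp: F'_def)
      then show ?thesis by simp
    next
      case False
      then have "continuous_on UNIV (\<lambda>(s, \<xi>). F w s \<xi>)" using N(2) w by auto
      moreover have "F' w = (\<lambda>(s, \<xi>). F w s \<xi>)" using False by (auto simp: F'_def fun_eq_iff)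
      ultimately show ?thesis by simp
    qed
  next
    show "(\<lambda>w. (u w, Du w)) \<in> borel_measurable (lebesgue_on Q)"
      using u Dum by (simp add: borel_prod[symmetric])
  qed
  then have "(\<lambda>w. F' w (u w, Du w) \<bullet> v) \<in> borel_measurable (lebesgue_on Q)" by simp
  from borel_rep_ex[OF Qs this] obtain G where G: "borel_rep Q (\<lambda>w. F' w (u w, Du w) \<bullet> v) G" by blast
  have "borel_rep Q (\<lambda>w. F w (u w) (Du w) \<bullet> v) G"
    by (rule borel_rep_AE_cong[OF G], rule AE_mp[OF AE_not_in[OF N(1)]]) (simp add: F'_def)
  then show ?thesis by blast
qed

subsection \<open>The energy inequality\<close>

text \<open>Separates the measure theory from the exponents: \<open>point\<close> assumes the
  pointwise bound in abstract form with rate \<kappa> and offset c. z stands for the power of the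
  cutoff, K contains its support, and K1 leaves room around K for mollification. Of the solution
  only the subsolution half enters.\<close>

locale singular_energy =
  fixes \<Omega> :: "(real^'n::finite) set" and T C C\<^sub>o C\<^sub>1 r \<nu> M \<kappa> c :: real and p :: "'n \<Rightarrow> real"
    and A :: "(real^'n) \<times> real \<Rightarrow> real \<Rightarrow> real^'n \<Rightarrow> real^'n"
    and B :: "(real^'n) \<times> real \<Rightarrow> real \<Rightarrow> real^'n \<Rightarrow> real"
    and u :: "(real^'n) \<times> real \<Rightarrow> real" and Du :: "(real^'n) \<times> real \<Rightarrow> real^'n"
    and K1 K :: "(real^'n) set" and z :: "real^'n \<Rightarrow> real" and z' :: "real^'n \<Rightarrow> real^'n \<Rightarrow> real"
  assumes \<Omega>: "open \<Omega>" and T: "T > 0" and p: "\<And>i. 1 < p i" and C: "C \<ge> 0" and C1: "C\<^sub>1 > 0"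
    and A: "caratheodory \<Omega> T A" and B: "caratheodory \<Omega> T B"
    and str: "structure_conditions \<Omega> T p C\<^sub>o C\<^sub>1 C A B"
    and uC: "C_L2loc \<Omega> T u" and uW: "Lp_Wloc \<Omega> T p u Du"
    and weak: "\<And>t\<^sub>1 t\<^sub>2 K \<phi> \<phi>\<^sub>t D\<phi>.
          0 \<le> t\<^sub>1 \<and> t\<^sub>1 \<le> t\<^sub>2 \<and> t\<^sub>2 \<le> T \<and> compact K \<and> K \<subseteq> \<Omega> \<and>
          W12_L2loc \<Omega> T \<phi> \<phi>\<^sub>t \<and> Lp_Wo \<Omega> T p \<phi> D\<phi> \<and>
          (AE z in lebesgue_on (\<Omega> \<times> {0..T}). \<phi> z \<ge> 0) \<and>
          (AE z in lebesgue_on (\<Omega> \<times> {0..T}). fst z \<notin> K \<longrightarrow> \<phi> z = 0) \<Longrightarrow>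
          ((\<integral>x. u (x, t\<^sub>2) * \<phi> (x, t\<^sub>2) \<partial>lebesgue_on K)
             - (\<integral>x. u (x, t\<^sub>1) * \<phi> (x, t\<^sub>1) \<partial>lebesgue_on K)
             + (\<integral>z. - u z * \<phi>\<^sub>t z + (\<Sum>i\<in>UNIV. A z (u z) (Du z) $ i * D\<phi> z $ i) \<partial>lebesgue_on (K \<times> {t\<^sub>1..t\<^sub>2})))
          \<le> (\<integral>z. B z (u z) (Du z) * \<phi> z \<partial>lebesgue_on (K \<times> {t\<^sub>1..t\<^sub>2}))"
    and K1: "compact K1" "K1 \<subseteq> \<Omega>" and K: "compact K" "K \<subseteq> interior K1"
    and bnd: "AE w in lebesgue_on (K1 \<times> {0..T}). 0 \<le> u w \<and> u w \<le> M" and M: "M \<ge> 0"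
    and z: "has_C1_deriv z z'" "\<And>x. 0 \<le> z x" "\<And>x. x \<notin> K \<Longrightarrow> z x = 0"
    and \<nu>: "\<nu> > 0" and r: "r > 1" and \<kappa>: "\<kappa> \<ge> 0" and c: "c \<ge> 0"
    and point: "\<And>x s \<xi> a b. x \<in> K \<Longrightarrow> 0 \<le> s \<Longrightarrow> s \<le> M \<Longrightarrow>
      (\<And>i. a $ i * \<xi> $ i \<ge> C\<^sub>o * \<bar>\<xi> $ i\<bar> powr p i - C powr p i) \<Longrightarrow>
      (\<And>i. \<bar>a $ i\<bar> \<le> C\<^sub>1 * \<bar>\<xi> $ i\<bar> powr (p i - 1) + C powr (p i - 1)) \<Longrightarrow>
      \<bar>b\<bar> \<le> (\<Sum>i\<in>UNIV. C * (\<bar>\<xi> $ i\<bar> powr (p i - 1) + C powr (p i - 1))) \<Longrightarrow>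
      b * ((s + \<nu>) powr (r - 1) * z x) - (\<Sum>i\<in>UNIV. a $ i *
        ((r - 1) * (s + \<nu>) powr (r - 2) * \<xi> $ i * z x + (s + \<nu>) powr (r - 1) * z' x (axis i 1)))
      \<le> \<kappa> * ((s + \<nu>) powr r / r * z x + c)"
begin

definition Q :: "((real^'n) \<times> real) set" where "Q = K1 \<times> {0..T}"

lemma Q: "compact Q" "Q \<subseteq> \<Omega> \<times> {0..T}" "Q \<in> sets borel" "Q \<in> sets lebesgue"
proof -
  show 1: "compact Q" unfolding Q_def using K1 by (intro compact_Times) auto
  show "Q \<subseteq> \<Omega> \<times> {0..T}" using K1 by (auto simp: Q_def)
  show "Q \<in> sets borel" using 1 by (rule borel_compact)
  show "Q \<in> sets lebesgue" using 1 by (rule compact_lebesgue)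
qed

lemma K_sub: "K \<subseteq> K1" "K \<subseteq> \<Omega>" and K_borel [measurable]: "K \<in> sets borel"
  using K K1 interior_subset[of K1] by (auto intro: borel_compact)

text \<open>Chooses Borel representatives whose bounds hold everywhere rather than almost
  everywhere: U is clipped to [0, M] and the flux P to the growth bound. D is the common L^p
  majorant that \<open>product_translation\<close> asks for.\<close>

lemma ex_reps:
  "\<exists>U V P R D. borel_rep Q u U \<and> (\<forall>w. 0 \<le> U w \<and> U w \<le> M) \<and> (\<forall>i. borel_rep Q (\<lambda>w. Du w $ i) (V i)) \<and>
    (\<forall>i. borel_rep Q (\<lambda>w. A w (u w) (Du w) $ i) (P i)) \<and> borel_rep Q (\<lambda>w. B w (u w) (Du w)) R \<and>
    (\<forall>i w. 0 \<le> D i w \<and> \<bar>P i w\<bar> \<le> D i w powr (p i - 1)) \<and>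
    (\<forall>i. integrable lborel (\<lambda>w. D i w powr p i)) \<and> (\<forall>i. integrable lborel (\<lambda>w. \<bar>V i w\<bar> powr p i)) \<and>
    (\<forall>i. integrable lborel (P i)) \<and> integrable lborel R"
proof -
  have um: "u \<in> borel_measurable (lebesgue_on Q)" and Dum: "\<And>i. (\<lambda>w. Du w $ i) \<in> borel_measurable (lebesgue_on Q)"
    and Dui: "\<And>i. integrable (lebesgue_on Q) (\<lambda>w. \<bar>Du w $ i\<bar> powr p i)"
    using uW Q by (auto simp: Lp_Wloc_def Lloc_def)
  obtain U0 where U0: "borel_rep Q u U0" using borel_rep_ex[OF Q(4) um] by blast
  define U where "U w = max 0 (min M (U0 w))" for w
  have U: "borel_rep Q u U"
  proof (rule borel_rep_AE_change[OF U0])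
    have [measurable]: "U0 \<in> borel_measurable borel" using U0 by (simp add: borel_rep_def)
    show "U \<in> borel_measurable borel" unfolding U_def by measurable
    have "AE w in lborel. U0 w = (if w \<in> Q then u w else 0)" using U0 by (simp add: borel_rep_def)
    moreover have "AE w in lborel. w \<in> Q \<longrightarrow> 0 \<le> u w \<and> u w \<le> M"
      using bnd unfolding AE_lebesgue_on_iff[OF Q(4)[unfolded Q_def]] Q_def .
    ultimately show "AE w in lborel. U0 w = U w"
      by eventually_elim (use M in \<open>auto simp: U_def\<close>)
  qed
  have "\<forall>i. \<exists>V. borel_rep Q (\<lambda>w. Du w $ i) V" using borel_rep_ex[OF Q(4) Dum] by blast
  then obtain V where V: "\<And>i. borel_rep Q (\<lambda>w. Du w $ i) (V i)" by metis
  have Vm [measurable]: "V i \<in> borel_measurable borel" for i using V[of i] by (simp add: borel_rep_def)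
  have Veq: "AE w in lborel. V i w = (if w \<in> Q then Du w $ i else 0)" for i using V[of i] by (simp add: borel_rep_def)
  have "borel_rep Q (\<lambda>w. \<bar>Du w $ i\<bar> powr p i) (\<lambda>w. \<bar>V i w\<bar> powr p i)" for i
    unfolding borel_rep_def
  proof
    show "AE w in lborel. \<bar>V i w\<bar> powr p i = (if w \<in> Q then \<bar>Du w $ i\<bar> powr p i else 0)"
      using Veq[of i] by eventually_elim auto
  qed simp
  from borel_rep_integral(2)[OF Q(4) this] have Vi: "integrable lborel (\<lambda>w. \<bar>V i w\<bar> powr p i)" for i
    using Dui[of i] by simp
  have iQ: "integrable lborel (\<lambda>w. a * indicator Q w)" for a :: real
    using Q(3) emeasure_bounded_finite[OF compact_imp_bounded[OF Q(1)]]
    by (intro integrable_mult_right integrable_real_indicator) auto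
  note [measurable] = Q(3)
  have strQ: "AE w in lborel. w \<in> Q \<longrightarrow> (\<forall>i. \<bar>A w (u w) (Du w) $ i\<bar> \<le> C\<^sub>1 * \<bar>Du w $ i\<bar> powr (p i - 1) + C powr (p i - 1)) \<and>
     \<bar>B w (u w) (Du w)\<bar> \<le> (\<Sum>i\<in>UNIV. C * (\<bar>Du w $ i\<bar> powr (p i - 1) + C powr (p i - 1)))"
  proof -
    have "\<Omega> \<times> {0..T} \<in> sets lebesgue" using \<Omega> borel_Times_Icc[of \<Omega> "{0..T}"] by simp
    then have "AE w in lborel. w \<in> \<Omega> \<times> {0..T} \<longrightarrow> (\<forall>s \<xi>.
        (\<forall>i. A w s \<xi> $ i * \<xi> $ i \<ge> C\<^sub>o * \<bar>\<xi> $ i\<bar> powr p i - C powr p i) \<and>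
        (\<forall>i. \<bar>A w s \<xi> $ i\<bar> \<le> C\<^sub>1 * \<bar>\<xi> $ i\<bar> powr (p i - 1) + C powr (p i - 1)) \<and>
        \<bar>B w s \<xi>\<bar> \<le> (\<Sum>i\<in>UNIV. C * (\<bar>\<xi> $ i\<bar> powr (p i - 1) + C powr (p i - 1))))"
      using str by (simp add: structure_conditions_def AE_lebesgue_on_iff)
    then show ?thesis by eventually_elim (use Q(2) in blast)
  qed
  \<comment> \<open>The factor makes D^(p-1) equal to (\<open>C\<^sub>1\<close> + 1)(|Du| + C)^(p-1)
    on Q, which dominates both terms of the growth condition for A.\<close>
  define D where "D i w = (C\<^sub>1 + 1) powr (1 / (p i - 1)) * (\<bar>V i w\<bar> + C) * indicator Q w" for i w
  have D0: "0 \<le> D i w" for i w using C by (simp add: D_def)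
  have Dm [measurable]: "D i \<in> borel_measurable borel" for i unfolding D_def by measurable
  have Dp: "D i w powr (p i - 1) = (C\<^sub>1 + 1) * (\<bar>V i w\<bar> + C) powr (p i - 1) * indicator Q w" for i w
    using p[of i] C C1 by (cases "w \<in> Q") (simp_all add: D_def powr_mult powr_powr)
  have Di: "integrable lborel (\<lambda>w. D i w powr p i)" for i
  proof (rule Bochner_Integration.integrable_bound)
    let ?a = "((C\<^sub>1 + 1) powr (1 / (p i - 1))) powr p i"
    show "integrable lborel (\<lambda>w. ?a * (2 powr p i * (\<bar>V i w\<bar> powr p i)) + (?a * (2 powr p i * C powr p i)) * indicator Q w)"
      using Vi[of i] iQ by simp
    show "AE w in lborel. norm (D i w powr p i)
      \<le> norm (?a * (2 powr p i * (\<bar>V i w\<bar> powr p i)) + (?a * (2 powr p i * C powr p i)) * indicator Q w)"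
    proof (rule AE_I2)
      fix w
      have "D i w powr p i \<le> ?a * (2 powr p i * (\<bar>V i w\<bar> powr p i)) + (?a * (2 powr p i * C powr p i)) * indicator Q w"
      proof (cases "w \<in> Q")
        case True
        have "D i w powr p i = ?a * (\<bar>V i w\<bar> + C) powr p i" using True C by (simp add: D_def powr_mult)
        also have "\<dots> \<le> ?a * (2 powr p i * (\<bar>V i w\<bar> powr p i + C powr p i))"
          using p[of i] C by (intro mult_left_mono powr_add_le) auto
        also have "\<dots> = ?a * (2 powr p i * (\<bar>V i w\<bar> powr p i)) + (?a * (2 powr p i * C powr p i)) * indicator Q w"
          using True by (simp add: algebra_simps)
        finally show ?thesis .
      qed (simp add: D_def)
      then show "norm (D i w powr p i)
        \<le> norm (?a * (2 powr p i * (\<bar>V i w\<bar> powr p i)) + (?a * (2 powr p i * C powr p i)) * indicator Q w)"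
        unfolding real_norm_def by (smt (verit) powr_ge_zero)
    qed
  qed simp
  have Dp1: "integrable lborel (\<lambda>w. D i w powr (p i - 1))" for i
  proof (rule Bochner_Integration.integrable_bound)
    show "integrable lborel (\<lambda>w. 1 * indicator Q w + D i w powr p i)"
      using iQ[of 1] Di[of i] by (intro Bochner_Integration.integrable_add)
    show "AE w in lborel. norm (D i w powr (p i - 1)) \<le> norm (1 * indicator Q w + D i w powr p i)"
    proof (rule AE_I2)
      fix w
      show "norm (D i w powr (p i - 1)) \<le> norm (1 * indicator Q w + D i w powr p i)"
      proof (cases "w \<in> Q")
        case True
        have "D i w powr (p i - 1) \<le> 1 + D i w powr p i"
        proof (cases "D i w \<le> 1")
          case True
          then have "D i w powr (p i - 1) \<le> 1" using D0[of i w] p[of i] powr_mono2[of "p i - 1" "D i w" 1] by simp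
          then show ?thesis using powr_ge_zero[of "D i w" "p i"] by linarith
        next
          case False
          then have "D i w powr (p i - 1) \<le> D i w powr p i" by (intro powr_mono) auto
          then show ?thesis by simp
        qed
        then show ?thesis using True by simp
      qed (simp add: D_def)
    qed
  qed simp
  have "\<forall>i. \<exists>G. borel_rep Q (\<lambda>w. A w (u w) (Du w) $ i) G"
    using caratheodory_borel_rep[OF A \<Omega> Q(1,2) um Dum, of "axis _ 1"] by (simp add: inner_axis)
  then obtain P0 where P0: "\<And>i. borel_rep Q (\<lambda>w. A w (u w) (Du w) $ i) (P0 i)" by metis
  have P0m [measurable]: "P0 i \<in> borel_measurable borel" for i using P0[of i] by (simp add: borel_rep_def)
  \<comment> \<open>Clipping changes P0 only on a null set, by the structure conditions, and makes
    the growth bound hold at every point.\<close>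
  define P where "P i w = max (- (D i w powr (p i - 1))) (min (D i w powr (p i - 1)) (P0 i w))" for i w
  have P: "borel_rep Q (\<lambda>w. A w (u w) (Du w) $ i) (P i)" for i
  proof (rule borel_rep_AE_change[OF P0])
    show "P i \<in> borel_measurable borel" unfolding P_def by measurable
    have "AE w in lborel. P0 i w = (if w \<in> Q then A w (u w) (Du w) $ i else 0)" using P0[of i] by (simp add: borel_rep_def)
    with strQ Veq[of i] show "AE w in lborel. P0 i w = P i w"
    proof eventually_elim
      case (elim w)
      show ?case
      proof (cases "w \<in> Q")
        case True
        have a: "\<bar>Du w $ i\<bar> powr (p i - 1) \<le> (\<bar>Du w $ i\<bar> + C) powr (p i - 1)" "C powr (p i - 1) \<le> (\<bar>Du w $ i\<bar> + C) powr (p i - 1)"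
          using C p[of i] by (auto intro!: powr_mono2)
        have "\<bar>P0 i w\<bar> \<le> C\<^sub>1 * \<bar>Du w $ i\<bar> powr (p i - 1) + C powr (p i - 1)" using elim True by auto
        also have "\<dots> \<le> C\<^sub>1 * (\<bar>Du w $ i\<bar> + C) powr (p i - 1) + (\<bar>Du w $ i\<bar> + C) powr (p i - 1)"
          using a C1 by (intro add_mono mult_left_mono) auto
        also have "\<dots> = D i w powr (p i - 1)" using elim True by (simp add: Dp algebra_simps)
        finally show ?thesis by (auto simp: P_def)
      next
        case False then show ?thesis using elim by (simp add: P_def D_def)
      qed
    qed
  qed
  have Pb: "\<bar>P i w\<bar> \<le> D i w powr (p i - 1)" for i w
  proof -
    have "\<bar>max (- y) (min y x)\<bar> \<le> y" if "0 \<le> y" for x y :: real using that by (auto simp: max_def min_def)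
    then show ?thesis unfolding P_def by simp
  qed
  have Pm [measurable]: "P i \<in> borel_measurable borel" for i using P[of i] by (simp add: borel_rep_def)
  have Pi: "integrable lborel (P i)" for i
    by (rule Bochner_Integration.integrable_bound[OF Dp1[of i]]) (use Pb in \<open>auto intro: order_trans\<close>)
  have "\<exists>G. borel_rep Q (\<lambda>w. B w (u w) (Du w)) G"
    using caratheodory_borel_rep[OF B \<Omega> Q(1,2) um Dum, of 1] by simp
  then obtain R where R: "borel_rep Q (\<lambda>w. B w (u w) (Du w)) R" by blast
  have Rm [measurable]: "R \<in> borel_measurable borel" using R by (simp add: borel_rep_def)
  have Ri: "integrable lborel R"
  proof (rule Bochner_Integration.integrable_bound)
    show "integrable lborel (\<lambda>w. \<Sum>i\<in>UNIV. 2 * C * D i w powr (p i - 1))"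
      using Dp1 by (intro Bochner_Integration.integrable_sum integrable_mult_right) auto
    have "AE w in lborel. R w = (if w \<in> Q then B w (u w) (Du w) else 0)" using R by (simp add: borel_rep_def)
    moreover have "AE w in lborel. \<forall>i. V i w = (if w \<in> Q then Du w $ i else 0)" using Veq by (simp add: AE_all_countable)
    ultimately show "AE w in lborel. norm (R w) \<le> norm (\<Sum>i\<in>UNIV. 2 * C * D i w powr (p i - 1))"
      using strQ
    proof eventually_elim
      case (elim w)
      have "\<bar>R w\<bar> \<le> (\<Sum>i\<in>UNIV. 2 * C * D i w powr (p i - 1))"
      proof (cases "w \<in> Q")
        case True
        have "\<bar>R w\<bar> \<le> (\<Sum>i\<in>UNIV. C * (\<bar>Du w $ i\<bar> powr (p i - 1) + C powr (p i - 1)))" using elim True by auto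
        also have "\<dots> \<le> (\<Sum>i\<in>UNIV. 2 * C * D i w powr (p i - 1))"
        proof (rule sum_mono)
          fix i
          have "\<bar>Du w $ i\<bar> powr (p i - 1) \<le> (\<bar>Du w $ i\<bar> + C) powr (p i - 1)" "C powr (p i - 1) \<le> (\<bar>Du w $ i\<bar> + C) powr (p i - 1)"
            using C p[of i] by (auto intro!: powr_mono2)
          moreover have "(\<bar>Du w $ i\<bar> + C) powr (p i - 1) \<le> D i w powr (p i - 1)"
            using elim True C1 by (simp add: Dp mult_le_cancel_right1)
          ultimately have "\<bar>Du w $ i\<bar> powr (p i - 1) + C powr (p i - 1) \<le> 2 * D i w powr (p i - 1)" by linarith
          from mult_left_mono[OF this C]
          show "C * (\<bar>Du w $ i\<bar> powr (p i - 1) + C powr (p i - 1)) \<le> 2 * C * D i w powr (p i - 1)" by simp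
        qed
        finally show ?thesis .
      next
        case False then show ?thesis using elim C by (simp add: sum_nonneg)
      qed
      then show ?case by simp
    qed
  qed simp
  have U0M: "0 \<le> U w" "U w \<le> M" for w using M by (auto simp: U_def)
  show ?thesis
    using U U0M V P R D0 Pb Di Vi Pi Ri by blast
qed

end

section \<open>Energy inequality for fixed representatives\<close>

lemma borel_rep_restrict:
  assumes "borel_rep S f F" "S' \<subseteq> S" "k \<in> borel_measurable borel" "\<And>w. w \<notin> S' \<Longrightarrow> k w = 0"
    "\<And>w. w \<in> S' \<Longrightarrow> h w = f w * k w"
  shows "borel_rep S' h (\<lambda>w. F w * k w)"
proof -
  have "AE x in lborel. F x = (if x \<in> S then f x else 0)" using assms(1) by (simp add: borel_rep_def)
  then have "AE x in lborel. F x * k x = (if x \<in> S' then h x else 0)"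
    by eventually_elim (use assms(2,4,5) in auto)
  moreover have "F \<in> borel_measurable borel" using assms(1) by (simp add: borel_rep_def)
  ultimately show ?thesis using assms(3) unfolding borel_rep_def by (simp add: borel_measurable_times)
qed

lemma borel_rep_sum:
  assumes "finite I" "\<And>i. i \<in> I \<Longrightarrow> borel_rep S (f i) (F i)"
  shows "borel_rep S (\<lambda>w. \<Sum>i\<in>I. f i w) (\<lambda>w. \<Sum>i\<in>I. F i w)"
proof -
  have "AE x in lborel. \<forall>i\<in>I. F i x = (if x \<in> S then f i x else 0)"
    using assms by (simp add: borel_rep_def AE_finite_all)
  then have "AE x in lborel. (\<Sum>i\<in>I. F i x) = (if x \<in> S then \<Sum>i\<in>I. f i x else 0)"
    by eventually_elim (auto intro!: sum.cong sum.neutral)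
  moreover have "F i \<in> borel_measurable borel" if "i \<in> I" for i using assms(2)[OF that] by (simp add: borel_rep_def)
  ultimately show ?thesis unfolding borel_rep_def by (simp add: borel_measurable_sum)
qed

text \<open>Holds one choice from \<open>ex_reps\<close> fixed, so that the test function, its
  gradient and the integrand can be defined from it as jointly measurable functions.\<close>

locale singular_energy_rep = singular_energy \<Omega> T C C\<^sub>o C\<^sub>1 r \<nu> M \<kappa> c p A B u Du K1 K z z'
  for \<Omega> :: "(real^'n::finite) set" and T C C\<^sub>o C\<^sub>1 r \<nu> M \<kappa> c and p :: "'n \<Rightarrow> real" and A B u Du K1 K z z' +
  fixes U R :: "(real^'n::finite) \<times> real \<Rightarrow> real" and V P D :: "'n \<Rightarrow> (real^'n) \<times> real \<Rightarrow> real"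
  assumes U: "borel_rep Q u U" "\<And>w. 0 \<le> U w" "\<And>w. U w \<le> M"
    and V: "\<And>i. borel_rep Q (\<lambda>w. Du w $ i) (V i)"
    and P: "\<And>i. borel_rep Q (\<lambda>w. A w (u w) (Du w) $ i) (P i)"
    and R: "borel_rep Q (\<lambda>w. B w (u w) (Du w)) R"
    and D: "\<And>i w. 0 \<le> D i w" "\<And>i w. \<bar>P i w\<bar> \<le> D i w powr (p i - 1)" "\<And>i. integrable lborel (\<lambda>w. D i w powr p i)"
    and Vi: "\<And>i. integrable lborel (\<lambda>w. \<bar>V i w\<bar> powr p i)"
    and Pi: "\<And>i. integrable lborel (P i)" and Ri: "integrable lborel R"
begin

definition "g s = (s + \<nu>) powr (r - 1)"
definition "dg s = (r - 1) * (s + \<nu>) powr (r - 2)"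
definition "\<psi> w = g (U w) * z (fst w) * indicator {0..T} (snd w)"
definition "\<Psi> i w = (dg (U w) * V i w * z (fst w) + g (U w) * z' (fst w) (axis i 1)) * indicator {0..T} (snd w)"
text \<open>Two separate times: coefficients at s, test function and its gradient frozen at b. The
  sign is that of source minus flux, so integrals of W bound the growth of the energy, and on the
  diagonal s = b the assumption \<open>point\<close> applies.\<close>

definition "W x s b = R (x, s) * \<psi> (x, b) - (\<Sum>i\<in>UNIV. P i (x, s) * \<Psi> i (x, b))"
definition "Y s = (\<integral>x. (u (x, s) + \<nu>) powr r / r * z x \<partial>lebesgue_on K)"

lemma g_deriv: "0 \<le> s \<Longrightarrow> (g has_real_derivative dg s) (at s)"
  unfolding g_def dg_def using \<nu>
  by (auto intro!: derivative_eq_intros has_real_derivative_powr[THEN DERIV_chain2] simp: add_nonneg_pos diff_diff_eq)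

lemma dg_cont: "continuous_on {0..M} dg"
  unfolding dg_def using \<nu> by (intro continuous_intros) auto

lemma U_meas [measurable]: "U \<in> borel_measurable borel" using U(1) by (simp add: borel_rep_def)
lemma R_meas [measurable]: "R \<in> borel_measurable borel" using R by (simp add: borel_rep_def)
lemma V_meas [measurable]: "V i \<in> borel_measurable borel" using V[of i] by (simp add: borel_rep_def)
lemma P_meas [measurable]: "P i \<in> borel_measurable borel" using P[of i] by (simp add: borel_rep_def)
lemma z_meas [measurable]: "z \<in> borel_measurable borel" "(\<lambda>x. z' x v) \<in> borel_measurable borel"
  by (rule has_C1_deriv_measurable[OF z(1)])+

lemma g_meas [measurable]: "g \<in> borel_measurable borel" "dg \<in> borel_measurable borel"
  unfolding g_def[abs_def] dg_def[abs_def] by measurable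

lemma \<psi>_meas [measurable]: "\<psi> \<in> borel_measurable borel" "\<Psi> i \<in> borel_measurable borel"
  unfolding \<psi>_def[abs_def] \<Psi>_def[abs_def] by measurable

lemma z'_0: "x \<notin> K \<Longrightarrow> z' x v = 0"
  by (rule has_C1_deriv_zero[OF z(1) compact_imp_closed[OF K(1)] z(3)])

lemma z_bounds: "\<exists>Z\<ge>0. (\<forall>x. z x \<le> Z) \<and> (\<forall>x i. \<bar>z' x (axis i 1)\<bar> \<le> Z)"
proof -
  obtain Z0 where Z0: "\<And>x. \<bar>z x\<bar> \<le> Z0" using has_C1_deriv_bounded(1)[OF z(1) K(1) z(3)] by blast
  have "\<forall>i. \<exists>B. \<forall>x. \<bar>z' x (axis i 1)\<bar> \<le> B" using has_C1_deriv_bounded(2)[OF z(1) K(1) z(3)] by blast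
  then obtain Z' where Z': "\<And>i x. \<bar>z' x (axis i 1)\<bar> \<le> Z' i" by metis
  have nn: "0 \<le> Z' i" for i using Z'[of 0 i] by linarith
  have "0 \<le> Z0" using Z0[of 0] by linarith
  moreover have "Z' i \<le> (\<Sum>i\<in>UNIV. Z' i)" for i using nn by (intro member_le_sum) auto
  moreover have "0 \<le> (\<Sum>i\<in>UNIV. Z' i)" using nn by (intro sum_nonneg) auto
  ultimately show ?thesis
    using Z0 Z' by (intro exI[of _ "Z0 + (\<Sum>i\<in>UNIV. Z' i)"]) (auto simp: abs_le_iff intro: order_trans add_increasing add_increasing2, (smt (verit))+)
qed

lemma g_bounds: "0 \<le> s \<Longrightarrow> s \<le> M \<Longrightarrow> 0 \<le> g s \<and> g s \<le> (M + \<nu>) powr (r - 1)"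
  unfolding g_def using \<nu> r by (auto intro!: powr_mono2)

lemma dg_bounds: "\<exists>G\<ge>0. \<forall>s. 0 \<le> s \<longrightarrow> s \<le> M \<longrightarrow> \<bar>dg s\<bar> \<le> G"
proof -
  have "bounded (dg ` {0..M})" by (intro compact_imp_bounded compact_continuous_image dg_cont compact_Icc)
  then obtain G where "G > 0" "\<And>y. y \<in> dg ` {0..M} \<Longrightarrow> norm y \<le> G" by (auto simp: bounded_pos)
  then show ?thesis by (intro exI[of _ G]) auto
qed

lemma \<psi>_bounds: "\<exists>Z. \<forall>w. \<bar>\<psi> w\<bar> \<le> Z"
proof -
  obtain Z where Z: "Z \<ge> 0" "\<And>x. z x \<le> Z" using z_bounds by blast
  have "\<bar>\<psi> w\<bar> \<le> (M + \<nu>) powr (r - 1) * Z" for w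
  proof -
    have "\<bar>\<psi> w\<bar> \<le> g (U w) * z (fst w)"
      unfolding \<psi>_def using g_bounds[OF U(2,3)] z(2) by (auto simp: indicator_def)
    also have "\<dots> \<le> (M + \<nu>) powr (r - 1) * Z" using g_bounds[OF U(2,3), of w] Z z(2) by (intro mult_mono) auto
    finally show ?thesis .
  qed
  then show ?thesis by blast
qed

lemma integrable_K: "integrable lborel (\<lambda>x. a * indicator K x :: real)"
  using emeasure_bounded_finite[OF compact_imp_bounded[OF K(1)]]
  by (intro integrable_mult_right integrable_real_indicator) auto

lemma integrable_KT: "integrable lborel (\<lambda>w. a * (indicator K (fst w) * indicator {0..T} (snd w)) :: real)"
proof -
  have "integrable lborel (indicator {0..T} :: real \<Rightarrow> real)" using T by (intro integrable_real_indicator) auto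
  from integrable_lborel_product[OF integrable_K[of 1] this] show ?thesis by simp
qed

text \<open>The L^(p_i) bound serves twice: almost every time slice of \<Psi> becomes an admissible
  test gradient, and \<Psi> pairs with the flux in \<open>product_translation\<close>.\<close>

lemma \<Psi>_int: "integrable lborel (\<lambda>w. \<bar>\<Psi> i w\<bar> powr p i)" "integrable lborel (\<Psi> i)"
proof -
  obtain Z where Z: "Z \<ge> 0" "\<And>x. z x \<le> Z" "\<And>x i. \<bar>z' x (axis i 1)\<bar> \<le> Z" using z_bounds by blast
  obtain G where G: "G \<ge> 0" "\<And>s. 0 \<le> s \<Longrightarrow> s \<le> M \<Longrightarrow> \<bar>dg s\<bar> \<le> G" using dg_bounds by blast
  let ?I = "\<lambda>w::(real^'n) \<times> real. indicator K (fst w) * indicator {0..T} (snd w) :: real"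
  define b where "b = (M + \<nu>) powr (r - 1) * Z"
  have b: "b \<ge> 0" using Z by (simp add: b_def)
  have bd: "\<bar>\<Psi> i w\<bar> \<le> (G * Z * \<bar>V i w\<bar> + b) * ?I w" for w
  proof (cases "fst w \<in> K \<and> snd w \<in> {0..T}")
    case True
    have "\<bar>\<Psi> i w\<bar> \<le> \<bar>dg (U w) * V i w * z (fst w)\<bar> + \<bar>g (U w) * z' (fst w) (axis i 1)\<bar>"
      using True by (simp add: \<Psi>_def)
    also have "\<dots> \<le> G * \<bar>V i w\<bar> * Z + b"
      unfolding b_def abs_mult using G U(2,3)[of w] Z z(2) g_bounds[OF U(2,3), of w]
      by (intro add_mono mult_mono) auto
    finally show ?thesis using True by (simp add: mult_ac)
  next
    case False
    then show ?thesis by (auto simp: \<Psi>_def z(3) z'_0)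
  qed
  show 1: "integrable lborel (\<lambda>w. \<bar>\<Psi> i w\<bar> powr p i)"
  proof (rule Bochner_Integration.integrable_bound)
    show "integrable lborel (\<lambda>w. 2 powr p i * ((G * Z) powr p i * \<bar>V i w\<bar> powr p i) + (2 powr p i * b powr p i) * ?I w)"
      by (intro Bochner_Integration.integrable_add integrable_mult_right Vi integrable_KT)
    show "AE w in lborel. norm (\<bar>\<Psi> i w\<bar> powr p i)
        \<le> norm (2 powr p i * ((G * Z) powr p i * \<bar>V i w\<bar> powr p i) + (2 powr p i * b powr p i) * ?I w)"
    proof (rule AE_I2)
      fix w
      have "\<bar>\<Psi> i w\<bar> powr p i \<le> ((G * Z * \<bar>V i w\<bar> + b) * ?I w) powr p i"
        using bd[of w] p[of i] by (intro powr_mono2) auto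
      also have "\<dots> \<le> 2 powr p i * ((G * Z) powr p i * \<bar>V i w\<bar> powr p i) + (2 powr p i * b powr p i) * ?I w"
      proof (cases "fst w \<in> K \<and> snd w \<in> {0..T}")
        case True
        have "(G * Z * \<bar>V i w\<bar> + b) powr p i \<le> 2 powr p i * ((G * Z * \<bar>V i w\<bar>) powr p i + b powr p i)"
          using G Z b p[of i] by (intro powr_add_le) auto
        then show ?thesis using True by (simp add: powr_mult algebra_simps)
      next
        case False
        then have "?I w = 0" by auto
        then show ?thesis by (simp only: mult_zero_right powr_0 add_0_right) simp
      qed
      finally show "norm (\<bar>\<Psi> i w\<bar> powr p i)
        \<le> norm (2 powr p i * ((G * Z) powr p i * \<bar>V i w\<bar> powr p i) + (2 powr p i * b powr p i) * ?I w)"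
        unfolding real_norm_def by (smt (verit) powr_ge_zero)
    qed
  qed simp
  show "integrable lborel (\<Psi> i)"
  proof (rule Bochner_Integration.integrable_bound)
    show "integrable lborel (\<lambda>w. 1 * ?I w + \<bar>\<Psi> i w\<bar> powr p i)"
      by (intro Bochner_Integration.integrable_add 1 integrable_KT)
    show "AE w in lborel. norm (\<Psi> i w) \<le> norm (1 * ?I w + \<bar>\<Psi> i w\<bar> powr p i)"
    proof (rule AE_I2)
      fix w
      show "norm (\<Psi> i w) \<le> norm (1 * ?I w + \<bar>\<Psi> i w\<bar> powr p i)"
      proof (cases "fst w \<in> K \<and> snd w \<in> {0..T}")
        case True
        have "\<bar>\<Psi> i w\<bar> \<le> 1 + \<bar>\<Psi> i w\<bar> powr p i"
        proof (cases "\<bar>\<Psi> i w\<bar> \<le> 1")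
          case True
          then show ?thesis using powr_ge_zero[of "\<bar>\<Psi> i w\<bar>" "p i"] by linarith
        next
          case False
          then have "\<bar>\<Psi> i w\<bar> powr 1 \<le> \<bar>\<Psi> i w\<bar> powr p i" using p[of i] by (intro powr_mono) auto
          then show ?thesis using False by simp
        qed
        then show ?thesis using True by simp
      qed (use bd[of w] in auto)
    qed
  qed simp
qed

lemma u_slice_bounds:
  assumes "s \<in> {0..T}"
  shows "AE x in lebesgue_on K. 0 \<le> u (x, s) \<and> u (x, s) \<le> M"
proof -
  have "AE x in lborel. x \<in> K1 \<longrightarrow> 0 \<le> u (x, s) \<and> u (x, s) \<le> M"
    using C_L2loc_slice_bounds[OF uC T K1 bnd assms M] unfolding AE_lebesgue_on_iff[OF compact_lebesgue[OF K1(1)]] .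
  then show ?thesis
    unfolding AE_lebesgue_on_iff[OF compact_lebesgue[OF K(1)]] by eventually_elim (use K_sub in auto)
qed

lemma Y_cont: "continuous_on {0..T} Y"
  and Y_int: "s \<in> {0..T} \<Longrightarrow> integrable (lebesgue_on K) (\<lambda>x. (u (x, s) + \<nu>) powr r / r * z x)"
proof -
  obtain Z where Z: "Z \<ge> 0" "\<And>x. z x \<le> Z" using z_bounds by blast
  have "\<bar>z x\<bar> \<le> Z" for x using Z z(2)[of x] by simp
  from C_L2loc_powr_continuous[OF uC K(1) K_sub(2) u_slice_bounds z_meas(1) this \<nu> r]
  show "continuous_on {0..T} Y" "s \<in> {0..T} \<Longrightarrow> integrable (lebesgue_on K) (\<lambda>x. (u (x, s) + \<nu>) powr r / r * z x)"
    unfolding Y_def by auto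
qed

lemma Y_nonneg: "0 \<le> Y s"
  unfolding Y_def using z(2) r by (intro Bochner_Integration.integral_nonneg mult_nonneg_nonneg divide_nonneg_pos) auto

text \<open>The times at which the test function can be frozen. Almost all times are enough, because
  the freezing time b is integrated over in \<open>energy_average\<close>.\<close>

lemma good_slices:
  "AE b in lborel. b \<in> {0..T} \<longrightarrow> W11loc \<Omega> (\<lambda>x. u (x, b)) (\<lambda>x. Du (x, b)) \<and>
    borel_rep K1 (\<lambda>x. u (x, b)) (\<lambda>x. U (x, b)) \<and> (\<forall>i. borel_rep K1 (\<lambda>x. Du (x, b) $ i) (\<lambda>x. V i (x, b))) \<and>
    (\<forall>i. integrable lborel (\<lambda>x. \<bar>\<Psi> i (x, b)\<bar> powr p i)) \<and> (\<forall>i. integrable lborel (\<lambda>x. \<Psi> i (x, b)))"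
proof -
  have "AE b in lborel. b \<in> {0..T} \<longrightarrow> W11loc \<Omega> (\<lambda>x. u (x, b)) (\<lambda>x. Du (x, b))"
    using uW by (simp add: Lp_Wloc_def AE_lebesgue_on_iff)
  moreover have slice: "AE b in lborel. b \<in> {0..T} \<longrightarrow> borel_rep K1 (\<lambda>x. f (x, b)) (\<lambda>x. F (x, b))"
    if "borel_rep Q f F" for f F
  proof -
    have [measurable]: "F \<in> borel_measurable borel" using that by (simp add: borel_rep_def)
    have m: "(\<lambda>x. F (x, b)) \<in> borel_measurable borel" for b
      by (rule measurable_compose[of "\<lambda>x. (x, b)" borel borel F]) (auto intro!: borel_measurable_continuous_onI continuous_on_Pair continuous_on_id continuous_on_const)
    have "AE w in lborel. F w = (if w \<in> Q then f w else 0)" using that by (simp add: borel_rep_def)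
    from AE_lborel_slices[OF this] show ?thesis
    proof eventually_elim
      case (elim b)
      show ?case
      proof
        assume b: "b \<in> {0..T}"
        have "AE x in lborel. F (x, b) = (if x \<in> K1 then f (x, b) else 0)"
          using elim by eventually_elim (use b in \<open>simp add: Q_def\<close>)
        then show "borel_rep K1 (\<lambda>x. f (x, b)) (\<lambda>x. F (x, b))" using m by (simp add: borel_rep_def)
      qed
    qed
  qed
  note slice[OF U(1)]
  moreover have "AE b in lborel. \<forall>i. b \<in> {0..T} \<longrightarrow> borel_rep K1 (\<lambda>x. Du (x, b) $ i) (\<lambda>x. V i (x, b))"
    unfolding AE_all_countable using slice[OF V] by blast
  moreover have "AE b in lborel. \<forall>i. integrable lborel (\<lambda>x. \<bar>\<Psi> i (x, b)\<bar> powr p i)"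
    using integral_lborel_fst_snd(1)[OF \<Psi>_int(1)] by (simp add: AE_all_countable)
  moreover have "AE b in lborel. \<forall>i. integrable lborel (\<lambda>x. \<Psi> i (x, b))"
    using integral_lborel_fst_snd(1)[OF \<Psi>_int(2)] by (simp add: AE_all_countable)
  ultimately show ?thesis by eventually_elim blast
qed

lemma slice_meas: "f \<in> borel_measurable borel \<Longrightarrow> (\<lambda>x. f (x, b)) \<in> borel_measurable borel"
  for f :: "(real^'n) \<times> real \<Rightarrow> real"
  by (rule measurable_compose[of "\<lambda>x. (x, b)" borel borel f])
     (auto intro!: borel_measurable_continuous_onI continuous_on_Pair continuous_on_id continuous_on_const)

text \<open>Only b has to be a good time. The time a is arbitrary, since at a only the values of
  \<open>u\<close> enter, and these are bounded on every slice.\<close>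

lemma energy_step:
  assumes b: "b \<in> {0..T}" and W1: "W11loc \<Omega> (\<lambda>x. u (x, b)) (\<lambda>x. Du (x, b))"
    and Ub: "borel_rep K1 (\<lambda>x. u (x, b)) (\<lambda>x. U (x, b))"
    and Vb: "\<And>i. borel_rep K1 (\<lambda>x. Du (x, b) $ i) (\<lambda>x. V i (x, b))"
    and \<Psi>b: "\<And>i. integrable lborel (\<lambda>x. \<bar>\<Psi> i (x, b)\<bar> powr p i)" "\<And>i. integrable lborel (\<lambda>x. \<Psi> i (x, b))"
    and a: "a \<in> {0..b}"
  shows "Y b - Y a \<le> (\<integral>w. indicator {a..b} (snd w) * W (fst w) (snd w) b \<partial>lborel)"
proof -
  let ?S = "K \<times> {a..b}" and ?I = "indicator {a..b} :: real \<Rightarrow> real"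
  let ?D = "\<lambda>x. \<chi> i. dg (U (x, b)) * V i (x, b) * z x + g (U (x, b)) * z' x (axis i 1)"
  have ab: "0 \<le> a" "a \<le> b" "b \<le> T" "a \<in> {0..T}" using a b by auto
  have \<psi>b: "\<psi> (x, b) = g (U (x, b)) * z x" for x using b by (simp add: \<psi>_def)
  have Db: "?D x $ i = \<Psi> i (x, b)" for x i using b by (simp add: \<Psi>_def)
  have D_eq: "?D = (\<lambda>x. \<chi> i. \<Psi> i (x, b))" using Db by (simp add: fun_eq_iff vec_eq_iff)
  have \<Psi>0: "\<Psi> i (x, b) = 0" if "x \<notin> K" for i x using that by (simp add: \<Psi>_def z z'_0)
  have "W11o \<Omega> (\<lambda>x. g (U (x, b)) * z x) ?D"
    using W11o_chain[OF \<Omega> W1 K1 K Ub Vb U(2,3) z(1,3) g_deriv dg_cont] .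
  then have Wo: "W11o \<Omega> (\<lambda>x. \<psi> (x, b)) (\<lambda>x. \<chi> i. \<Psi> i (x, b))" unfolding \<psi>b D_eq .
  obtain Z where Z: "\<And>w. \<bar>\<psi> w\<bar> \<le> Z" using \<psi>_bounds by blast
  have \<psi>nn: "0 \<le> \<psi> (x, b)" for x using g_bounds[OF U(2,3), of "(x, b)"] z(2)[of x] by (simp add: \<psi>b)
  have \<psi>m: "(\<lambda>x. \<psi> (x, b)) \<in> borel_measurable borel" by (rule slice_meas) simp
  have \<Psi>m: "(\<lambda>x. \<Psi> i (x, b)) \<in> borel_measurable borel" for i by (rule slice_meas) simp
  have test: "(\<integral>x. u (x, b) * \<psi> (x, b) \<partial>lebesgue_on K) - (\<integral>x. u (x, a) * \<psi> (x, b) \<partial>lebesgue_on K)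
      + (\<integral>w. (\<Sum>i\<in>UNIV. A w (u w) (Du w) $ i * (\<chi> i. \<Psi> i (fst w, b)) $ i) \<partial>lebesgue_on ?S)
    \<le> (\<integral>w. B w (u w) (Du w) * \<psi> (fst w, b) \<partial>lebesgue_on ?S)"
  proof (rule weak_inequality_stationary_test[OF \<Omega> T weak K(1) K_sub(2) Wo \<psi>m \<psi>nn _ _ _ _ _ ab(1-3)])
    show "\<psi> (x, b) \<le> Z" for x using Z[of "(x, b)"] by simp
    show "\<psi> (x, b) = 0" if "x \<notin> K" for x using that by (simp add: \<psi>_def z)
    show "integrable lborel (\<lambda>x. (\<chi> i. \<Psi> i (x, b)) $ i)" for i using \<Psi>b(2) by simp
    show "(\<chi> i. \<Psi> i (x, b)) = 0" if "x \<notin> K" for x using \<Psi>0[OF that] by (simp add: vec_eq_iff)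
    show "integrable lborel (\<lambda>x. \<bar>(\<chi> i. \<Psi> i (x, b)) $ i\<bar> powr p i)" for i using \<Psi>b(1) by simp
  qed
  have SQ: "?S \<subseteq> Q" using K_sub ab by (auto simp: Q_def)
  have Ss: "?S \<in> sets lebesgue"
    using borel_Times_Icc[OF K_borel, of "{a..b}"] by simp
  have fm: "(\<lambda>w. f (fst w, b) * ?I (snd w)) \<in> borel_measurable borel"
    if "(\<lambda>x. f (x, b)) \<in> borel_measurable borel" for f :: "(real^'n) \<times> real \<Rightarrow> real"
    using measurable_compose[OF borel_measurable_fst_snd(1) that] by measurable
  have rB: "borel_rep ?S (\<lambda>w. B w (u w) (Du w) * \<psi> (fst w, b)) (\<lambda>w. R w * (\<psi> (fst w, b) * ?I (snd w)))"
  proof (rule borel_rep_restrict[OF R SQ fm[OF \<psi>m]])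
    fix w assume "w \<notin> ?S"
    then show "\<psi> (fst w, b) * ?I (snd w) = 0" by (cases w) (auto simp: \<psi>_def z indicator_def)
  qed auto
  have rA: "borel_rep ?S (\<lambda>w. A w (u w) (Du w) $ i * \<Psi> i (fst w, b)) (\<lambda>w. P i w * (\<Psi> i (fst w, b) * ?I (snd w)))" for i
  proof (rule borel_rep_restrict[OF P SQ fm[OF \<Psi>m]])
    fix w assume "w \<notin> ?S"
    then show "\<Psi> i (fst w, b) * ?I (snd w) = 0" using \<Psi>0[of "fst w" i] by (cases w) (auto simp: indicator_def)
  qed auto
  have iab: "integrable lborel ?I" using ab by (intro integrable_real_indicator) auto
  have iR: "integrable lborel (\<lambda>w. R w * (\<psi> (fst w, b) * ?I (snd w)))"
  proof (rule integrable_mult_bounded[OF Ri])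
    show "\<bar>\<psi> (fst w, b) * ?I (snd w)\<bar> \<le> Z" for w :: "(real^'n) \<times> real"
      using Z[of "(fst w, b)"] by (auto simp: indicator_def)
  qed (use fm[OF \<psi>m] in simp)
  have iP: "integrable lborel (\<lambda>w. P i w * (\<Psi> i (fst w, b) * ?I (snd w)))" for i
  proof (rule integrable_powr_product[OF p _ D(2,1,3)])
    have "\<bar>\<Psi> i (fst w, b) * ?I (snd w)\<bar> powr p i = \<bar>\<Psi> i (fst w, b)\<bar> powr p i * ?I (snd w)" for w :: "(real^'n) \<times> real"
      by (auto simp: indicator_def)
    then show "integrable lborel (\<lambda>w. \<bar>\<Psi> i (fst w, b) * ?I (snd w)\<bar> powr p i)"
      using integrable_lborel_product[OF \<Psi>b(1) iab] by simp
  qed (use fm[OF \<Psi>m] in simp_all)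
  have "(\<integral>w. B w (u w) (Du w) * \<psi> (fst w, b) \<partial>lebesgue_on ?S)
      - (\<integral>w. (\<Sum>i\<in>UNIV. A w (u w) (Du w) $ i * (\<chi> i. \<Psi> i (fst w, b)) $ i) \<partial>lebesgue_on ?S)
    = (\<integral>w. R w * (\<psi> (fst w, b) * ?I (snd w)) \<partial>lborel) - (\<integral>w. (\<Sum>i\<in>UNIV. P i w * (\<Psi> i (fst w, b) * ?I (snd w))) \<partial>lborel)"
    using borel_rep_integral(1)[OF Ss rB] borel_rep_integral(1)[OF Ss borel_rep_sum[OF finite rA]] by simp
  also have "\<dots> = (\<integral>w. R w * (\<psi> (fst w, b) * ?I (snd w)) - (\<Sum>i\<in>UNIV. P i w * (\<Psi> i (fst w, b) * ?I (snd w))) \<partial>lborel)"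
    by (intro Bochner_Integration.integral_diff[symmetric] iR Bochner_Integration.integrable_sum iP)
  also have "\<dots> = (\<integral>w. ?I (snd w) * W (fst w) (snd w) b \<partial>lborel)"
    by (intro Bochner_Integration.integral_cong) (auto simp: W_def indicator_def)
  finally have rhs: "(\<integral>x. u (x, b) * \<psi> (x, b) \<partial>lebesgue_on K) - (\<integral>x. u (x, a) * \<psi> (x, b) \<partial>lebesgue_on K)
     \<le> (\<integral>w. ?I (snd w) * W (fst w) (snd w) b \<partial>lborel)" using test by linarith
  interpret K: finite_measure "lebesgue_on K"
    by (rule finite_measure_lebesgue_on) (rule lmeasurable_compact[OF K(1)])
  have \<psi>mK: "(\<lambda>x. \<psi> (x, b)) \<in> borel_measurable (lebesgue_on K)"
    using \<psi>m by (intro measurable_restrict_space1) (simp add: measurable_completion)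
  have iu: "integrable (lebesgue_on K) (\<lambda>x. u (x, s) * \<psi> (x, b))" if s: "s \<in> {0..T}" for s
  proof (rule K.integrable_const_bound[of _ "M * Z"])
    show "AE x in lebesgue_on K. norm (u (x, s) * \<psi> (x, b)) \<le> M * Z"
      using u_slice_bounds[OF s]
    proof eventually_elim
      case (elim x)
      then show ?case unfolding real_norm_def abs_mult using Z[of "(x, b)"] M by (intro mult_mono) auto
    qed
    have "(\<lambda>x. u (x, s)) \<in> borel_measurable (lebesgue_on K)"
      using uC s K(1) K_sub(2) by (auto simp: C_L2loc_def Lloc_def)
    then show "(\<lambda>x. u (x, s) * \<psi> (x, b)) \<in> borel_measurable (lebesgue_on K)" using \<psi>mK by simp
  qed
  \<comment> \<open>Here convexity replaces the chain rule in time: the increment of the energy is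
    at most the increment of \<open>u\<close> times the test function frozen at the later
    time.\<close>
  have "Y b - Y a = (\<integral>x. (u (x, b) + \<nu>) powr r / r * z x - (u (x, a) + \<nu>) powr r / r * z x \<partial>lebesgue_on K)"
    unfolding Y_def using Y_int b ab by simp
  also have "\<dots> \<le> (\<integral>x. u (x, b) * \<psi> (x, b) - u (x, a) * \<psi> (x, b) \<partial>lebesgue_on K)"
  proof (rule integral_mono_AE)
    have "AE x in lborel. U (x, b) = (if x \<in> K1 then u (x, b) else 0)" using Ub by (simp add: borel_rep_def)
    then have "AE x in lebesgue_on K. U (x, b) = u (x, b)"
      unfolding AE_lebesgue_on_iff[OF compact_lebesgue[OF K(1)]] by eventually_elim (use K_sub in auto)
    then show "AE x in lebesgue_on K. (u (x, b) + \<nu>) powr r / r * z x - (u (x, a) + \<nu>) powr r / r * z x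
        \<le> u (x, b) * \<psi> (x, b) - u (x, a) * \<psi> (x, b)"
      using u_slice_bounds[OF b] u_slice_bounds[OF ab(4)]
    proof eventually_elim
      case (elim x)
      have "(u (x, b) + \<nu>) powr r / r - (u (x, a) + \<nu>) powr r / r \<le> (u (x, b) + \<nu>) powr (r - 1) * ((u (x, b) + \<nu>) - (u (x, a) + \<nu>))"
        using elim \<nu> r by (intro powr_tangent_le) auto
      from mult_right_mono[OF this z(2)[of x]] show ?case
        using elim by (simp add: \<psi>b g_def algebra_simps)
    qed
  qed (use Y_int[OF b] Y_int[OF ab(4)] iu[OF b] iu[OF ab(4)] in simp_all)
  also have "\<dots> = (\<integral>x. u (x, b) * \<psi> (x, b) \<partial>lebesgue_on K) - (\<integral>x. u (x, a) * \<psi> (x, b) \<partial>lebesgue_on K)"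
    using iu[OF b] iu[OF ab(4)] by simp
  finally show ?thesis using rhs by simp
qed

lemma W_meas: "(\<lambda>(x, s, b). W x s b) \<in> borel_measurable borel"
proof -
  have [measurable]: "(\<lambda>w::(real^'n) \<times> real \<times> real. (fst w, fst (snd w))) \<in> borel \<rightarrow>\<^sub>M borel"
    "(\<lambda>w::(real^'n) \<times> real \<times> real. (fst w, snd (snd w))) \<in> borel \<rightarrow>\<^sub>M borel"
    by (intro borel_measurable_continuous_onI continuous_on_Pair continuous_on_fst continuous_on_snd continuous_on_id)+
  have "(\<lambda>w::(real^'n) \<times> real \<times> real. R (fst w, fst (snd w)) * \<psi> (fst w, snd (snd w))
      - (\<Sum>i\<in>UNIV. P i (fst w, fst (snd w)) * \<Psi> i (fst w, snd (snd w)))) \<in> borel_measurable borel"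
    by measurable
  then show ?thesis by (simp add: W_def case_prod_unfold)
qed

lemma W_error:
  assumes e: "e > 0"
  shows "\<exists>h0>0. \<forall>d. \<bar>d\<bar> < h0 \<longrightarrow>
    (\<integral>\<^sup>+w. ennreal \<bar>W (fst w) (snd w + d) (snd w) - W (fst w) (snd w) (snd w)\<bar> \<partial>lborel) \<le> ennreal e"
proof -
  \<comment> \<open>One share of e for the source term and one for each of the N flux
    components.\<close>
  define e' where "e' = e / (real CARD('n) + 1)"
  have e': "e' > 0" using e by (simp add: e'_def add_nonneg_pos)
  obtain Z where Z: "\<And>w. \<bar>\<psi> w\<bar> \<le> Z" using \<psi>_bounds by blast
  obtain h1 where h1: "h1 > 0" "\<And>v. norm v < h1 \<Longrightarrow> (\<integral>\<^sup>+w. ennreal (\<bar>R (w + v) - R w\<bar> * \<bar>\<psi> w\<bar>) \<partial>lborel) \<le> ennreal e'"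
    using product_translation_bounded[OF Ri \<psi>_meas(1) Z e'] by blast
  have "\<exists>h>0. \<forall>v. norm v < h \<longrightarrow> (\<integral>\<^sup>+w. ennreal (\<bar>P i (w + v) - P i w\<bar> * \<bar>\<Psi> i w\<bar>) \<partial>lborel) \<le> ennreal e'" for i
    by (rule product_translation[OF p Pi D(2) D(1) D(3) _ \<Psi>_int(1) e']) simp
  then have "\<forall>i. \<exists>h. h > 0 \<and> (\<forall>v. norm v < h \<longrightarrow> (\<integral>\<^sup>+w. ennreal (\<bar>P i (w + v) - P i w\<bar> * \<bar>\<Psi> i w\<bar>) \<partial>lborel) \<le> ennreal e')"
    by simp
  from choice[OF this] obtain h where h: "\<And>i. h i > 0"
    "\<And>i v. norm v < h i \<Longrightarrow> (\<integral>\<^sup>+w. ennreal (\<bar>P i (w + v) - P i w\<bar> * \<bar>\<Psi> i w\<bar>) \<partial>lborel) \<le> ennreal e'" by auto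
  define h0 where "h0 = min h1 (Min (range h))"
  have h0: "h0 > 0" using h1(1) h(1) by (simp add: h0_def)
  have h0i: "h0 \<le> h i" for i unfolding h0_def by (intro min.coboundedI2 Min_le) auto
  have "(\<integral>\<^sup>+w. ennreal \<bar>W (fst w) (snd w + d) (snd w) - W (fst w) (snd w) (snd w)\<bar> \<partial>lborel) \<le> ennreal e"
    if d: "\<bar>d\<bar> < h0" for d
  proof -
    let ?v = "(0, d) :: (real^'n) \<times> real"
    have nv: "norm ?v < h0" using d by (simp add: norm_Pair)
    have pt: "\<bar>W (fst w) (snd w + d) (snd w) - W (fst w) (snd w) (snd w)\<bar>
      \<le> \<bar>R (w + ?v) - R w\<bar> * \<bar>\<psi> w\<bar> + (\<Sum>i\<in>UNIV. \<bar>P i (w + ?v) - P i w\<bar> * \<bar>\<Psi> i w\<bar>)" for w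
    proof -
      have "w + ?v = (fst w, snd w + d)" by (simp add: prod_eq_iff)
      then have "W (fst w) (snd w + d) (snd w) - W (fst w) (snd w) (snd w)
        = (R (w + ?v) - R w) * \<psi> w - (\<Sum>i\<in>UNIV. (P i (w + ?v) - P i w) * \<Psi> i w)"
        by (simp add: W_def left_diff_distrib sum_subtractf)
      then have "\<bar>W (fst w) (snd w + d) (snd w) - W (fst w) (snd w) (snd w)\<bar>
        \<le> \<bar>(R (w + ?v) - R w) * \<psi> w\<bar> + \<bar>\<Sum>i\<in>UNIV. (P i (w + ?v) - P i w) * \<Psi> i w\<bar>"
        by (simp only: abs_triangle_ineq4)
      moreover have "\<bar>\<Sum>i\<in>UNIV. (P i (w + ?v) - P i w) * \<Psi> i w\<bar> \<le> (\<Sum>i\<in>UNIV. \<bar>(P i (w + ?v) - P i w) * \<Psi> i w\<bar>)"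
        by (rule sum_abs)
      ultimately have "\<bar>W (fst w) (snd w + d) (snd w) - W (fst w) (snd w) (snd w)\<bar>
        \<le> \<bar>(R (w + ?v) - R w) * \<psi> w\<bar> + (\<Sum>i\<in>UNIV. \<bar>(P i (w + ?v) - P i w) * \<Psi> i w\<bar>)"
        by linarith
      then show ?thesis unfolding abs_mult .
    qed
    have "(\<integral>\<^sup>+w. ennreal \<bar>W (fst w) (snd w + d) (snd w) - W (fst w) (snd w) (snd w)\<bar> \<partial>lborel)
      \<le> (\<integral>\<^sup>+w. ennreal (\<bar>R (w + ?v) - R w\<bar> * \<bar>\<psi> w\<bar>) + (\<Sum>i\<in>UNIV. ennreal (\<bar>P i (w + ?v) - P i w\<bar> * \<bar>\<Psi> i w\<bar>)) \<partial>lborel)"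
    proof (rule nn_integral_mono)
      fix w :: "(real^'n) \<times> real"
      have "ennreal (\<bar>R (w + ?v) - R w\<bar> * \<bar>\<psi> w\<bar> + (\<Sum>i\<in>UNIV. \<bar>P i (w + ?v) - P i w\<bar> * \<bar>\<Psi> i w\<bar>))
        = ennreal (\<bar>R (w + ?v) - R w\<bar> * \<bar>\<psi> w\<bar>) + (\<Sum>i\<in>UNIV. ennreal (\<bar>P i (w + ?v) - P i w\<bar> * \<bar>\<Psi> i w\<bar>))"
        by (subst ennreal_plus) (auto intro!: sum_nonneg sum_ennreal[symmetric])
      with ennreal_leI[OF pt[of w]]
      show "ennreal \<bar>W (fst w) (snd w + d) (snd w) - W (fst w) (snd w) (snd w)\<bar>
        \<le> ennreal (\<bar>R (w + ?v) - R w\<bar> * \<bar>\<psi> w\<bar>) + (\<Sum>i\<in>UNIV. ennreal (\<bar>P i (w + ?v) - P i w\<bar> * \<bar>\<Psi> i w\<bar>))"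
        by (simp only:)
    qed
    also have "\<dots> = (\<integral>\<^sup>+w. ennreal (\<bar>R (w + ?v) - R w\<bar> * \<bar>\<psi> w\<bar>) \<partial>lborel)
        + (\<Sum>i\<in>UNIV. (\<integral>\<^sup>+w. ennreal (\<bar>P i (w + ?v) - P i w\<bar> * \<bar>\<Psi> i w\<bar>) \<partial>lborel))"
    proof -
      have m: "(\<lambda>w. ennreal (\<bar>P i (w + ?v) - P i w\<bar> * \<bar>\<Psi> i w\<bar>)) \<in> borel_measurable lborel" for i by measurable
      have m': "(\<lambda>w. ennreal (\<bar>R (w + ?v) - R w\<bar> * \<bar>\<psi> w\<bar>)) \<in> borel_measurable lborel" by measurable
      show ?thesis by (subst nn_integral_add[OF m' borel_measurable_sum[OF m]]) (simp only: nn_integral_sum[OF m])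
    qed
    also have "\<dots> \<le> ennreal e' + (\<Sum>i\<in>(UNIV::'n set). ennreal e')"
    proof (intro add_mono sum_mono)
      show "(\<integral>\<^sup>+w. ennreal (\<bar>R (w + ?v) - R w\<bar> * \<bar>\<psi> w\<bar>) \<partial>lborel) \<le> ennreal e'"
        using nv by (intro h1) (simp add: h0_def)
      show "(\<integral>\<^sup>+w. ennreal (\<bar>P i (w + ?v) - P i w\<bar> * \<bar>\<Psi> i w\<bar>) \<partial>lborel) \<le> ennreal e'" for i
        using less_le_trans[OF nv h0i[of i]] by (rule h)
    qed
    also have "\<dots> = ennreal e"
    proof -
      have "(real CARD('n) + 1) * e' = e" unfolding e'_def by (simp add: add_nonneg_eq_0_iff)
      moreover have "ennreal e' + (\<Sum>i\<in>(UNIV::'n set). ennreal e') = ennreal ((real CARD('n) + 1) * e')"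
        using e' by (simp add: distrib_right ennreal_mult ennreal_of_nat_eq_real_of_nat add.commute)
      ultimately show ?thesis by (simp only:)
    qed
    finally show ?thesis .
  qed
  with h0 show ?thesis by blast
qed

lemma W_slice_integrable: "AE b in lborel. integrable lborel (\<lambda>x. W x b b)"
proof -
  obtain Z where Z: "\<And>w. \<bar>\<psi> w\<bar> \<le> Z" using \<psi>_bounds by blast
  have "integrable lborel (\<lambda>w. R w * \<psi> w - (\<Sum>i\<in>UNIV. P i w * \<Psi> i w))"
    by (intro Bochner_Integration.integrable_diff Bochner_Integration.integrable_sum
        integrable_mult_bounded[OF Ri _ Z]
        integrable_powr_product[OF p _ D(2) D(1) D(3) _ \<Psi>_int(1)]) simp_all
  from integral_lborel_fst_snd(1)[OF this] show ?thesis by (simp add: W_def)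
qed

text \<open>On the diagonal, coefficients and test gradient involve the same values of
  \<open>u\<close> and \<open>Du\<close>, which is the situation of \<open>point\<close>. Outside K
  both sides reduce to cutoff terms that vanish.\<close>

lemma W_pointwise:
  "AE w in lborel. snd w \<in> {0..T} \<longrightarrow>
    W (fst w) (snd w) (snd w) \<le> \<kappa> * ((U w + \<nu>) powr r / r * z (fst w) + c * indicator K (fst w))"
proof -
  have "\<Omega> \<times> {0..T} \<in> sets lebesgue" using \<Omega> borel_Times_Icc[of \<Omega> "{0..T}"] by simp
  then have "AE w in lborel. w \<in> \<Omega> \<times> {0..T} \<longrightarrow> (\<forall>s \<xi>.
      (\<forall>i. A w s \<xi> $ i * \<xi> $ i \<ge> C\<^sub>o * \<bar>\<xi> $ i\<bar> powr p i - C powr p i) \<and>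
      (\<forall>i. \<bar>A w s \<xi> $ i\<bar> \<le> C\<^sub>1 * \<bar>\<xi> $ i\<bar> powr (p i - 1) + C powr (p i - 1)) \<and>
      \<bar>B w s \<xi>\<bar> \<le> (\<Sum>i\<in>UNIV. C * (\<bar>\<xi> $ i\<bar> powr (p i - 1) + C powr (p i - 1))))"
    using str by (simp add: structure_conditions_def AE_lebesgue_on_iff)
  moreover have "AE w in lborel. \<forall>i. V i w = (if w \<in> Q then Du w $ i else 0)"
    unfolding AE_all_countable using V by (simp add: borel_rep_def)
  moreover have "AE w in lborel. \<forall>i. P i w = (if w \<in> Q then A w (u w) (Du w) $ i else 0)"
    unfolding AE_all_countable using P by (simp add: borel_rep_def)
  moreover have "AE w in lborel. R w = (if w \<in> Q then B w (u w) (Du w) else 0)"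
    using R by (simp add: borel_rep_def)
  ultimately show ?thesis
  proof eventually_elim
    case (elim w)
    show ?case
    proof
      assume t: "snd w \<in> {0..T}"
      show "W (fst w) (snd w) (snd w) \<le> \<kappa> * ((U w + \<nu>) powr r / r * z (fst w) + c * indicator K (fst w))"
      proof (cases "fst w \<in> K")
        case True
        then have wQ: "w \<in> Q" "w \<in> \<Omega> \<times> {0..T}" using t K_sub by (auto simp: Q_def mem_Times_iff)
        let ?a = "A w (u w) (Du w)" and ?b = "B w (u w) (Du w)" and ?\<xi> = "Du w"
        have "W (fst w) (snd w) (snd w) = ?b * ((U w + \<nu>) powr (r - 1) * z (fst w)) - (\<Sum>i\<in>UNIV. ?a $ i *
          ((r - 1) * (U w + \<nu>) powr (r - 2) * ?\<xi> $ i * z (fst w) + (U w + \<nu>) powr (r - 1) * z' (fst w) (axis i 1)))"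
          using elim(2-4) wQ(1) t by (simp add: W_def \<psi>_def \<Psi>_def g_def dg_def)
        also have "\<dots> \<le> \<kappa> * ((U w + \<nu>) powr r / r * z (fst w) + c)"
          using elim(1) wQ(2) by (intro point True U(2,3)) blast+
        finally show ?thesis using True by simp
      next
        case False
        have "W (fst w) (snd w) (snd w) = 0" using False by (simp add: W_def \<psi>_def \<Psi>_def z z'_0)
        moreover have "0 \<le> \<kappa> * ((U w + \<nu>) powr r / r * z (fst w) + c * indicator K (fst w))"
          using \<kappa> r c z(2) by (intro mult_nonneg_nonneg add_nonneg_nonneg divide_nonneg_pos) auto
        ultimately show ?thesis by simp
      qed
    qed
  qed
qed

lemma W_slice_integral:
  "AE b in lborel. b \<in> {0..T} \<longrightarrow> (\<integral>x. W x b b \<partial>lborel) \<le> \<kappa> * (Y b + c * measure lborel K)"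
  using AE_lborel_slices[OF W_pointwise] W_slice_integrable good_slices
proof eventually_elim
  case (elim b)
  show ?case
  proof
    assume b: "b \<in> {0..T}"
    have "borel_rep K1 (\<lambda>x. u (x, b)) (\<lambda>x. U (x, b))" using elim(3) b by blast
    then have eq: "AE x in lborel. U (x, b) = (if x \<in> K1 then u (x, b) else 0)" by (simp add: borel_rep_def)
    have [measurable]: "(\<lambda>x. U (x, b)) \<in> borel_measurable borel" by (rule slice_meas) simp
    have rep: "borel_rep K (\<lambda>x. (u (x, b) + \<nu>) powr r / r * z x) (\<lambda>x. (U (x, b) + \<nu>) powr r / r * z x)"
      unfolding borel_rep_def
    proof
      show "AE x in lborel. (U (x, b) + \<nu>) powr r / r * z x = (if x \<in> K then (u (x, b) + \<nu>) powr r / r * z x else 0)"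
        using eq by eventually_elim (use K_sub in \<open>auto simp: z\<close>)
    qed measurable
    note Yb = borel_rep_integral[OF compact_lebesgue[OF K(1)] rep]
    have i1: "integrable lborel (\<lambda>x. (U (x, b) + \<nu>) powr r / r * z x)" using Yb(2) Y_int[OF b] by simp
    have "(\<integral>x. W x b b \<partial>lborel) \<le> (\<integral>x. \<kappa> * ((U (x, b) + \<nu>) powr r / r * z x + c * indicator K x) \<partial>lborel)"
      using elim(1,2) b
      by (intro integral_mono_AE integrable_mult_right Bochner_Integration.integrable_add i1 integrable_K) auto
    also have "\<dots> = \<kappa> * ((\<integral>x. (U (x, b) + \<nu>) powr r / r * z x \<partial>lborel) + (\<integral>x. c * indicator K x \<partial>lborel))"
      by (subst integral_mult_right_zero, subst Bochner_Integration.integral_add[OF i1 integrable_K]) simp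
    also have "\<dots> = \<kappa> * (Y b + c * measure lborel K)" unfolding Y_def Yb(1) by simp
    finally show "(\<integral>x. W x b b \<partial>lborel) \<le> \<kappa> * (Y b + c * measure lborel K)" .
  qed
qed

text \<open>The offset c |K| joins Y in a homogeneous inequality with rate \<kappa>; for each s,
  \<open>energy_average\<close> supplies the integral hypothesis of \<open>gronwall\<close>.\<close>

lemma energy_bound:
  assumes t: "t \<in> {0..T}"
  shows "Y t + c * measure lborel K \<le> (Y 0 + c * measure lborel K) * exp (\<kappa> * t)"
proof (rule gronwall[OF _ \<kappa>])
  show "continuous_on {0..t} Y" using t by (intro continuous_on_subset[OF Y_cont]) auto
  show "0 \<le> t" using t by simp
  fix s assume s: "s \<in> {0..t}"
  show "Y s - Y 0 \<le> integral {0..s} (\<lambda>b. \<kappa> * (Y b + c * measure lborel K))"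
  proof (rule energy_average[OF W_meas W_error W_slice_integrable Y_cont _ _ W_slice_integral])
    show "continuous_on {0..T} (\<lambda>b. \<kappa> * (Y b + c * measure lborel K))"
      by (intro continuous_on_mult continuous_on_add continuous_on_const Y_cont)
    show "0 \<le> \<kappa> * (Y b + c * measure lborel K)" for b
      using \<kappa> c Y_nonneg[of b] by (intro mult_nonneg_nonneg add_nonneg_nonneg) auto
    show "AE b in lborel. b \<in> {0..T} \<longrightarrow> (\<forall>a\<in>{0..b}.
       Y b - Y a \<le> (\<integral>z. indicator {a..b} (snd z) * W (fst z) (snd z) b \<partial>lborel))"
      using good_slices
    proof eventually_elim
      case (elim b)
      then show ?case by (intro impI ballI energy_step) auto
    qed
    show "s \<in> {0..T}" using s t by auto
  qed
qed

end

context singular_energy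
begin

text \<open>The chosen representatives disappear again: the statement involves only \<open>u\<close>
  and the cutoff.\<close>

lemma energy_bound:
  assumes "t \<in> {0..T}"
  shows "(\<integral>x. (u (x, t) + \<nu>) powr r / r * z x \<partial>lebesgue_on K) + c * measure lborel K
    \<le> ((\<integral>x. (u (x, 0) + \<nu>) powr r / r * z x \<partial>lebesgue_on K) + c * measure lborel K) * exp (\<kappa> * t)"
proof -
  obtain U V P R D where *: "borel_rep Q u U" "\<And>w. 0 \<le> U w \<and> U w \<le> M" "\<And>i. borel_rep Q (\<lambda>w. Du w $ i) (V i)"
    "\<And>i. borel_rep Q (\<lambda>w. A w (u w) (Du w) $ i) (P i)" "borel_rep Q (\<lambda>w. B w (u w) (Du w)) R"
    "\<And>i w. 0 \<le> D i w \<and> \<bar>P i w\<bar> \<le> D i w powr (p i - 1)"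
    "\<And>i. integrable lborel (\<lambda>w. D i w powr p i)" "\<And>i. integrable lborel (\<lambda>w. \<bar>V i w\<bar> powr p i)"
    "\<And>i. integrable lborel (P i)" "integrable lborel R"
    using ex_reps by blast
  interpret singular_energy_rep \<Omega> T C C\<^sub>o C\<^sub>1 r \<nu> M \<kappa> c p A B u Du K1 K z z' U R V P D
    by unfold_locales (use * in auto)
  show ?thesis using energy_bound[OF assms] unfolding Y_def .
qed

end

subsection \<open>Intrinsic cubes and cutoff functions\<close>

lemma max_power_deriv:
  assumes m: "m \<ge> 2"
  shows "((\<lambda>y::real. (max 0 y) ^ m) has_real_derivative real m * (max 0 y) ^ (m - 1)) (at y)"
proof -
  consider "y > 0" | "y < 0" | "y = 0" by linarith
  then show ?thesis
  proof cases
    case 1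
    have "((\<lambda>y. y ^ m) has_real_derivative real m * y ^ (m - 1)) (at y)"
      by (auto intro!: derivative_eq_intros)
    then have "((\<lambda>y. (max 0 y) ^ m) has_real_derivative real m * y ^ (m - 1)) (at y)"
      by (rule has_field_derivative_transform_within_open[where S="{0<..}"]) (use 1 in auto)
    then show ?thesis using 1 by simp
  next
    case 2
    have "((\<lambda>y. 0) has_real_derivative 0) (at y)" by simp
    then have "((\<lambda>y. (max 0 y) ^ m) has_real_derivative 0) (at y)"
      by (rule has_field_derivative_transform_within_open[where S="{..<0}"]) (use 2 m in \<open>auto simp: power_0_left\<close>)
    then show ?thesis using 2 m by (simp add: power_0_left)
  next
    case 3
    have "((\<lambda>h. ((max 0 (0 + h)) ^ m - (max 0 0) ^ m) / h) \<longlongrightarrow> 0) (at (0::real))"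
    proof (rule Lim_null_comparison)
      show "\<forall>\<^sub>F h in at (0::real). norm (((max 0 (0 + h)) ^ m - (max 0 0) ^ m) / h) \<le> \<bar>h\<bar> ^ (m - 1)"
      proof (rule eventuallyI)
        fix h :: real
        obtain k where k: "m = Suc k" using m by (cases m) auto
        show "norm (((max 0 (0 + h)) ^ m - (max 0 0) ^ m) / h) \<le> \<bar>h\<bar> ^ (m - 1)"
          by (cases "h > 0") (simp_all add: k abs_mult max_def)
      qed
      have "((\<lambda>h::real. \<bar>h\<bar> ^ (m - 1)) \<longlongrightarrow> \<bar>0\<bar> ^ (m - 1)) (at 0)" by (intro tendsto_intros)
      then show "((\<lambda>h::real. \<bar>h\<bar> ^ (m - 1)) \<longlongrightarrow> 0) (at 0)" using m by (simp add: power_0_left)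
    qed
    then show ?thesis using 3 m by (simp add: DERIV_def power_0_left)
  qed
qed

lemma three_mult_less_power_4: "n \<ge> 1 \<Longrightarrow> 3 * real n < 4 ^ n"
proof (induction n rule: dec_induct)
  case (step n)
  then show ?case by simp
qed simp

text \<open>The level sets of \<open>\<Sum>\<^sub>j (x\<^sub>j / \<rho>\<^sub>j)\<^sup>2\<^sup>N\<close> at height up to \<open>3 N < 4\<^sup>N\<close> separate the box with half sides
  \<open>\<rho>\<^sub>j\<close> from the complement of the box with half sides \<open>2 \<rho>\<^sub>j\<close>.\<close>

lemma ex_box_cutoff:
  fixes \<rho> :: "'n::finite \<Rightarrow> real"
  assumes \<rho>: "\<And>i. \<rho> i > 0" and m: "m \<ge> 2"
  obtains \<zeta> :: "real^'n \<Rightarrow> real" and z' d K K1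
  where "compact K1" "compact K" "K \<subseteq> interior K1" "K1 \<subseteq> {x. \<forall>i. \<bar>x $ i\<bar> < 2 * \<rho> i}"
    "has_C1_deriv (\<lambda>x. \<zeta> x ^ m) z'" "\<And>x. 0 \<le> \<zeta> x" "\<And>x. \<zeta> x \<le> 1" "\<And>x. x \<notin> K \<Longrightarrow> \<zeta> x = 0"
    "\<And>x. (\<And>i. \<bar>x $ i\<bar> < \<rho> i) \<Longrightarrow> 1/2 \<le> \<zeta> x"
    "\<And>x i. z' x (axis i 1) = real m * \<zeta> x ^ (m - 1) * d x i"
    "\<And>x i. x \<in> K \<Longrightarrow> \<bar>d x i\<bar> \<le> 4 ^ CARD('n) / \<rho> i"
proof -
  define N where "N = CARD('n)"
  have N: "N \<ge> 1" using zero_less_card_finite[where 'a='n] by (simp add: N_def)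
  define \<sigma> where "\<sigma> x = (\<Sum>j\<in>UNIV. (x $ j / \<rho> j) ^ (2 * N))" for x :: "real^'n"
  define \<sigma>' where "\<sigma>' x v = (\<Sum>j\<in>UNIV. real (2 * N) * (x $ j / \<rho> j) ^ (2 * N - 1) * (v $ j / \<rho> j))" for x v :: "real^'n"
  have \<sigma>C1: "has_C1_deriv \<sigma> \<sigma>'"
    unfolding has_C1_deriv_def
  proof (intro conjI allI)
    fix x :: "real^'n"
    have "((\<lambda>x. (x $ j / \<rho> j) ^ (2 * N)) has_derivative (\<lambda>v. real (2 * N) * (x $ j / \<rho> j) ^ (2 * N - 1) * (v $ j / \<rho> j))) (at x)" for j
    proof -
      have "((\<lambda>x. x $ j / \<rho> j) has_derivative (\<lambda>v. v $ j / \<rho> j)) (at x)"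
        by (rule bounded_linear_imp_has_derivative) (intro bounded_linear_divide bounded_linear_vec_nth bounded_linear_compose[OF bounded_linear_divide bounded_linear_vec_nth])
      from has_derivative_power[OF this, of "2 * N"] show ?thesis
        by (rule has_derivative_eq_rhs) (auto simp: fun_eq_iff)
    qed
    then show "(\<sigma> has_derivative \<sigma>' x) (at x)"
      unfolding \<sigma>_def[abs_def] \<sigma>'_def[abs_def] by (intro has_derivative_sum)
    show "continuous_on UNIV (\<lambda>x. \<sigma>' x v)" for v
      unfolding \<sigma>'_def divide_inverse by (intro continuous_intros)
  qed
  have \<sigma>0: "\<sigma> x \<ge> 0" for x unfolding \<sigma>_def by (intro sum_nonneg) (simp add: zero_le_even_power)
  have \<sigma>c: "continuous_on UNIV \<sigma>" by (rule has_C1_deriv_continuous[OF \<sigma>C1])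
  \<comment> \<open>On the inner box each summand of \<sigma> is at most 1, so \<sigma> <= N and
    \<zeta> >= 1/2; \<zeta> vanishes for \<sigma> >= 2 N, and the level 3 N of K1 leaves a
    neighbourhood around K.\<close>
  define \<zeta> where "\<zeta> x = max 0 (1 - \<sigma> x / (2 * N))" for x
  define h where "h s = (max 0 (1 - s / (2 * N))) ^ m" for s :: real
  define h' where "h' s = real m * (max 0 (1 - s / (2 * N))) ^ (m - 1) * (- (1 / (2 * N)))" for s :: real
  have hd: "(h has_real_derivative h' s) (at s)" for s
  proof -
    have "((\<lambda>s. 1 - s / (2 * N)) has_real_derivative - (1 / (2 * N))) (at s)"
      using N by (auto intro!: derivative_eq_intros)
    from DERIV_chain2[OF max_power_deriv[OF m] this] show ?thesis unfolding h_def h'_def .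
  qed
  define z' where "z' x v = h' (\<sigma> x) * \<sigma>' x v" for x v
  \<comment> \<open>The factor 2 N from differentiating the power cancels the 1/(2 N) in \<zeta>. As
    |x_i| <= 2 \<rho>_i on K, d is bounded there by 2^(2N-1) / \<rho>_i.\<close>
  define d where "d x i = - ((x $ i / \<rho> i) ^ (2 * N - 1) / \<rho> i)" for x :: "real^'n" and i
  define K where "K = {x. \<sigma> x \<le> 2 * N}"
  define K1 where "K1 = {x. \<sigma> x \<le> 3 * N}"
  have coord: "\<bar>x $ i\<bar> < 2 * \<rho> i" if "\<sigma> x \<le> 3 * N" for x i
  proof (rule ccontr)
    assume "\<not> ?thesis"
    then have "2 \<le> \<bar>x $ i / \<rho> i\<bar>" using \<rho>[of i] by (simp add: field_simps)
    then have "2 ^ (2 * N) \<le> \<bar>x $ i / \<rho> i\<bar> ^ (2 * N)" by (intro power_mono) auto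
    also have "\<dots> = (x $ i / \<rho> i) ^ (2 * N)" by (rule power_even_abs) simp
    also have "\<dots> \<le> \<sigma> x" unfolding \<sigma>_def by (rule member_le_sum) (auto simp: zero_le_even_power)
    also have "\<dots> < 4 ^ N" using that three_mult_less_power_4[OF N] by simp
    finally show False by (simp add: power_mult)
  qed
  have cl: "closed K" "closed K1"
    unfolding K_def K1_def by (intro closed_Collect_le \<sigma>c continuous_on_const)+
  have "K1 \<subseteq> cbox (\<chi> i. - (2 * \<rho> i)) (\<chi> i. 2 * \<rho> i)"
  proof
    fix x assume "x \<in> K1"
    then have "\<bar>x $ i\<bar> < 2 * \<rho> i" for i using coord by (simp add: K1_def)
    then have "- (2 * \<rho> i) \<le> x $ i \<and> x $ i \<le> 2 * \<rho> i" for i by (smt (verit))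
    then show "x \<in> cbox (\<chi> i. - (2 * \<rho> i)) (\<chi> i. 2 * \<rho> i)" by (simp add: mem_box_cart)
  qed
  then have bd: "bounded K1" by (rule bounded_subset[OF bounded_cbox])
  have KK1: "K \<subseteq> K1" by (auto simp: K_def K1_def)
  have comp: "compact K" "compact K1"
    using cl bd bounded_subset[OF bd KK1] unfolding compact_eq_bounded_closed by blast+
  have int: "K \<subseteq> interior K1"
  proof (rule subset_trans)
    show "K \<subseteq> {x. \<sigma> x < 3 * N}" using N by (auto simp: K_def)
    show "{x. \<sigma> x < 3 * N} \<subseteq> interior K1"
    proof (rule interior_maximal)
      show "{x. \<sigma> x < 3 * N} \<subseteq> K1" by (auto simp: K1_def)
      show "open {x. \<sigma> x < 3 * N}" by (rule open_Collect_less[OF \<sigma>c continuous_on_const])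
    qed
  qed
  have zC1: "has_C1_deriv (\<lambda>x. \<zeta> x ^ m) z'"
  proof -
    have "has_C1_deriv (\<lambda>x. h (\<sigma> x)) (\<lambda>x v. h' (\<sigma> x) * \<sigma>' x v)"
    proof (rule has_C1_deriv_comp[OF \<sigma>C1 hd])
      show "continuous_on (range \<sigma>) h'"
        unfolding h'_def[abs_def] divide_inverse by (intro continuous_intros)
    qed
    then show ?thesis unfolding h_def \<zeta>_def z'_def[abs_def] .
  qed
  have z0: "\<zeta> x = 0" if "x \<notin> K" for x
    using that N by (auto simp: K_def \<zeta>_def field_simps max_def)
  have half: "1/2 \<le> \<zeta> x" if x: "\<And>i. \<bar>x $ i\<bar> < \<rho> i" for x
  proof -
    have "(x $ j / \<rho> j) ^ (2 * N) \<le> 1" for j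
    proof -
      have "\<bar>x $ j / \<rho> j\<bar> \<le> 1" using x[of j] \<rho>[of j] by (simp add: field_simps)
      then have "\<bar>x $ j / \<rho> j\<bar> ^ (2 * N) \<le> 1" by (intro power_le_one) auto
      moreover have "\<bar>x $ j / \<rho> j\<bar> ^ (2 * N) = (x $ j / \<rho> j) ^ (2 * N)" by (rule power_even_abs) simp
      ultimately show ?thesis by (simp only:)
    qed
    then have "\<sigma> x \<le> (\<Sum>j\<in>(UNIV::'n set). 1)" unfolding \<sigma>_def by (rule sum_mono)
    then have "\<sigma> x \<le> N" by (simp add: N_def)
    then have "\<sigma> x / (2 * N) \<le> 1/2" using N by (simp add: field_simps)
    then show ?thesis by (simp add: \<zeta>_def)
  qed
  have zd: "z' x (axis i 1) = real m * \<zeta> x ^ (m - 1) * d x i" for x i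
  proof -
    have "\<sigma>' x (axis i 1) = (\<Sum>j\<in>UNIV. if j = i then real (2 * N) * (x $ i / \<rho> i) ^ (2 * N - 1) / \<rho> i else 0)"
      unfolding \<sigma>'_def by (intro sum.cong) (auto simp: axis_def)
    also have "\<dots> = real (2 * N) * (x $ i / \<rho> i) ^ (2 * N - 1) / \<rho> i" by simp
    finally show ?thesis using N by (simp add: z'_def h'_def \<zeta>_def d_def)
  qed
  have db: "\<bar>d x i\<bar> \<le> 4 ^ CARD('n) / \<rho> i" if "x \<in> K" for x i
  proof -
    have "\<bar>x $ i / \<rho> i\<bar> \<le> 2" using coord[of x i] that KK1 \<rho>[of i] by (auto simp: K1_def field_simps)
    then have "\<bar>x $ i / \<rho> i\<bar> ^ (2 * N - 1) \<le> 2 ^ (2 * N - 1)" by (intro power_mono) auto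
    also have "\<dots> \<le> (2::real) ^ (2 * N)" by (intro power_increasing) auto
    also have "\<dots> = 4 ^ N" by (simp add: power_mult)
    finally show ?thesis using \<rho>[of i] unfolding d_def N_def[symmetric]
      by (simp add: power_abs abs_divide divide_right_mono)
  qed
  show ?thesis
  proof (rule that[OF comp(2,1) int _ zC1 _ _ z0 half zd db])
    show "K1 \<subseteq> {x. \<forall>i. \<bar>x $ i\<bar> < 2 * \<rho> i}" using coord by (auto simp: K1_def)
    show "0 \<le> \<zeta> x" "\<zeta> x \<le> 1" for x using \<sigma>0[of x] by (auto simp: \<zeta>_def)
  qed
qed

section \<open>Intrinsic geometry: sides, volume, smallness of C\<close>

definition intrinsic_side :: "('n::finite \<Rightarrow> real) \<Rightarrow> real \<Rightarrow> real \<Rightarrow> 'n \<Rightarrow> real" where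
  "intrinsic_side p \<rho> t i = \<rho> powr (harmonic_mean p * (2 - p i) / (p i * (2 - harmonic_mean p)))
     * t powr ((p i - harmonic_mean p) / ((2 - harmonic_mean p) * p i))"

lemma intrinsic_cube_eq: "intrinsic_cube p a \<rho> t = {x. \<forall>i. \<bar>x $ i\<bar> < a * intrinsic_side p \<rho> t i}"
  by (simp add: intrinsic_cube_def intrinsic_side_def Let_def mult.assoc)

lemma harmonic_mean_bounds:
  fixes p :: "'n::finite \<Rightarrow> real"
  assumes "\<And>i. 1 < p i" "\<And>i. p i < 2"
  shows "1 < harmonic_mean p" "harmonic_mean p < 2"
    "(\<Sum>i\<in>UNIV. 1 / p i) = real CARD('n) / harmonic_mean p"
proof -
  let ?S = "\<Sum>i\<in>UNIV. 1 / p i"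
  have pos: "p i > 0" for i using assms(1)[of i] by simp
  have "?S < (\<Sum>i\<in>(UNIV::'n set). 1)" using assms(1) pos by (intro sum_strict_mono) auto
  then have 1: "?S < real CARD('n)" by simp
  have "(\<Sum>i\<in>(UNIV::'n set). 1/2) < ?S" using assms(2) pos by (intro sum_strict_mono) (auto simp: field_simps)
  then have 2: "real CARD('n) / 2 < ?S" by simp
  have 3: "?S > 0" using 2 by (smt (verit) of_nat_0_le_iff divide_nonneg_nonneg)
  show "1 < harmonic_mean p" using 1 3 by (simp add: harmonic_mean_def field_simps)
  show "harmonic_mean p < 2" using 2 3 by (simp add: harmonic_mean_def field_simps)
  show "?S = real CARD('n) / harmonic_mean p" using 3 by (simp add: harmonic_mean_def)
qed

context
  fixes p :: "'n::finite \<Rightarrow> real" and q \<rho> t \<nu> :: real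
  assumes p: "\<And>i. 1 < p i" "\<And>i. p i < 2" and q: "q = harmonic_mean p"
    and \<rho>: "\<rho> > 0" and t: "t > 0" and \<nu>: "\<nu> = (t / \<rho> powr q) powr (1 / (2 - q))"
begin

lemma q_bounds: "1 < q" "q < 2"
  using harmonic_mean_bounds[OF p] by (simp_all add: q)

lemma \<nu>_pos: "\<nu> > 0" using \<rho> t by (simp add: \<nu>)

lemma \<nu>_powr: "\<nu> powr (2 - q) = t / \<rho> powr q"
  using q_bounds \<rho> t by (simp add: \<nu> powr_powr)

lemma intrinsic_side_pos: "intrinsic_side p \<rho> t i > 0"
  using \<rho> t by (simp add: intrinsic_side_def)

text \<open>The powers of \<rho> agree on both sides and those of t add up to 1. Through this
  identity the cutoff gradient fits the singular exponent 2 - p_i in every direction at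
  once.\<close>

lemma intrinsic_side_powr: "t / intrinsic_side p \<rho> t i powr p i = \<nu> powr (2 - p i)"
proof -
  have pi: "p i \<noteq> 0" "2 - q \<noteq> 0" using p(1)[of i] q_bounds by auto
  have side: "intrinsic_side p \<rho> t i powr p i = \<rho> powr (q * (2 - p i) / (2 - q)) * t powr ((p i - q) / (2 - q))"
    using pi by (simp add: intrinsic_side_def powr_mult powr_powr flip: q)
  have \<nu>p: "\<nu> powr (2 - p i) = t powr ((2 - p i) / (2 - q)) / \<rho> powr (q * (2 - p i) / (2 - q))"
    using \<rho> t by (simp add: \<nu> powr_powr powr_divide)
  have "t powr ((2 - p i) / (2 - q)) * t powr ((p i - q) / (2 - q)) = t"
  proof -
    have "(2 - p i) / (2 - q) + (p i - q) / (2 - q) = 1" using pi by (simp flip: add_divide_distrib)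
    then show ?thesis using t by (simp flip: powr_add)
  qed
  moreover have "t / (b * s) = a / b" if "a * s = t" "s > 0" for a b s :: real using that by auto
  moreover have "t powr ((p i - q) / (2 - q)) > 0" using t by simp
  ultimately show ?thesis unfolding side \<nu>p by metis
qed

text \<open>The exponents are affine in 1 / p_i; since q is the harmonic mean, those of t sum to 0
  and those of \<rho> to N.\<close>

lemma prod_intrinsic_side: "(\<Prod>i\<in>UNIV. intrinsic_side p \<rho> t i) = \<rho> ^ CARD('n)"
proof -
  have q0: "q > 0" "2 - q \<noteq> 0" using q_bounds by auto
  have pi: "p i \<noteq> 0" for i using p(1)[of i] by simp
  have split1: "q * (2 - y) / (y * D) = (2 * q / D) * (1 / y) - q / D" if "y \<noteq> 0" "D \<noteq> 0" for y D :: real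
    using that by (simp add: field_simps)
  have split2: "(y - q) / (D * y) = 1 / D - (q / D) * (1 / y)" if "y \<noteq> 0" "D \<noteq> 0" for y D :: real
    using that by (simp add: field_simps)
  have comb1: "(2 * q / D) * (n / q) - n * (q / D) = n * ((2 - q) / D)" if "q \<noteq> 0" "D \<noteq> 0" for n D :: real
    using that by (simp add: field_simps)
  have comb2: "n * (1 / D) - (q / D) * (n / q) = 0" if "q \<noteq> 0" "D \<noteq> 0" for n D :: real
    using that by (simp add: field_simps)
  have S: "(\<Sum>i\<in>UNIV. 1 / p i) = real CARD('n) / q" using harmonic_mean_bounds(3)[OF p] by (simp add: q)
  have "(\<Prod>i\<in>UNIV. intrinsic_side p \<rho> t i)
    = (\<Prod>i\<in>UNIV. \<rho> powr (q * (2 - p i) / (p i * (2 - q)))) * (\<Prod>i\<in>UNIV. t powr ((p i - q) / ((2 - q) * p i)))"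
    by (simp add: intrinsic_side_def prod.distrib flip: q)
  also have "(\<Prod>i\<in>UNIV. \<rho> powr (q * (2 - p i) / (p i * (2 - q)))) = \<rho> powr (\<Sum>i\<in>UNIV. q * (2 - p i) / (p i * (2 - q)))"
    using \<rho> by (simp add: powr_sum)
  also have "(\<Sum>i\<in>UNIV. q * (2 - p i) / (p i * (2 - q))) = (\<Sum>i\<in>UNIV. (2 * q / (2 - q)) * (1 / p i) - q / (2 - q))"
    using pi q0 by (intro sum.cong split1 refl)
  also have "\<dots> = (2 * q / (2 - q)) * (real CARD('n) / q) - real CARD('n) * (q / (2 - q))"
    unfolding sum_subtractf sum_distrib_left[symmetric] S by simp
  also have "\<dots> = real CARD('n) * ((2 - q) / (2 - q))" by (rule comb1) (use q0 in auto)
  also have "\<dots> = real CARD('n)" using q0 by simp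
  also have "(\<Prod>i\<in>UNIV. t powr ((p i - q) / ((2 - q) * p i))) = t powr (\<Sum>i\<in>UNIV. (p i - q) / ((2 - q) * p i))"
    using t by (simp add: powr_sum)
  also have "(\<Sum>i\<in>UNIV. (p i - q) / ((2 - q) * p i)) = (\<Sum>i\<in>UNIV. 1 / (2 - q) - (q / (2 - q)) * (1 / p i))"
    using pi q0 by (intro sum.cong split2 refl)
  also have "\<dots> = real CARD('n) * (1 / (2 - q)) - (q / (2 - q)) * (real CARD('n) / q)"
    unfolding sum_subtractf sum_distrib_left[symmetric] S by simp
  also have "\<dots> = 0" by (rule comb2) (use q0 in auto)
  finally show ?thesis using \<rho> t by (simp add: powr_realpow)
qed

text \<open>Since t = \<nu>^(2-q) \<rho>^q, multiplying the three bounds by \<nu>^(2-q) gives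
  \<nu>^(2-q), \<nu>^(2-p_i) and \<nu>^2. The last conclusion takes \<nu>^2 <= \<nu> if \<nu> <= 1
  and \<nu>^(2-q) <= \<nu> otherwise, as 2 - q < 1.\<close>

lemma coefficient_smallness:
  assumes C: "C powr p i * \<rho> powr q \<le> 1" "C powr p i * \<rho> powr q \<le> \<nu> powr (q - p i)" "C powr p i * \<rho> powr q \<le> \<nu> powr q"
  shows "t * C powr p i \<le> \<nu>\<^sup>2" "t * C powr p i \<le> \<nu> powr (2 - p i)" "t * C powr p i \<le> \<nu>"
proof -
  have eq: "t * C powr p i = \<nu> powr (2 - q) * (C powr p i * \<rho> powr q)"
    using \<rho> by (simp add: \<nu>_powr)
  have le: "t * C powr p i \<le> \<nu> powr (2 - q + e)" if "C powr p i * \<rho> powr q \<le> \<nu> powr e" for e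
    unfolding eq powr_add using that by (intro mult_left_mono) auto
  have two: "t * C powr p i \<le> \<nu>\<^sup>2" using le[OF C(3)] \<nu>_pos by simp
  then show "t * C powr p i \<le> \<nu>\<^sup>2" .
  show "t * C powr p i \<le> \<nu> powr (2 - p i)" using le[OF C(2)] by simp
  show "t * C powr p i \<le> \<nu>"
  proof (cases "\<nu> \<le> 1")
    case True
    then have "\<nu>\<^sup>2 \<le> \<nu>" using \<nu>_pos by (simp add: power2_eq_square mult_left_le)
    with two show ?thesis by simp
  next
    case False
    have "t * C powr p i \<le> \<nu> powr (2 - q + 0)" by (rule le) (use C(1) \<nu>_pos in simp)
    also have "\<dots> \<le> \<nu> powr 1" using False q_bounds by (intro powr_mono) auto
    finally show ?thesis using \<nu>_pos by simp
  qed
qed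

text \<open>Identifies the last term of the theorem: up to a power of 2 it is \<nu>^r times the
  volume of the cube, that is, the contribution of the shift by \<nu>.\<close>

lemma intrinsic_volume:
  "(t powr r / \<rho> powr (real CARD('n) * (q - 2) + q * r)) powr (1 / (2 - q)) = \<rho> ^ CARD('n) * \<nu> powr r"
proof -
  have q0: "2 - q \<noteq> 0" using q_bounds by auto
  have "(t powr r / \<rho> powr (real CARD('n) * (q - 2) + q * r)) powr (1 / (2 - q))
    = t powr (r / (2 - q)) / \<rho> powr ((real CARD('n) * (q - 2) + q * r) / (2 - q))"
    by (simp add: powr_divide powr_powr)
  also have "(real CARD('n) * (q - 2) + q * r) / (2 - q) = q * r / (2 - q) - real CARD('n)"
    using q0 by (simp add: field_simps)
  also have "\<rho> powr (q * r / (2 - q) - real CARD('n)) = \<rho> powr (q * r / (2 - q)) / \<rho> ^ CARD('n)"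
    using \<rho> by (simp add: powr_diff powr_realpow)
  also have "t powr (r / (2 - q)) / (\<rho> powr (q * r / (2 - q)) / \<rho> ^ CARD('n)) = \<rho> ^ CARD('n) * \<nu> powr r"
    by (simp add: \<nu> powr_powr powr_divide)
  finally show ?thesis .
qed

end

lemma intrinsic_cube_borel: "(intrinsic_cube p a \<rho> t :: (real^'n::finite) set) \<in> sets borel"
proof -
  have "(intrinsic_cube p a \<rho> t :: (real^'n) set) = (\<Inter>i\<in>UNIV. {x. \<bar>x $ i\<bar> < a * intrinsic_side p \<rho> t i})"
    by (auto simp: intrinsic_cube_eq)
  moreover have "open (\<Inter>i\<in>UNIV. {x::real^'n. \<bar>x $ i\<bar> < a * intrinsic_side p \<rho> t i})"
  proof (rule open_INT[OF finite], rule ballI)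
    show "open {x::real^'n. \<bar>x $ i\<bar> < a * intrinsic_side p \<rho> t i}" for i
      by (intro open_Collect_less continuous_intros)
  qed
  ultimately show ?thesis by simp
qed

subsection \<open>The \<open>L\<^sup>r\<close> estimate\<close>

text \<open>The larger cube may touch the boundary of \<Omega>, where local boundedness gives
  nothing, so integrals over cubes stay in \<open>ennreal\<close>; finite integrals live on the
  compact K. \<Gamma> and its bound \<open>point\<close> are given before the solution, so \<gamma>
  is independent of it.\<close>

lemma Lr_estimate:
  fixes p :: "'n::finite \<Rightarrow> real" and q C\<^sub>o C\<^sub>1 r \<rho> t \<nu> \<tau> T C :: real and m :: nat and \<Gamma> :: "'n \<Rightarrow> real"
    and \<Omega> :: "(real^'n) set"
  assumes p: "\<And>i. 1 < p i" "\<And>i. p i < 2" and q: "q = harmonic_mean p"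
    and C1: "C\<^sub>1 > 0" and r: "r > 1" and m: "m \<ge> 2"
    and \<Gamma>: "\<And>i. \<Gamma> i \<ge> 0"
    and point: "\<And>i w \<nu> t K \<zeta> d \<xi> A. \<nu> > 0 \<Longrightarrow> w \<ge> \<nu> \<Longrightarrow> t > 0 \<Longrightarrow> K \<ge> 0 \<Longrightarrow> 0 \<le> \<zeta> \<Longrightarrow> \<zeta> \<le> 1 \<Longrightarrow>
      t * \<bar>d\<bar> powr p i \<le> (4 ^ CARD('n)) powr p i * \<nu> powr (2 - p i) \<Longrightarrow> t * K powr p i \<le> \<nu>\<^sup>2 \<Longrightarrow>
      t * K powr p i \<le> \<nu> powr (2 - p i) \<Longrightarrow>
      t * K powr p i \<le> \<nu> \<Longrightarrow> A * \<xi> \<ge> C\<^sub>o * \<bar>\<xi>\<bar> powr p i - K powr p i \<Longrightarrow>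
      \<bar>A\<bar> \<le> C\<^sub>1 * \<bar>\<xi>\<bar> powr (p i - 1) + K powr (p i - 1) \<Longrightarrow>
      K * (\<bar>\<xi>\<bar> powr (p i - 1) + K powr (p i - 1)) * (w powr (r - 1) * \<zeta> ^ m)
        - A * ((r - 1) * w powr (r - 2) * \<xi> * \<zeta> ^ m + w powr (r - 1) * (real m * \<zeta> ^ (m - 1) * d))
      \<le> \<Gamma> i / t * (w powr r * \<zeta> ^ m + \<nu> powr r)"
    and \<Omega>: "open \<Omega>" and T: "T > 0" and C: "C \<ge> 0"
    and A: "caratheodory \<Omega> T A" and B: "caratheodory \<Omega> T B"
    and str: "structure_conditions \<Omega> T p C\<^sub>o C\<^sub>1 C A B"
    and sub: "local_weak_subsolution \<Omega> T p A B u"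
    and u0: "AE w in lebesgue_on (\<Omega> \<times> {0..T}). u w \<ge> 0" and lb: "locally_bounded (\<Omega> \<times> {0..T}) u"
    and t: "t > 0" and \<rho>: "\<rho> > 0" and cyl: "intrinsic_cube p 2 \<rho> t \<times> {0..t} \<subseteq> \<Omega> \<times> {0..T}"
    and \<nu>: "\<nu> = (t / \<rho> powr q) powr (1 / (2 - q))"
    and small: "\<And>i. C powr p i * \<rho> powr q \<le> Min {1, \<nu> powr (q - p i), \<nu> powr q}"
    and \<tau>: "\<tau> \<in> {0..t}"
  defines "\<gamma> \<equiv> 2 ^ m * exp (r * (\<Sum>i\<in>UNIV. \<Gamma> i)) * (2 powr r + 1) * 4 ^ CARD('n)"
  shows "(\<integral>\<^sup>+x. ennreal (u (x, \<tau>) powr r) \<partial>lebesgue_on (intrinsic_cube p 1 \<rho> t))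
    \<le> ennreal \<gamma> * (\<integral>\<^sup>+x. ennreal (u (x, 0) powr r) \<partial>lebesgue_on (intrinsic_cube p 2 \<rho> t))
      + ennreal (\<gamma> * (\<rho> ^ CARD('n) * \<nu> powr r))"
proof -
  let ?s = "intrinsic_side p \<rho> t"
  have s0: "?s i > 0" for i by (rule intrinsic_side_pos[OF p q \<rho> t \<nu>])
  have \<nu>0: "\<nu> > 0" by (rule \<nu>_pos[OF p q \<rho> t \<nu>])
  obtain \<zeta> z' d K K1 where K1: "compact K1" and K: "compact K" "K \<subseteq> interior K1"
    and K1s: "K1 \<subseteq> {x. \<forall>i. \<bar>x $ i\<bar> < 2 * ?s i}"
    and zC1: "has_C1_deriv (\<lambda>x. \<zeta> x ^ m) z'" and \<zeta>01: "\<And>x. 0 \<le> \<zeta> x" "\<And>x. \<zeta> x \<le> (1::real)"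
    and \<zeta>0: "\<And>x. x \<notin> K \<Longrightarrow> \<zeta> x = 0" and \<zeta>half: "\<And>x. (\<And>i. \<bar>x $ i\<bar> < ?s i) \<Longrightarrow> 1/2 \<le> \<zeta> x"
    and z'eq: "\<And>x i. z' x (axis i 1) = real m * \<zeta> x ^ (m - 1) * d x i"
    and db: "\<And>x i. x \<in> K \<Longrightarrow> \<bar>d x i\<bar> \<le> 4 ^ CARD('n) / ?s i"
  proof (rule ex_box_cutoff[where \<rho>="?s" and m=m, OF s0 m])
    fix \<zeta> :: "real^'n \<Rightarrow> real" and z' d K K1
    assume a: "compact K1" "compact K" "K \<subseteq> interior K1" "K1 \<subseteq> {x. \<forall>i. \<bar>x $ i\<bar> < 2 * ?s i}"
      "has_C1_deriv (\<lambda>x. \<zeta> x ^ m) z'" "\<And>x. 0 \<le> \<zeta> x" "\<And>x. \<zeta> x \<le> 1" "\<And>x. x \<notin> K \<Longrightarrow> \<zeta> x = 0"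
      "\<And>x. (\<And>i. \<bar>x $ i\<bar> < ?s i) \<Longrightarrow> 1/2 \<le> \<zeta> x"
      "\<And>x i. z' x (axis i 1) = real m * \<zeta> x ^ (m - 1) * d x i"
      "\<And>x i. x \<in> K \<Longrightarrow> \<bar>d x i\<bar> \<le> 4 ^ CARD('n) / ?s i"
    show thesis by (rule that[OF a])
  qed
  have K1c: "K1 \<subseteq> intrinsic_cube p 2 \<rho> t" using K1s by (simp add: intrinsic_cube_eq)
  \<comment> \<open>Pairing the centre of the cube with the time t turns the inclusion of cylinders
    into t <= T.\<close>
  have z_in: "(0::real^'n) \<in> intrinsic_cube p 2 \<rho> t" using s0 by (simp add: intrinsic_cube_eq)
  have tT: "t \<le> T" using cyl z_in t by (auto dest!: subsetD[where c="(0, t)"])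
  have cube\<Omega>: "intrinsic_cube p 2 \<rho> t \<subseteq> \<Omega>" using cyl t by (auto dest!: subsetD[where c="(_, 0)"])
  have K1\<Omega>: "K1 \<subseteq> \<Omega>" using K1c cube\<Omega> by blast
  have KK1: "K \<subseteq> K1" using K(2) interior_subset by blast
  have K\<Omega>: "K \<subseteq> \<Omega>" using KK1 K1\<Omega> by blast
  have Ks: "K \<in> sets lebesgue" "K \<in> sets borel" using K(1) by (auto intro: compact_lebesgue borel_compact)
  have cs: "intrinsic_cube p a \<rho> t \<in> sets lebesgue" for a using intrinsic_cube_borel[of p a \<rho> t] by simp
  obtain Du where uC: "C_L2loc \<Omega> T u" and uW: "Lp_Wloc \<Omega> T p u Du"
    and weak: "\<And>t\<^sub>1 t\<^sub>2 K \<phi> \<phi>\<^sub>t D\<phi>.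
          0 \<le> t\<^sub>1 \<and> t\<^sub>1 \<le> t\<^sub>2 \<and> t\<^sub>2 \<le> T \<and> compact K \<and> K \<subseteq> \<Omega> \<and>
          W12_L2loc \<Omega> T \<phi> \<phi>\<^sub>t \<and> Lp_Wo \<Omega> T p \<phi> D\<phi> \<and>
          (AE z in lebesgue_on (\<Omega> \<times> {0..T}). \<phi> z \<ge> 0) \<and>
          (AE z in lebesgue_on (\<Omega> \<times> {0..T}). fst z \<notin> K \<longrightarrow> \<phi> z = 0) \<Longrightarrow>
          ((\<integral>x. u (x, t\<^sub>2) * \<phi> (x, t\<^sub>2) \<partial>lebesgue_on K)
             - (\<integral>x. u (x, t\<^sub>1) * \<phi> (x, t\<^sub>1) \<partial>lebesgue_on K)
             + (\<integral>z. - u z * \<phi>\<^sub>t z + (\<Sum>i\<in>UNIV. A z (u z) (Du z) $ i * D\<phi> z $ i) \<partial>lebesgue_on (K \<times> {t\<^sub>1..t\<^sub>2})))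
          \<le> (\<integral>z. B z (u z) (Du z) * \<phi> z \<partial>lebesgue_on (K \<times> {t\<^sub>1..t\<^sub>2}))"
    using sub unfolding local_weak_subsolution_def weak_inequality_def by (elim conjE exE) (rule that, assumption+, blast)
  let ?Q = "K1 \<times> {0..T}"
  have Q: "compact ?Q" "?Q \<subseteq> \<Omega> \<times> {0..T}" using K1 K1\<Omega> by (auto intro: compact_Times)
  obtain M0 where "AE w in lebesgue_on ?Q. \<bar>u w\<bar> \<le> M0" using lb Q by (auto simp: locally_bounded_def)
  then have M0: "AE w in lborel. w \<in> ?Q \<longrightarrow> \<bar>u w\<bar> \<le> M0" unfolding AE_lebesgue_on_iff[OF compact_lebesgue[OF Q(1)]] .
  define M where "M = max 0 M0"
  have \<Omega>T: "\<Omega> \<times> {0..T} \<in> sets lebesgue" using \<Omega> borel_Times_Icc[of \<Omega> "{0..T}"] by simp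
  have bnd: "AE w in lebesgue_on ?Q. 0 \<le> u w \<and> u w \<le> M"
    unfolding AE_lebesgue_on_iff[OF compact_lebesgue[OF Q(1)]]
    using M0 u0[unfolded AE_lebesgue_on_iff[OF \<Omega>T]]
  proof eventually_elim
    case (elim w) then show ?case using Q(2) by (auto simp: M_def)
  qed
  have M: "M \<ge> 0" by (simp add: M_def)
  define G where "G = (\<Sum>i\<in>UNIV. \<Gamma> i)"
  have G: "G \<ge> 0" unfolding G_def using \<Gamma> by (intro sum_nonneg) auto
  \<comment> \<open>The factors r and 1/r match the normalisation w^r / r of the energy. As \<kappa>
    t = r G, the Gronwall factor on [0, t] is independent of t.\<close>
  define \<kappa> where "\<kappa> = r * G / t"
  define c where "c = \<nu> powr r / r"
  interpret E: singular_energy \<Omega> T C C\<^sub>o C\<^sub>1 r \<nu> M \<kappa> c p A B u Du K1 K "\<lambda>x. \<zeta> x ^ m" z'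
  proof (unfold_locales; (fact \<Omega> T p C C1 A B str uC uW K1 K1\<Omega> K bnd M zC1 \<nu>0 r)?)
    show "\<And>t\<^sub>1 t\<^sub>2 K \<phi> \<phi>\<^sub>t D\<phi>.
          0 \<le> t\<^sub>1 \<and> t\<^sub>1 \<le> t\<^sub>2 \<and> t\<^sub>2 \<le> T \<and> compact K \<and> K \<subseteq> \<Omega> \<and>
          W12_L2loc \<Omega> T \<phi> \<phi>\<^sub>t \<and> Lp_Wo \<Omega> T p \<phi> D\<phi> \<and>
          (AE z in lebesgue_on (\<Omega> \<times> {0..T}). \<phi> z \<ge> 0) \<and>
          (AE z in lebesgue_on (\<Omega> \<times> {0..T}). fst z \<notin> K \<longrightarrow> \<phi> z = 0) \<Longrightarrow>
          ((\<integral>x. u (x, t\<^sub>2) * \<phi> (x, t\<^sub>2) \<partial>lebesgue_on K)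
             - (\<integral>x. u (x, t\<^sub>1) * \<phi> (x, t\<^sub>1) \<partial>lebesgue_on K)
             + (\<integral>z. - u z * \<phi>\<^sub>t z + (\<Sum>i\<in>UNIV. A z (u z) (Du z) $ i * D\<phi> z $ i) \<partial>lebesgue_on (K \<times> {t\<^sub>1..t\<^sub>2})))
          \<le> (\<integral>z. B z (u z) (Du z) * \<phi> z \<partial>lebesgue_on (K \<times> {t\<^sub>1..t\<^sub>2}))" by (rule weak)
    show "0 \<le> \<zeta> x ^ m" for x using \<zeta>01 by simp
    show "\<zeta> x ^ m = 0" if "x \<notin> K" for x using \<zeta>0[OF that] m by simp
    show "0 \<le> \<kappa>" using r G t by (simp add: \<kappa>_def)
    show "0 \<le> c" using r by (simp add: c_def)
  next
    fix x s \<xi> a b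
    assume x: "x \<in> K" and s: "0 \<le> s" "s \<le> M"
      and a1: "\<And>i. C\<^sub>o * \<bar>\<xi> $ i\<bar> powr p i - C powr p i \<le> a $ i * \<xi> $ i"
      and a2: "\<And>i. \<bar>a $ i\<bar> \<le> C\<^sub>1 * \<bar>\<xi> $ i\<bar> powr (p i - 1) + C powr (p i - 1)"
      and b: "\<bar>b\<bar> \<le> (\<Sum>i\<in>UNIV. C * (\<bar>\<xi> $ i\<bar> powr (p i - 1) + C powr (p i - 1)))"
    let ?w = "s + \<nu>"
    let ?F = "?w powr r * \<zeta> x ^ m + \<nu> powr r"
    let ?D = "\<lambda>i. (r - 1) * ?w powr (r - 2) * \<xi> $ i * \<zeta> x ^ m + ?w powr (r - 1) * z' x (axis i 1)"
    let ?b = "\<lambda>i. C * (\<bar>\<xi> $ i\<bar> powr (p i - 1) + C powr (p i - 1))"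
    \<comment> \<open>The bound on the source is a sum over directions, so the integrand splits into
      one term per direction, each covered by \<open>point\<close>.\<close>
    have each: "?b i * (?w powr (r - 1) * \<zeta> x ^ m) - a $ i * ?D i \<le> \<Gamma> i / t * ?F" for i
      unfolding z'eq
    proof (rule point[OF \<nu>0 _ t C \<zeta>01 _ _ _ _ a1 a2])
      show "\<nu> \<le> ?w" using s by simp
      have "t * \<bar>d x i\<bar> powr p i \<le> t * (4 ^ CARD('n) / ?s i) powr p i"
        using db[OF x, of i] p(1)[of i] t by (intro mult_left_mono powr_mono2) auto
      also have "\<dots> = (4 ^ CARD('n)) powr p i * (t / ?s i powr p i)" by (simp add: powr_divide)
      also have "\<dots> = (4 ^ CARD('n)) powr p i * \<nu> powr (2 - p i)"
        using intrinsic_side_powr[OF p q \<rho> t \<nu>] by simp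
      finally show "t * \<bar>d x i\<bar> powr p i \<le> (4 ^ CARD('n)) powr p i * \<nu> powr (2 - p i)" .
      have "C powr p i * \<rho> powr q \<le> 1" "C powr p i * \<rho> powr q \<le> \<nu> powr (q - p i)" "C powr p i * \<rho> powr q \<le> \<nu> powr q"
        using small[of i] by simp_all
      note coefficient_smallness[OF p q \<rho> t \<nu> this]
      then show "t * C powr p i \<le> \<nu>\<^sup>2" "t * C powr p i \<le> \<nu> powr (2 - p i)" "t * C powr p i \<le> \<nu>" by auto
    qed
    have wz: "0 \<le> ?w powr (r - 1) * \<zeta> x ^ m" using \<zeta>01 by simp
    have "b \<le> (\<Sum>i\<in>UNIV. ?b i)" using b by linarith
    from mult_right_mono[OF this wz]
    have "b * (?w powr (r - 1) * \<zeta> x ^ m) - (\<Sum>i\<in>UNIV. a $ i * ?D i)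
      \<le> (\<Sum>i\<in>UNIV. ?b i * (?w powr (r - 1) * \<zeta> x ^ m) - a $ i * ?D i)"
      by (simp add: sum_subtractf sum_distrib_right)
    also have "\<dots> \<le> (\<Sum>i\<in>UNIV. \<Gamma> i / t * ?F)" by (intro sum_mono each)
    also have "\<dots> = G / t * ?F" by (simp add: G_def sum_distrib_right sum_divide_distrib)
    also have "\<dots> = \<kappa> * (?w powr r / r * \<zeta> x ^ m + c)"
      using r by (simp add: \<kappa>_def c_def distrib_left)
    finally show "b * (?w powr (r - 1) * \<zeta> x ^ m) - (\<Sum>i\<in>UNIV. a $ i * ?D i) \<le> \<kappa> * (?w powr r / r * \<zeta> x ^ m + c)" .
  qed
  let ?f = "\<lambda>s x. (u (x, s) + \<nu>) powr r / r * \<zeta> x ^ m"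
  let ?Y = "\<lambda>s. \<integral>x. ?f s x \<partial>lebesgue_on K"
  define \<mu> where "\<mu> = measure lborel K"
  have \<tau>T: "\<tau> \<in> {0..T}" and zT: "0 \<in> {0..T}" using \<tau> tT T by auto
  have energy: "?Y \<tau> + c * \<mu> \<le> (?Y 0 + c * \<mu>) * exp (\<kappa> * \<tau>)"
    using E.energy_bound[OF \<tau>T] by (simp add: \<mu>_def)
  have sl: "AE x in lebesgue_on K. 0 \<le> u (x, s) \<and> u (x, s) \<le> M" if "s \<in> {0..T}" for s
  proof -
    have "AE x in lborel. x \<in> K1 \<longrightarrow> 0 \<le> u (x, s) \<and> u (x, s) \<le> M"
      using C_L2loc_slice_bounds[OF uC T K1 K1\<Omega> bnd that M] unfolding AE_lebesgue_on_iff[OF compact_lebesgue[OF K1]] .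
    then show ?thesis unfolding AE_lebesgue_on_iff[OF Ks(1)] by eventually_elim (use KK1 in auto)
  qed
  have zm: "(\<lambda>x. \<zeta> x ^ m) \<in> borel_measurable borel" by (rule has_C1_deriv_measurable(1)[OF zC1])
  have z1: "\<bar>\<zeta> x ^ m\<bar> \<le> 1" for x using \<zeta>01[of x] by (simp add: power_le_one)
  have fi: "integrable (lebesgue_on K) (?f s)" if "s \<in> {0..T}" for s
    by (rule C_L2loc_powr_continuous(1)[OF uC K(1) K\<Omega> sl zm z1 \<nu>0 r that])
  have f0: "0 \<le> ?f s x" for s x using r \<zeta>01 by simp
  have Y0: "?Y s \<ge> 0" for s by (intro Bochner_Integration.integral_nonneg f0)
  have \<mu>: "0 \<le> \<mu>" "\<mu> \<le> 4 ^ CARD('n) * \<rho> ^ CARD('n)"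
  proof -
    show "0 \<le> \<mu>" by (simp add: \<mu>_def)
    let ?box = "cbox (\<chi> i. - (2 * ?s i)) (\<chi> i. 2 * ?s i) :: (real^'n) set"
    have "K \<subseteq> ?box"
    proof
      fix x assume "x \<in> K"
      then have "\<bar>x $ i\<bar> < 2 * ?s i" for i using KK1 K1s by blast
      then have "- (2 * ?s i) \<le> x $ i \<and> x $ i \<le> 2 * ?s i" for i by (smt (verit))
      then show "x \<in> ?box" by (simp add: mem_box_cart)
    qed
    then have "\<mu> \<le> measure lborel ?box"
      unfolding \<mu>_def using Ks(2) by (intro measure_mono_fmeasurable) auto
    also have "\<dots> = (\<Prod>i\<in>UNIV. 4 * ?s i)"
    proof -
      have "(0::real^'n) \<in> ?box" using s0 by (simp add: mem_box_cart less_imp_le)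
      then show ?thesis by (subst content_cbox_cart) auto
    qed
    also have "\<dots> = 4 ^ CARD('n) * \<rho> ^ CARD('n)"
      using prod_intrinsic_side[OF p q \<rho> t \<nu>] by (simp add: prod.distrib)
    finally show "\<mu> \<le> 4 ^ CARD('n) * \<rho> ^ CARD('n)" .
  qed
  let ?I = "\<integral>\<^sup>+x. ennreal (u (x, 0) powr r) \<partial>lebesgue_on (intrinsic_cube p 2 \<rho> t)"
  \<comment> \<open>On the inner cube \<zeta> >= 1/2, so 2^m \<zeta>^m >= 1 and the cutoff can be
    inserted; points of that cube lie in K because \<zeta> is zero elsewhere.\<close>
  have upper: "(\<integral>\<^sup>+x. ennreal (u (x, \<tau>) powr r) \<partial>lebesgue_on (intrinsic_cube p 1 \<rho> t)) \<le> ennreal (2 ^ m * r * ?Y \<tau>)"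
  proof -
    have "(\<integral>\<^sup>+x. ennreal (u (x, \<tau>) powr r) \<partial>lebesgue_on (intrinsic_cube p 1 \<rho> t))
      = (\<integral>\<^sup>+x. ennreal (u (x, \<tau>) powr r) * indicator (intrinsic_cube p 1 \<rho> t) x \<partial>lebesgue)"
      using cs[of 1] by (intro nn_integral_restrict_space) simp
    also have "\<dots> \<le> (\<integral>\<^sup>+x. ennreal (2 ^ m * r * ?f \<tau> x) * indicator K x \<partial>lebesgue)"
    proof (rule nn_integral_mono_AE)
      have "AE x in lebesgue. x \<in> K \<longrightarrow> 0 \<le> u (x, \<tau>) \<and> u (x, \<tau>) \<le> M"
        using sl[OF \<tau>T] unfolding AE_lebesgue_on_iff[OF Ks(1)] AE_completion_iff .
      then show "AE x in lebesgue. ennreal (u (x, \<tau>) powr r) * indicator (intrinsic_cube p 1 \<rho> t) x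
          \<le> ennreal (2 ^ m * r * ?f \<tau> x) * indicator K x"
      proof eventually_elim
        case (elim x)
        show ?case
        proof (cases "x \<in> intrinsic_cube p 1 \<rho> t")
          case True
          then have half: "1/2 \<le> \<zeta> x" by (intro \<zeta>half) (simp add: intrinsic_cube_eq)
          then have xK: "x \<in> K" using \<zeta>0[of x] by fastforce
          have "(1/2) ^ m \<le> \<zeta> x ^ m" using half by (intro power_mono) auto
          then have "1 \<le> 2 ^ m * \<zeta> x ^ m" by (simp add: power_divide field_simps)
          moreover have "u (x, \<tau>) powr r \<le> (u (x, \<tau>) + \<nu>) powr r" using elim xK \<nu>0 r by (intro powr_mono2) auto
          ultimately have "1 * u (x, \<tau>) powr r \<le> (2 ^ m * \<zeta> x ^ m) * (u (x, \<tau>) + \<nu>) powr r"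
            by (intro mult_mono) auto
          then show ?thesis using xK True r by (simp add: ennreal_leI mult_ac)
        qed simp
      qed
    qed
    also have "\<dots> = (\<integral>\<^sup>+x. ennreal (2 ^ m * r * ?f \<tau> x) \<partial>lebesgue_on K)"
      using Ks(1) by (intro nn_integral_restrict_space[symmetric]) simp
    also have "\<dots> = ennreal (\<integral>x. 2 ^ m * r * ?f \<tau> x \<partial>lebesgue_on K)"
      using \<zeta>01(1) r by (intro nn_integral_eq_integral integrable_mult_right fi \<tau>T AE_I2) simp
    also have "(\<integral>x. 2 ^ m * r * ?f \<tau> x \<partial>lebesgue_on K) = 2 ^ m * r * ?Y \<tau>" by (rule integral_mult_right_zero)
    finally show ?thesis .
  qed
  \<comment> \<open>The shift is undone by (u + \<nu>)^r <= 2^r (u^r + \<nu>^r), and the cutoff is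
    dropped inside the larger cube.\<close>
  have initial: "ennreal (r * ?Y 0) \<le> ennreal (2 powr r) * ?I + ennreal (2 powr r * \<nu> powr r * \<mu>)"
  proof -
    have um: "(\<lambda>x. u (x, 0)) \<in> borel_measurable (lebesgue_on K)"
      using uC zT K(1) K\<Omega> by (auto simp: C_L2loc_def Lloc_def)
    have "ennreal (r * ?Y 0) = ennreal (\<integral>x. r * ?f 0 x \<partial>lebesgue_on K)" by (subst integral_mult_right_zero) simp
    also have "\<dots> = (\<integral>\<^sup>+x. ennreal (r * ?f 0 x) \<partial>lebesgue_on K)"
      using \<zeta>01(1) r by (intro nn_integral_eq_integral[symmetric] integrable_mult_right fi zT AE_I2) simp
    also have "\<dots> \<le> (\<integral>\<^sup>+x. ennreal (2 powr r) * ennreal (u (x, 0) powr r) + ennreal (2 powr r * \<nu> powr r) \<partial>lebesgue_on K)"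
    proof (rule nn_integral_mono_AE)
      show "AE x in lebesgue_on K. ennreal (r * ?f 0 x) \<le> ennreal (2 powr r) * ennreal (u (x, 0) powr r) + ennreal (2 powr r * \<nu> powr r)"
        using sl[OF zT]
      proof eventually_elim
        case (elim x)
        have "r * ?f 0 x = (u (x, 0) + \<nu>) powr r * \<zeta> x ^ m" using r by simp
        also have "\<dots> \<le> (u (x, 0) + \<nu>) powr r * 1" using z1[of x] by (intro mult_left_mono) auto
        also have "\<dots> \<le> 2 powr r * (u (x, 0) powr r + \<nu> powr r)"
          using powr_add_le[of "u (x, 0)" \<nu> r] elim \<nu>0 r by simp
        also have "\<dots> = 2 powr r * u (x, 0) powr r + 2 powr r * \<nu> powr r" by (simp add: distrib_left)
        finally have "ennreal (r * ?f 0 x) \<le> ennreal (2 powr r * u (x, 0) powr r + 2 powr r * \<nu> powr r)" by (rule ennreal_leI)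
        also have "\<dots> = ennreal (2 powr r) * ennreal (u (x, 0) powr r) + ennreal (2 powr r * \<nu> powr r)"
          by (subst ennreal_plus) (auto simp: ennreal_mult)
        finally show ?case .
      qed
    qed
    also have "\<dots> = ennreal (2 powr r) * (\<integral>\<^sup>+x. ennreal (u (x, 0) powr r) \<partial>lebesgue_on K) + ennreal (2 powr r * \<nu> powr r * \<mu>)"
    proof -
      have "emeasure (lebesgue_on K) K = emeasure lborel K"
        using Ks by (simp add: emeasure_restrict_space)
      also have "\<dots> = ennreal \<mu>"
        unfolding \<mu>_def using emeasure_bounded_finite[OF compact_imp_bounded[OF K(1)]]
        by (intro emeasure_eq_ennreal_measure) auto
      finally show ?thesis
        using um \<mu>(1) by (simp add: nn_integral_add nn_integral_cmult ennreal_mult)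
    qed
    also have "(\<integral>\<^sup>+x. ennreal (u (x, 0) powr r) \<partial>lebesgue_on K) \<le> ?I"
    proof -
      have "(\<integral>\<^sup>+x. ennreal (u (x, 0) powr r) \<partial>lebesgue_on K) = (\<integral>\<^sup>+x. ennreal (u (x, 0) powr r) * indicator K x \<partial>lebesgue)"
        using Ks(1) by (intro nn_integral_restrict_space) simp
      also have "\<dots> \<le> (\<integral>\<^sup>+x. ennreal (u (x, 0) powr r) * indicator (intrinsic_cube p 2 \<rho> t) x \<partial>lebesgue)"
        using KK1 K1c by (intro nn_integral_mono) (auto simp: indicator_def)
      also have "\<dots> = ?I" using cs[of 2] by (intro nn_integral_restrict_space[symmetric]) simp
      finally show ?thesis .
    qed
    finally show ?thesis by (simp add: add_mono mult_left_mono)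
  qed
  define a where "a = 2 ^ m * exp (r * G)"
  have a: "a > 0" by (simp add: a_def)
  have "2 ^ m * r * ?Y \<tau> \<le> 2 ^ m * r * ((?Y 0 + c * \<mu>) * exp (r * G))"
  proof (intro mult_left_mono)
    have "?Y \<tau> \<le> ?Y \<tau> + c * \<mu>" using \<mu>(1) r by (simp add: c_def)
    also note energy
    also have "(?Y 0 + c * \<mu>) * exp (\<kappa> * \<tau>) \<le> (?Y 0 + c * \<mu>) * exp (r * G)"
    proof (intro mult_left_mono)
      have "\<kappa> * \<tau> \<le> \<kappa> * t" using \<tau> r G t by (intro mult_left_mono) (auto simp: \<kappa>_def)
      also have "\<dots> = r * G" using t by (simp add: \<kappa>_def)
      finally show "exp (\<kappa> * \<tau>) \<le> exp (r * G)" by simp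
      show "0 \<le> ?Y 0 + c * \<mu>" using Y0[of 0] \<mu>(1) r by (intro add_nonneg_nonneg mult_nonneg_nonneg) (auto simp: c_def)
    qed
    finally show "?Y \<tau> \<le> (?Y 0 + c * \<mu>) * exp (r * G)" .
  qed (use r in simp)
  also have "\<dots> = a * (r * ?Y 0 + \<nu> powr r * \<mu>)" using r by (simp add: a_def c_def algebra_simps)
  finally have "ennreal (2 ^ m * r * ?Y \<tau>) \<le> ennreal (a * (r * ?Y 0 + \<nu> powr r * \<mu>))" by (rule ennreal_leI)
  also have "\<dots> = ennreal a * (ennreal (r * ?Y 0) + ennreal (\<nu> powr r * \<mu>))"
  proof -
    have "0 \<le> r * ?Y 0" using r Y0[of 0] by (intro mult_nonneg_nonneg) auto
    moreover have "0 \<le> \<nu> powr r * \<mu>" using \<mu>(1) by simp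
    ultimately show ?thesis using a by (simp only: ennreal_mult[OF less_imp_le add_nonneg_nonneg] ennreal_plus)
  qed
  also have "\<dots> \<le> ennreal a * ((ennreal (2 powr r) * ?I + ennreal (2 powr r * \<nu> powr r * \<mu>)) + ennreal (\<nu> powr r * \<mu>))"
    by (intro mult_left_mono add_mono initial order_refl) simp
  also have "\<dots> = ennreal (a * 2 powr r) * ?I + ennreal (a * (2 powr r + 1) * (\<nu> powr r * \<mu>))"
  proof -
    have "ennreal (2 powr r * \<nu> powr r * \<mu>) + ennreal (\<nu> powr r * \<mu>) = ennreal ((2 powr r + 1) * (\<nu> powr r * \<mu>))"
      using \<mu>(1) by (subst ennreal_plus[symmetric]) (auto simp: algebra_simps)
    then have "(ennreal (2 powr r) * ?I + ennreal (2 powr r * \<nu> powr r * \<mu>)) + ennreal (\<nu> powr r * \<mu>)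
      = ennreal (2 powr r) * ?I + ennreal ((2 powr r + 1) * (\<nu> powr r * \<mu>))" by (simp only: add.assoc)
    moreover have "ennreal (a * (2 powr r + 1) * (\<nu> powr r * \<mu>)) = ennreal a * ennreal ((2 powr r + 1) * (\<nu> powr r * \<mu>))"
      using a \<mu>(1) by (subst ennreal_mult[symmetric]) (auto simp: mult.assoc)
    moreover have "ennreal (a * 2 powr r) = ennreal a * ennreal (2 powr r)" using a by (simp add: ennreal_mult)
    ultimately show ?thesis by (simp only: distrib_left mult.assoc)
  qed
  also have "\<dots> \<le> ennreal \<gamma> * ?I + ennreal (\<gamma> * (\<rho> ^ CARD('n) * \<nu> powr r))"
  proof (intro add_mono mult_right_mono ennreal_leI)
    have \<gamma>: "\<gamma> = a * (2 powr r + 1) * 4 ^ CARD('n)" by (simp add: \<gamma>_def a_def G_def)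
    have "a * 2 powr r * 1 \<le> a * (2 powr r + 1) * 4 ^ CARD('n)" using a by (intro mult_mono) auto
    then show "a * 2 powr r \<le> \<gamma>" by (simp add: \<gamma>)
    have "a * (2 powr r + 1) * (\<nu> powr r * \<mu>) \<le> a * (2 powr r + 1) * (\<nu> powr r * (4 ^ CARD('n) * \<rho> ^ CARD('n)))"
      using a \<mu>(2) by (intro mult_left_mono) auto
    also have "\<dots> = \<gamma> * (\<rho> ^ CARD('n) * \<nu> powr r)" by (simp add: \<gamma> mult_ac)
    finally show "a * (2 powr r + 1) * (\<nu> powr r * \<mu>) \<le> \<gamma> * (\<rho> ^ CARD('n) * \<nu> powr r)" .
  qed simp
  finally show ?thesis using upper by (rule order_trans[rotated])
qed

theorem theorem5p2:
  fixes p :: "'n::{finite,linorder} \<Rightarrow> real" and q C\<^sub>o C\<^sub>1 r :: real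
  assumes "mono p" and "\<And>i. 1 < p i" and "\<And>i. p i < 2"
    and q_def: "q = harmonic_mean p" and "q < real CARD('n)"
    and "C\<^sub>o > 0" and "C\<^sub>1 > 0" and "r > 1"
  shows "\<exists>\<gamma>>0.
    \<forall>(\<Omega> :: (real^'n::{finite,linorder}) set) (T::real) (C::real) A B u.
      open \<Omega> \<and> bounded \<Omega> \<and> T > 0 \<and> C \<ge> 0 \<and>
      caratheodory \<Omega> T A \<and> caratheodory \<Omega> T B \<and> structure_conditions \<Omega> T p C\<^sub>o C\<^sub>1 C A B \<and>
      local_weak_solution \<Omega> T p A B u \<and>
      (AE z in lebesgue_on (\<Omega> \<times> {0..T}). u z \<ge> 0) \<and>
      locally_bounded (\<Omega> \<times> {0..T}) u \<and> Lloc r (\<Omega> \<times> {0..T}) u \<longrightarrow>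
      (\<forall>t>0. \<forall>\<rho>>0. intrinsic_cube p 2 \<rho> t \<times> {0..t} \<subseteq> \<Omega> \<times> {0..T} \<longrightarrow>
        (let \<nu> = (t / \<rho> powr q) powr (1 / (2 - q));
             \<Lambda> = real CARD('n) * (q - 2) + q * r
         in (\<exists>i. C powr p i * \<rho> powr q > Min {1, \<nu> powr (q - p i), \<nu> powr q}) \<or>
            (SUP \<tau>\<in>{0..t}. \<integral>\<^sup>+x. ennreal (u (x, \<tau>) powr r) \<partial>lebesgue_on (intrinsic_cube p 1 \<rho> t))
            \<le> ennreal \<gamma> * (\<integral>\<^sup>+x. ennreal (u (x, 0) powr r) \<partial>lebesgue_on (intrinsic_cube p 2 \<rho> t))
              + ennreal (\<gamma> * (t powr r / \<rho> powr \<Lambda>) powr (1 / (2 - q)))))"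
proof -
  note p = assms(2,3)
  \<comment> \<open>One power m has to satisfy the lower bound of every direction; the sum dominates
    each requirement, and the added 2 gives m >= 2.\<close>
  define m0 where "m0 i = nat \<lceil>p i + p i / (2 - p i) * (r - 2 + p i)\<rceil>" for i
  define m where "m = 2 + (\<Sum>i\<in>UNIV. m0 i)"
  have m2: "m \<ge> 2" by (simp add: m_def)
  have m: "real m \<ge> p i + p i / (2 - p i) * (r - 2 + p i)" for i
  proof -
    have "p i + p i / (2 - p i) * (r - 2 + p i) \<le> real (m0 i)" unfolding m0_def by (rule real_nat_ceiling_ge)
    also have "m0 i \<le> m" unfolding m_def by (rule trans_le_add2, rule member_le_sum) auto
    finally show ?thesis by simp
  qed
  \<comment> \<open>This L is the p_i-th power of the constant 4^N in the gradient bound of the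
    cutoff.\<close>
  note ex = pointwise_energy[OF p assms(8,6,7) _ m m2, where L="(4 ^ CARD('n)) powr p i" for i]
  obtain \<Gamma> where \<Gamma>: "\<And>i. \<Gamma> i \<ge> 0" and point: "\<And>i w \<nu> t K \<zeta> d \<xi> A. \<nu> > 0 \<Longrightarrow> w \<ge> \<nu> \<Longrightarrow> t > 0 \<Longrightarrow> K \<ge> 0 \<Longrightarrow> 0 \<le> \<zeta> \<Longrightarrow> \<zeta> \<le> 1 \<Longrightarrow>
      t * \<bar>d\<bar> powr p i \<le> (4 ^ CARD('n)) powr p i * \<nu> powr (2 - p i) \<Longrightarrow> t * K powr p i \<le> \<nu>\<^sup>2 \<Longrightarrow>
      t * K powr p i \<le> \<nu> powr (2 - p i) \<Longrightarrow>
      t * K powr p i \<le> \<nu> \<Longrightarrow> A * \<xi> \<ge> C\<^sub>o * \<bar>\<xi>\<bar> powr p i - K powr p i \<Longrightarrow>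
      \<bar>A\<bar> \<le> C\<^sub>1 * \<bar>\<xi>\<bar> powr (p i - 1) + K powr (p i - 1) \<Longrightarrow>
      K * (\<bar>\<xi>\<bar> powr (p i - 1) + K powr (p i - 1)) * (w powr (r - 1) * \<zeta> ^ m)
        - A * ((r - 1) * w powr (r - 2) * \<xi> * \<zeta> ^ m + w powr (r - 1) * (real m * \<zeta> ^ (m - 1) * d))
      \<le> \<Gamma> i / t * (w powr r * \<zeta> ^ m + \<nu> powr r)"
  proof -
    let ?P = "\<lambda>i \<Gamma>. \<Gamma> \<ge> 0 \<and> (\<forall>w \<nu> t K \<zeta> d \<xi> A. \<nu> > 0 \<longrightarrow> w \<ge> \<nu> \<longrightarrow> t > 0 \<longrightarrow> K \<ge> 0 \<longrightarrow> 0 \<le> \<zeta> \<longrightarrow> \<zeta> \<le> 1 \<longrightarrow>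
      t * \<bar>d\<bar> powr p i \<le> (4 ^ CARD('n)) powr p i * \<nu> powr (2 - p i) \<longrightarrow> t * K powr p i \<le> \<nu>\<^sup>2 \<longrightarrow>
      t * K powr p i \<le> \<nu> powr (2 - p i) \<longrightarrow>
      t * K powr p i \<le> \<nu> \<longrightarrow> A * \<xi> \<ge> C\<^sub>o * \<bar>\<xi>\<bar> powr p i - K powr p i \<longrightarrow>
      \<bar>A\<bar> \<le> C\<^sub>1 * \<bar>\<xi>\<bar> powr (p i - 1) + K powr (p i - 1) \<longrightarrow>
      K * (\<bar>\<xi>\<bar> powr (p i - 1) + K powr (p i - 1)) * (w powr (r - 1) * \<zeta> ^ m)
        - A * ((r - 1) * w powr (r - 2) * \<xi> * \<zeta> ^ m + w powr (r - 1) * (real m * \<zeta> ^ (m - 1) * d))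
      \<le> \<Gamma> / t * (w powr r * \<zeta> ^ m + \<nu> powr r))"
    have "\<forall>i. \<exists>\<Gamma>. ?P i \<Gamma>" by (intro allI ex) simp
    from choice[OF this] obtain \<Gamma> where \<Gamma>: "\<forall>i. ?P i (\<Gamma> i)" by blast
    show ?thesis
    proof (rule that)
      show "\<Gamma> i \<ge> 0" for i using \<Gamma> by blast
    qed (use \<Gamma> in blast)
  qed
  \<comment> \<open>Built from p, r, N and the structure constants through m and \<Gamma>, before
    the domain, the constant C, the coefficients and the solution are introduced.\<close>
  define \<gamma> :: real where "\<gamma> = 2 ^ m * exp (r * (\<Sum>i\<in>UNIV. \<Gamma> i)) * (2 powr r + 1) * 4 ^ CARD('n)"
  have \<gamma>: "\<gamma> > 0" unfolding \<gamma>_def by (intro mult_pos_pos add_pos_pos) auto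
  show ?thesis
  \<comment> \<open>Negating the first alternative gives the smallness of C in every direction; the
    supremum is then bounded at each \<tau> separately.\<close>
  proof (intro exI[of _ \<gamma>] conjI \<gamma> allI impI, unfold Let_def, rule disj_imp[THEN iffD2], rule impI, rule SUP_least, goal_cases)
    case (1 \<Omega> T C A B u t \<rho> \<tau>)
    define \<nu> where "\<nu> = (t / \<rho> powr q) powr (1 / (2 - q))"
    have small: "C powr p i * \<rho> powr q \<le> Min {1, \<nu> powr (q - p i), \<nu> powr q}" for i
      using 1 by (auto simp: \<nu>_def not_less)
    have sub: "local_weak_subsolution \<Omega> T p A B u" using 1 by (simp add: local_weak_solution_def)
    show ?case
      unfolding intrinsic_volume[OF p q_def \<open>0 < \<rho>\<close> \<open>0 < t\<close> refl] \<gamma>_def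
      using 1 by (intro Lr_estimate[OF p q_def assms(7,8) m2 \<Gamma> point _ _ _ _ _ _ sub _ _ _ _ _ refl small[unfolded \<nu>_def]]) auto
  qed
qed

end
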